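(* There exists a universal constant $K>0$ such that the following holds. Fix a $d$-dimensional quantum state $\sigma$ and let $\gamma$ be its minimum eigenvalue. (i) For any $\theta\ge0$, if $T\ge K\cdot\max\{\frac{d}{\theta},\frac{\sqrt d}{\sqrt{\theta\gamma}}\}$, there is an algorithm which, given one copy each of unknown $d$-dimensional states $\rho_1,\dots,\rho_T$ (i.e., given $\rho_1\otimes\cdots\otimes\rho_T$), distinguishes with probability at least $0.99$ the case $D_{\chi^2}(\rho_{\mathrm{avg}}\,\|\,\sigma)\le0.99\,\theta$ from the case $D_{\chi^2}(\rho_{\mathrm{avg}}\,\|\,\sigma)>\theta$. (ii) For any $\varepsilon>0$, if $T\ge K\cdot\frac{d}{\varepsilon^2}$, there is an algorithm which, given one copy each of $\rho_1,\dots,\rho_T$, distinguishes with probability at least $0.99$ the case $\rho_{\mathrm{avg}}=\sigma$ from the case $D_{\mathrm{tr}}(\rho_{\mathrm{avg}},\sigma)>\varepsilon$. Here $\rho_{\mathrm{avg}}=\frac1T\sum_{t=1}^T\rho_t$.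
   Context: $D_{\mathrm{tr}}(\rho,\sigma)=\frac12\|\rho-\sigma\|_1$. The Bures $\chi^2$-divergence is defined as follows: write $\sigma=U\,\mathrm{diag}(q_1,\dots,q_d)\,U^\dagger$ with $U$ unitary, and let $\rho'=U^\dagger\rho U$; then $D_{\chi^2}(\rho\,\|\,\sigma)=\sum_{i,j=1}^d\frac{2}{q_i+q_j}|\rho'_{ij}|^2-1$, with conventions $0/0=0$ and $x/0=\infty$ for $x>0$. The algorithm may apply any quantum measurement to $\rho_1\otimes\cdots\otimes\rho_T$ (chosen depending on $d,\sigma$, the distance parameter, and $T$ only) and outputs accept/reject; "distinguishes with probability at least $0.99$" means it accepts with probability at least $0.99$ in the first case and rejects with probability at least $0.99$ in the second case. *)

theory Defs
  imports "Jordan_Normal_Form.Schur_Decomposition" "Jordan_Normal_Form.Spectral_Radius"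
    "HOL-Library.Extended_Real"
begin

definition mtrace :: "complex mat \<Rightarrow> complex" where
  "mtrace A = (\<Sum>i<dim_row A. A $$ (i,i))"

definition hermitian_mat :: "complex mat \<Rightarrow> bool" where
  "hermitian_mat A \<longleftrightarrow> mat_adjoint A = A"

definition psd_mat :: "nat \<Rightarrow> complex mat \<Rightarrow> bool" where
  "psd_mat n A \<longleftrightarrow> A \<in> carrier_mat n n \<and> hermitian_mat A \<and>
     (\<forall>v \<in> carrier_vec n. Re ((A *\<^sub>v v) \<bullet>c v) \<ge> 0)"

definition density_mat :: "nat \<Rightarrow> complex mat \<Rightarrow> bool" where
  "density_mat d \<rho> \<longleftrightarrow> psd_mat d \<rho> \<and> mtrace \<rho> = 1"

definition unitary_mat :: "nat \<Rightarrow> complex mat \<Rightarrow> bool" where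
  "unitary_mat d U \<longleftrightarrow> U \<in> carrier_mat d d \<and> mat_adjoint U * U = 1\<^sub>m d"

definition kron :: "complex mat \<Rightarrow> complex mat \<Rightarrow> complex mat" where
  "kron A B = mat (dim_row A * dim_row B) (dim_col A * dim_col B)
     (\<lambda>(i,j). A $$ (i div dim_row B, j div dim_col B) * B $$ (i mod dim_row B, j mod dim_col B))"

definition tensor_all :: "nat \<Rightarrow> (nat \<Rightarrow> complex mat) \<Rightarrow> complex mat" where
  "tensor_all T \<rho> = foldr kron (map \<rho> [0..<T]) (1\<^sub>m 1)"

definition avg_state :: "nat \<Rightarrow> nat \<Rightarrow> (nat \<Rightarrow> complex mat) \<Rightarrow> complex mat" where
  "avg_state d T \<rho> = mat d d (\<lambda>(i,j). (\<Sum>t<T. \<rho> t $$ (i,j)) / of_nat T)"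

definition min_eigenvalue :: "complex mat \<Rightarrow> real" where
  "min_eigenvalue A = Min (Re ` spectrum A)"

(* Bures chi^2-divergence, per the paper's definition, with 0/0 = 0 and x/0 = \<infinity> for x > 0 *)
definition chi2_term :: "real \<Rightarrow> real \<Rightarrow> ereal" where
  "chi2_term a s = (if a = 0 then 0 else if s = 0 then \<infinity> else ereal (a / s))"

definition D_chi2 :: "nat \<Rightarrow> complex mat \<Rightarrow> complex mat \<Rightarrow> ereal" where
  "D_chi2 d \<rho> \<sigma> = (SOME v. \<exists>U q. unitary_mat d U \<and>
      \<sigma> = U * mat_diag d (\<lambda>i. complex_of_real (q i)) * mat_adjoint U \<and>
      v = (\<Sum>i<d. \<Sum>j<d. chi2_term (2 * (cmod ((mat_adjoint U * \<rho> * U) $$ (i,j)))\<^sup>2) (q i + q j)) - 1)"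

definition trace_norm_herm :: "nat \<Rightarrow> complex mat \<Rightarrow> real" where
  "trace_norm_herm d A = (SOME v. \<exists>U l. unitary_mat d U \<and>
      A = U * mat_diag d (\<lambda>i. complex_of_real (l i)) * mat_adjoint U \<and>
      v = (\<Sum>i<d. \<bar>l i\<bar>))"

definition D_tr :: "nat \<Rightarrow> complex mat \<Rightarrow> complex mat \<Rightarrow> real" where
  "D_tr d \<rho> \<sigma> = trace_norm_herm d (\<rho> - \<sigma>) / 2"

(* two-outcome measurement (accept effect M, reject effect I - M) on n-dim space *)
definition accept_effect :: "nat \<Rightarrow> complex mat \<Rightarrow> bool" where
  "accept_effect n M \<longleftrightarrow> psd_mat n M \<and> psd_mat n (1\<^sub>m n - M)"

definition accept_prob :: "complex mat \<Rightarrow> complex mat \<Rightarrow> real" where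
  "accept_prob M R = Re (mtrace (M * R))"

end

theory Submission
  imports Defs "HOL-Analysis.L2_Norm"
begin

text \<open>
  Work in an eigenbasis of \<open>\<sigma>\<close> and put \<open>\<Delta> = \<rho>\<^sub>a\<^sub>v\<^sub>g - \<sigma>\<close>. For positive weights \<open>\<alpha>\<close> the
  quadratic form \<open>\<chi> = \<Sum>\<^sub>i\<^sub>j 2 / (\<alpha>\<^sub>i + \<alpha>\<^sub>j) \<bar>\<Delta>\<^sub>i\<^sub>j\<bar>\<^sup>2\<close> is the expectation of a two-copy observable, centred at
  \<open>\<sigma>\<close> on each factor. Summing that observable over all ordered pairs of distinct copies gives an
  observable on the product state whose mean is \<open>T\<^sup>2 \<chi>\<close> up to a small bias. After subtracting the true
  means copy by copy, its fluctuation splits into pairwise and single-copy terms, and only terms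
  supported on the same copies are correlated. Together with \<open>\<bar>\<rho>\<^sub>i\<^sub>j\<bar>\<^sup>2 \<le> \<rho>\<^sub>i\<^sub>i \<rho>\<^sub>j\<^sub>j\<close> and
  \<open>2 / (\<alpha>\<^sub>i + \<alpha>\<^sub>j) \<le> 1 / \<surd>(\<alpha>\<^sub>i \<alpha>\<^sub>j)\<close> this bounds bias and standard deviation by a small multiple of
  \<open>T\<^sup>2 max(\<theta>, \<chi>)\<close>, so thresholding the observable decides between \<open>\<chi> \<le> 0.99 \<theta>\<close> and \<open>\<chi> > \<theta>\<close>.
  For (i) the weights are the eigenvalues of \<open>\<sigma>\<close>, and \<open>\<chi>\<close> is the Bures divergence. For (ii) they are
  the eigenvalues of \<open>(\<sigma> + I / d) / 2\<close>, which are at least \<open>1 / (2 d)\<close>, and Cauchy-Schwarz gives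
  \<open>\<chi> \<ge> 4 D\<^sub>t\<^sub>r\<^sup>2\<close>.
\<close>

text \<open>The copies need not be alike: a single \<open>\<rho> t\<close> may be far from
  \<open>\<sigma>\<close> although the average is close. So errors of single copies are bounded by
  quantities that are linear in the state, because their sums over the copies depend on the average
  alone. The main one is the trace of \<open>\<rho> t\<close> against the inverse of the weights,
  whose sum is at most T (2 d + sqrt(\<chi> d / \<gamma>)). The two sample conditions say that this
  sum is small against T^2 max(\<theta>, \<chi>): the summand 2 d asks that T \<theta> exceed d, the
  root asks that T^2 \<theta> \<gamma> exceed d, each by a large constant factor. Errors are
  measured against max(\<theta>, \<chi>) because \<chi> has no upper bound in the rejecting case and
  the fluctuation grows with it. The spectrum q of \<sigma> and the weights \<alpha> are kept apart,
  linked by q \<le> 2 \<alpha>; this holds both for equal spectra and after averaging with the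
  maximally mixed state, so one analysis serves both parts. Divergence and trace norm are defined by
  a choice among diagonalisations, so the divergence also has to be shown independent of the
  eigenbasis.\<close>

section \<open>Digits and tensor products\<close>

text \<open>Base \<open>d\<close> digits are counted from the most significant one, as in \<^const>\<open>kron\<close>.\<close>
definition dig :: "nat \<Rightarrow> nat \<Rightarrow> nat \<Rightarrow> nat \<Rightarrow> nat" where
  "dig d T t a = a div d ^ (T - Suc t) mod d"

lemma dig_less: "0 < d \<Longrightarrow> dig d T t a < d"
  by (simp add: dig_def)

lemma dig_Suc_0: "a < d ^ Suc T \<Longrightarrow> dig d (Suc T) 0 a = a div d ^ T"
  by (simp add: dig_def less_mult_imp_div_less)

lemma dig_Suc_Suc:
  assumes "t < T"
  shows "dig d (Suc T) (Suc t) a = dig d T t (a mod d ^ T)"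
proof -
  define k where "k = T - Suc t"
  have "T = Suc k + t" using assms by (simp add: k_def)
  then have e: "d ^ T = d ^ k * (d * d ^ t)" by (simp add: power_add mult_ac)
  have "a mod d ^ T div d ^ k = a div d ^ k mod (d * d ^ t)"
    unfolding e by (cases "d ^ k = 0") (simp_all add: mod_mult2_eq)
  then show ?thesis
    by (simp add: dig_def k_def[symmetric] mod_mod_cancel)
qed

lemma sum_div_mod:
  fixes g :: "nat \<Rightarrow> nat \<Rightarrow> 'a::comm_monoid_add"
  shows "(\<Sum>a<m * n. g (a div n) (a mod n)) = (\<Sum>i<m. \<Sum>j<n. g i j)"
proof -
  have "(\<Sum>a<m * n. g (a div n) (a mod n)) = (\<Sum>(i,j)\<in>{..<m} \<times> {..<n}. g i j)"
  proof (rule sum.reindex_bij_witness[where i = "\<lambda>(i,j). i * n + j" and j = "\<lambda>a. (a div n, a mod n)"], goal_cases)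
    case (2 a)
    then have "0 < n" by (cases n) auto
    with 2 show ?case by (auto simp: less_mult_imp_div_less)
  next
    case (4 b)
    then obtain i j where b: "b = (i,j)" "i < m" "j < n" by auto
    have "Suc i * n \<le> m * n" using b by (intro mult_right_mono) auto
    then have "i * n + j < m * n" using b by simp
    then show ?case using b by simp
  qed auto
  then show ?thesis by (simp add: sum.cartesian_product)
qed

text \<open>Distributivity of products over sums, with the choice of one index per copy coded as a
  number below \<open>d ^ T\<close>. Together with \<open>tensor_all_index\<close> it replaces
  matrix algebra on the tensor space: traces on product states become products of traces.\<close>

lemma sum_prod_dig:
  fixes f :: "nat \<Rightarrow> nat \<Rightarrow> 'a::comm_semiring_1"
  shows "(\<Sum>a<d ^ T. \<Prod>t<T. f t (dig d T t a)) = (\<Prod>t<T. \<Sum>i<d. f t i)"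
proof (induction T arbitrary: f)
  case (Suc T)
  have "(\<Sum>a<d ^ Suc T. \<Prod>t<Suc T. f t (dig d (Suc T) t a))
      = (\<Sum>a<d * d ^ T. f 0 (a div d ^ T) * (\<Prod>t<T. f (Suc t) (dig d T t (a mod d ^ T))))"
    unfolding power_Suc[symmetric]
    by (intro sum.cong refl)
      (simp only: prod.lessThan_Suc_shift lessThan_iff dig_Suc_0,
        auto intro!: arg_cong2[of _ _ _ _ times] prod.cong simp: dig_Suc_Suc)
  also have "\<dots> = (\<Sum>i<d. \<Sum>b<d ^ T. f 0 i * (\<Prod>t<T. f (Suc t) (dig d T t b)))"
    by (rule sum_div_mod)
  also have "\<dots> = (\<Sum>i<d. f 0 i) * (\<Prod>t<T. \<Sum>i<d. f (Suc t) i)"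
    using Suc.IH[of "\<lambda>t. f (Suc t)"] by (simp add: sum_distrib_left[symmetric] sum_distrib_right[symmetric])
  finally show ?case by (simp only: prod.lessThan_Suc_shift)
qed simp

lemma tensor_all_Suc: "tensor_all (Suc T) X = kron (X 0) (tensor_all T (\<lambda>t. X (Suc t)))"
  by (simp add: tensor_all_def map_upt_Suc del: upt_Suc)

lemma tensor_all_carrier:
  "\<forall>t<T. X t \<in> carrier_mat d d \<Longrightarrow> tensor_all T X \<in> carrier_mat (d ^ T) (d ^ T)"
proof (induction T arbitrary: X)
  case 0
  show ?case by (simp add: tensor_all_def)
next
  case (Suc T)
  have "X 0 \<in> carrier_mat d d" "tensor_all T (\<lambda>t. X (Suc t)) \<in> carrier_mat (d ^ T) (d ^ T)"
    using Suc by auto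
  then show ?case by (auto simp: tensor_all_Suc kron_def)
qed

lemma tensor_all_index:
  "\<forall>t<T. X t \<in> carrier_mat d d \<Longrightarrow> a < d ^ T \<Longrightarrow> b < d ^ T \<Longrightarrow>
    tensor_all T X $$ (a,b) = (\<Prod>t<T. X t $$ (dig d T t a, dig d T t b))"
proof (induction T arbitrary: X a b)
  case 0
  then show ?case by (simp add: tensor_all_def)
next
  case (Suc T)
  have X: "X 0 \<in> carrier_mat d d" "tensor_all T (\<lambda>t. X (Suc t)) \<in> carrier_mat (d ^ T) (d ^ T)"
    using Suc.prems by (auto intro!: tensor_all_carrier)
  have "0 < d" using Suc.prems by (cases d) auto
  then have p: "0 < d ^ T" by simp
  have "tensor_all T (\<lambda>t. X (Suc t)) $$ (a mod d ^ T, b mod d ^ T) =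
      (\<Prod>t<T. X (Suc t) $$ (dig d T t (a mod d ^ T), dig d T t (b mod d ^ T)))"
    using Suc.prems p by (intro Suc.IH) auto
  also have "\<dots> = (\<Prod>t<T. X (Suc t) $$ (dig d (Suc T) (Suc t) a, dig d (Suc T) (Suc t) b))"
    by (intro prod.cong) (auto simp: dig_Suc_Suc)
  finally show ?case
    using X Suc.prems carrier_matD[OF X(1)] carrier_matD[OF X(2)]
    by (simp only: prod.lessThan_Suc_shift dig_Suc_0) (simp add: tensor_all_Suc kron_def)
qed

section \<open>Spectral theorem\<close>

lemma adjoint_index: "mat_adjoint A = mat (dim_col A) (dim_row A) (\<lambda>(i,j). cnj (A $$ (j,i)))"
  unfolding mat_adjoint_def by (rule eq_matI) (auto simp: mat_of_rows_index)

lemma adjoint_carrier [simp]: "(A::complex mat) \<in> carrier_mat n m \<Longrightarrow> mat_adjoint A \<in> carrier_mat m n"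
  by (auto simp: adjoint_index)

lemma adjoint_mult:
  fixes A B :: "complex mat"
  assumes "A \<in> carrier_mat n m" "B \<in> carrier_mat m k"
  shows "mat_adjoint (A * B) = mat_adjoint B * mat_adjoint A"
  by (rule eq_matI) (use assms in \<open>auto simp: adjoint_index scalar_prod_def mult.commute\<close>)

lemma adjoint_adjoint [simp]: "mat_adjoint (mat_adjoint A) = (A::complex mat)"
  by (rule eq_matI) (auto simp: adjoint_index)

lemma unitary_mat_right:
  assumes "unitary_mat n U"
  shows "U * mat_adjoint U = 1\<^sub>m n"
  using assms mat_mult_left_right_inverse[of "mat_adjoint U" n U]
  by (auto simp: unitary_mat_def)

lemma unitary_mat_mult:
  assumes "unitary_mat n U" "unitary_mat n V"
  shows "unitary_mat n (U * V)"
proof -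
  have U: "U \<in> carrier_mat n n" "mat_adjoint U * U = 1\<^sub>m n"
    and V: "V \<in> carrier_mat n n" "mat_adjoint V * V = 1\<^sub>m n"
    using assms by (auto simp: unitary_mat_def)
  have "mat_adjoint (U * V) * (U * V) = mat_adjoint V * (mat_adjoint U * U * V)"
    using U(1) V(1) by (simp add: adjoint_mult[of _ n n _ n] assoc_mult_mat[of _ n n _ n _ n])
  then show ?thesis using U V by (simp add: unitary_mat_def)
qed

text \<open>Complete \<open>v\<close> to a basis and orthogonalise, starting from \<open>v\<close>.
  Only a multiple of \<open>v\<close> can be promised, since the column has unit length.\<close>

lemma unitary_first_column:
  assumes v: "v \<in> carrier_vec n" and v0: "v \<noteq> 0\<^sub>v n"
  shows "\<exists>W c. unitary_mat n W \<and> col W 0 = c \<cdot>\<^sub>v v"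
proof -
  interpret cof_vec_space n "TYPE(complex)" .
  define bs where "bs = basis_completion v"
  define ws where "ws = gram_schmidt n bs"
  note b = basis_completion[OF v v0, folded bs_def]
  have hd: "bs = v # tl bs"
    using b(6,7) v v0 by (cases bs) auto
  note g = gram_schmidt_result[OF b(2) b(4) b(5) ws_def]
  have n: "0 < n" using v v0 by (cases n) auto
  have len: "length ws = n" using g b by simp
  have "hd ws = v" using gram_schmidt_hd[OF v, of "tl bs"] hd ws_def by simp
  then have ws0: "ws ! 0 = v" using len n by (cases ws) auto
  \<comment> \<open>\<open>gram_schmidt\<close> yields pairwise orthogonal nonzero vectors without
    normalising them; \<open>c w\<close> is the missing inverse length.\<close>
  define c where "c w = complex_of_real (1 / sqrt (Re (w \<bullet>c w)))" for w :: "complex vec"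
  define W where "W = mat_of_cols n (map (\<lambda>w. c w \<cdot>\<^sub>v w) ws)"
  have W: "W \<in> carrier_mat n n" unfolding W_def using len by (auto simp: mat_of_cols_def)
  have wsc: "ws ! i \<in> carrier_vec n" if "i < n" for i using g(3) len that by auto
  have colW: "col W i = c (ws ! i) \<cdot>\<^sub>v ws ! i" if "i < n" for i
    unfolding W_def using that len wsc[OF that] by (subst col_mat_of_cols) auto
  have "(mat_adjoint W * W) $$ (i,j) = 1\<^sub>m n $$ (i,j)" if i: "i < n" and j: "j < n" for i j
  proof -
    have "(mat_adjoint W * W) $$ (i,j) = col W j \<bullet>c col W i"
      using W i j by (auto simp: adjoint_index scalar_prod_def intro!: sum.cong)
    also have "\<dots> = c (ws ! j) * cnj (c (ws ! i)) * (ws ! j \<bullet>c ws ! i)"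
      using wsc[OF i] wsc[OF j] by (simp add: colW i j scalar_prod_def sum_distrib_left mult_ac)
    also have "\<dots> = (if i = j then 1 else 0)"
    proof (cases "i = j")
      case True
      let ?s = "ws ! j \<bullet>c ws ! j"
      have "?s = of_real (\<Sum>k<n. (cmod (ws ! j $ k))\<^sup>2)"
        using wsc[OF j] by (auto simp: scalar_prod_def complex_norm_square lessThan_atLeast0 simp del: of_real_power intro!: sum.cong)
      then obtain s where s: "?s = of_real s" "s \<ge> 0" by (metis sum_nonneg zero_le_power2)
      have "?s \<noteq> 0" using corthogonalD[OF g(2), of j j] len j by simp
      then have "s > 0" using s by auto
      then show ?thesis using True
        by (simp add: c_def s flip: of_real_mult)
    next
      case False
      then have "ws ! j \<bullet>c ws ! i = 0" using corthogonalD[OF g(2), of j i] len i j by simp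
      then show ?thesis using False by simp
    qed
    finally show ?thesis using i j by simp
  qed
  then have "mat_adjoint W * W = 1\<^sub>m n"
    using W by (intro eq_matI) (auto simp: adjoint_index)
  then show ?thesis using W colW[OF n] ws0 by (auto simp: unitary_mat_def)
qed

text \<open>The direct sum of a scalar and a matrix. With the scalar in front, the old indices are
  shifted by \<open>Suc\<close>, which fits the case split on the index in the induction
  below.\<close>

definition dsum1 :: "complex \<Rightarrow> nat \<Rightarrow> complex mat \<Rightarrow> complex mat" where
  "dsum1 e n A = four_block_mat (mat 1 1 (\<lambda>_. e)) (0\<^sub>m 1 n) (0\<^sub>m n 1) A"

lemma dsum1_carrier [simp]: "A \<in> carrier_mat n n \<Longrightarrow> dsum1 e n A \<in> carrier_mat (Suc n) (Suc n)"
  using four_block_carrier_mat[of "mat 1 1 (\<lambda>_. e)" 1 1 A n n] by (simp add: dsum1_def)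

lemma dsum1_mult:
  assumes "A \<in> carrier_mat n n" "B \<in> carrier_mat n n"
  shows "dsum1 e n A * dsum1 f n B = dsum1 (e * f) n (A * B)"
proof -
  have e: "mat 1 1 (\<lambda>_. e) * mat 1 1 (\<lambda>_. f) = mat 1 1 (\<lambda>_. e * f)"
    by (rule eq_matI) (auto simp: scalar_prod_def)
  show ?thesis unfolding dsum1_def
    by (subst mult_four_block_mat[of _ 1 1 _ n _ n _ _ 1 _ n]) (use assms e in auto)
qed

lemma dsum1_adjoint:
  assumes "A \<in> carrier_mat n n"
  shows "mat_adjoint (dsum1 e n A) = dsum1 (cnj e) n (mat_adjoint A)"
  by (rule eq_matI) (use assms in \<open>auto simp: adjoint_index dsum1_def\<close>)

lemma dsum1_diag:
  "dsum1 (f 0) n (mat_diag n (\<lambda>i. f (Suc i))) = mat_diag (Suc n) f"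
  by (rule eq_matI) (auto simp: dsum1_def mat_diag_def)

lemma dsum1_one: "dsum1 1 n (1\<^sub>m n) = 1\<^sub>m (Suc n)"
  using dsum1_diag[of "\<lambda>_. 1"] by simp

text \<open>Deflation: with an eigenvector as first column of the unitary \<open>W\<close>,
  conjugating \<open>A\<close> by \<open>W\<close> gives the first column (e, 0, ..., 0).
  Hermiticity then clears the rest of the first row and makes e real, and the induction hypothesis
  diagonalises the remaining block.\<close>

theorem hermitian_spectral:
  assumes "A \<in> carrier_mat n n" "hermitian_mat A"
  shows "\<exists>U l. unitary_mat n U \<and> A = U * mat_diag n (\<lambda>i. complex_of_real (l i)) * mat_adjoint U"
  using assms
proof (induction n arbitrary: A)
  case 0
  show ?case
    by (rule exI[of _ "1\<^sub>m 0"]) (use 0 in \<open>auto simp: unitary_mat_def adjoint_index intro!: eq_matI\<close>)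
next
  case (Suc n)
  let ?n = "Suc n"
  note A = Suc.prems(1)
  have hA: "mat_adjoint A = A" using Suc.prems(2) by (simp add: hermitian_mat_def)
  obtain e v where ev: "eigenvector A v e"
    using spectrum_non_empty[OF A] by (auto simp: spectrum_def eigenvalue_def)
  then have v: "v \<in> carrier_vec ?n" "v \<noteq> 0\<^sub>v ?n" and Av: "A *\<^sub>v v = e \<cdot>\<^sub>v v"
    using A by (auto simp: eigenvector_def)
  obtain W c where W: "unitary_mat ?n W" and col0: "col W 0 = c \<cdot>\<^sub>v v"
    using unitary_first_column[OF v] by blast
  have Wc: "W \<in> carrier_mat ?n ?n" and WW: "mat_adjoint W * W = 1\<^sub>m ?n" "W * mat_adjoint W = 1\<^sub>m ?n"
    using W unitary_mat_right[OF W] by (auto simp: unitary_mat_def)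
  define B where "B = mat_adjoint W * A * W"
  have Bc: "B \<in> carrier_mat ?n ?n" unfolding B_def
    by (rule mult_carrier_mat[OF mult_carrier_mat[OF adjoint_carrier[OF Wc] A] Wc])
  have hB: "mat_adjoint B = B" unfolding B_def using A Wc hA
    by (simp add: adjoint_mult[of _ ?n ?n _ ?n] assoc_mult_mat[of _ ?n ?n _ ?n _ ?n])
  have Bsym: "B $$ (i,j) = cnj (B $$ (j,i))" if "i < ?n" "j < ?n" for i j
  proof -
    have "B $$ (i,j) = mat_adjoint B $$ (i,j)" by (simp add: hB)
    also have "\<dots> = cnj (B $$ (j,i))" using that Bc by (simp add: adjoint_index)
    finally show ?thesis .
  qed
  have Acol: "col (A * W) 0 = e \<cdot>\<^sub>v col W 0"
  proof -
    have "col (A * W) 0 = A *\<^sub>v col W 0" by (rule col_mult2[OF A Wc]) simp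
    also have "\<dots> = c \<cdot>\<^sub>v (A *\<^sub>v v)" using A v by (simp add: col0 mult_mat_vec)
    also have "\<dots> = e \<cdot>\<^sub>v col W 0" by (simp add: Av col0 smult_smult_assoc mult.commute)
    finally show ?thesis .
  qed
  have B0: "B $$ (i,0) = (if i = 0 then e else 0)" if i: "i < ?n" for i
  proof -
    have "B $$ (i,0) = (mat_adjoint W * (A * W)) $$ (i,0)"
      using A Wc by (simp add: B_def assoc_mult_mat[of _ ?n ?n _ ?n _ ?n])
    also have "\<dots> = row (mat_adjoint W) i \<bullet> col (A * W) 0" using i A Wc by (simp add: adjoint_index)
    also have "\<dots> = e * (row (mat_adjoint W) i \<bullet> col W 0)" using Acol Wc i by (simp add: adjoint_index)
    also have "row (mat_adjoint W) i \<bullet> col W 0 = (mat_adjoint W * W) $$ (i,0)"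
      using i Wc by (simp add: adjoint_index)
    finally show ?thesis using WW i by simp
  qed
  have e_real: "e = of_real (Re e)"
    using Bsym[of 0 0] B0[of 0] by (simp add: complex_eq_iff)
  define B2 where "B2 = mat n n (\<lambda>(i,j). B $$ (Suc i, Suc j))"
  have B2c: "B2 \<in> carrier_mat n n" by (simp add: B2_def)
  have Bd: "B = dsum1 e n B2"
  proof (rule eq_matI)
    fix i j assume "i < dim_row (dsum1 e n B2)" "j < dim_col (dsum1 e n B2)"
    then have ij: "i < ?n" "j < ?n" using dsum1_carrier[OF B2c, of e] by auto
    then show "B $$ (i,j) = dsum1 e n B2 $$ (i,j)"
      using B0[of i] B0[of j] Bsym[of 0 j]
      by (cases i; cases j) (auto simp: dsum1_def B2_def)
  qed (use Bc dsum1_carrier[OF B2c, of e] in auto)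
  have "hermitian_mat B2" unfolding hermitian_mat_def
    by (rule eq_matI) (auto simp: B2_def adjoint_index Bsym[symmetric])
  from Suc.IH[OF B2c this] obtain U l where U: "unitary_mat n U"
    and BU: "B2 = U * mat_diag n (\<lambda>i. complex_of_real (l i)) * mat_adjoint U" by blast
  have Uc: "U \<in> carrier_mat n n" and UU: "mat_adjoint U * U = 1\<^sub>m n" using U by (auto simp: unitary_mat_def)
  define V where "V = dsum1 1 n U"
  define l' where "l' i = (case i of 0 \<Rightarrow> Re e | Suc i \<Rightarrow> l i)" for i
  let ?D = "mat_diag n (\<lambda>i. complex_of_real (l i))"
  let ?D' = "mat_diag ?n (\<lambda>i. complex_of_real (l' i))"
  have Vc: "V \<in> carrier_mat ?n ?n" using Uc by (simp add: V_def)
  have V: "unitary_mat ?n V"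
    using Uc UU by (simp add: unitary_mat_def V_def dsum1_adjoint dsum1_mult dsum1_one)
  have D': "?D' = dsum1 e n ?D"
    using dsum1_diag[of "\<lambda>i. complex_of_real (l' i)" n] e_real by (simp add: l'_def)
  have BV: "B = V * ?D' * mat_adjoint V"
    unfolding Bd BU V_def D' using Uc by (simp add: dsum1_adjoint dsum1_mult[of _ n])
  have "A = (W * mat_adjoint W) * A * (W * mat_adjoint W)" using A by (simp add: WW)
  also have "\<dots> = W * B * mat_adjoint W" unfolding B_def using A Wc
    by (simp add: assoc_mult_mat[of _ ?n ?n _ ?n _ ?n] mult_carrier_mat[of _ ?n ?n _ ?n])
  also have "\<dots> = (W * V) * ?D' * mat_adjoint (W * V)" unfolding BV using Wc Vc
    by (simp add: assoc_mult_mat[of _ ?n ?n _ ?n _ ?n] adjoint_mult[of _ ?n ?n _ ?n]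
      mult_carrier_mat[of _ ?n ?n _ ?n])
  finally show ?case using unitary_mat_mult[OF W V] by blast
qed

section \<open>Threshold measurements\<close>

lemma sum_rotate3:
  "(\<Sum>a\<in>A. \<Sum>b\<in>B. \<Sum>c\<in>C. f a b c) = (\<Sum>c\<in>C. \<Sum>a\<in>A. \<Sum>b\<in>B. f a b c)"
  by (subst sum.swap[of _ C B]) (rule sum.swap)

lemma sum_mult_delta:
  fixes h :: "nat \<Rightarrow> 'a::comm_semiring_1"
  shows "k < n \<Longrightarrow> (\<Sum>l<n. h l * (if k = l then 1 else 0)) = h k"
  by (simp add: if_distrib cong: if_cong)

lemma quadratic_form_sum:
  fixes A :: "complex mat"
  assumes "A \<in> carrier_mat n n" "v \<in> carrier_vec n"
  shows "(A *\<^sub>v v) \<bullet>c v = (\<Sum>a<n. \<Sum>b<n. A $$ (a,b) * v $ b * cnj (v $ a))"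
  using assms by (auto simp: scalar_prod_def sum_distrib_right lessThan_atLeast0 intro!: sum.cong)

lemma psd_mat_gram:
  assumes R: "R \<in> carrier_mat n n"
    and C: "\<And>a b. a < n \<Longrightarrow> b < n \<Longrightarrow> R $$ (a,b) = (\<Sum>c<m. C a c * cnj (C b c))"
  shows "psd_mat n R"
proof -
  have "mat_adjoint R = R"
    by (rule eq_matI) (use R C in \<open>auto simp: adjoint_index mult.commute\<close>)
  moreover have "0 \<le> Re ((R *\<^sub>v v) \<bullet>c v)" if v: "v \<in> carrier_vec n" for v
  proof -
    define y where "y c = (\<Sum>b<n. cnj (C b c) * v $ b)" for c
    have "(R *\<^sub>v v) \<bullet>c v = (\<Sum>a<n. \<Sum>b<n. \<Sum>c<m. C a c * cnj (C b c) * v $ b * cnj (v $ a))"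
      using R v by (simp add: quadratic_form_sum C sum_distrib_right)
    also have "\<dots> = (\<Sum>c<m. \<Sum>a<n. \<Sum>b<n. C a c * cnj (C b c) * v $ b * cnj (v $ a))"
      by (rule sum_rotate3)
    also have "\<dots> = (\<Sum>c<m. y c * cnj (y c))"
      by (simp add: y_def sum_product mult_ac)
    finally show ?thesis by (simp add: sum_nonneg)
  qed
  ultimately show ?thesis using R by (simp add: psd_mat_def hermitian_mat_def)
qed

text \<open>\<open>f\<close> is a function of the index \<open>k\<close>, not of the eigenvalue. One
  \<open>U\<close> thus carries an observable, its shifts, its square and its threshold projection,
  and products are taken pointwise (\<open>spectral_fun_mult\<close>).\<close>

definition spectral_fun :: "nat \<Rightarrow> complex mat \<Rightarrow> (nat \<Rightarrow> real) \<Rightarrow> complex mat" where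
  "spectral_fun n U f = U * mat_diag n (\<lambda>i. complex_of_real (f i)) * mat_adjoint U"

lemma spectral_fun_carrier [simp]: "U \<in> carrier_mat n n \<Longrightarrow> spectral_fun n U f \<in> carrier_mat n n"
  unfolding spectral_fun_def by (auto intro!: mult_carrier_mat[of _ n n _ n])

lemma spectral_fun_index:
  assumes "U \<in> carrier_mat n n" "a < n" "b < n"
  shows "spectral_fun n U f $$ (a,b) = (\<Sum>k<n. U $$ (a,k) * f k * cnj (U $$ (b,k)))"
  using assms
  by (auto simp: spectral_fun_def mat_diag_mult_right[of _ n n] adjoint_index scalar_prod_def
      lessThan_atLeast0 intro!: sum.cong)

lemma unitary_mat_sum_rows:
  assumes "unitary_mat n U" "a < n" "b < n"
  shows "(\<Sum>k<n. U $$ (a,k) * cnj (U $$ (b,k))) = (if a = b then 1 else 0)"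
proof -
  have U: "U \<in> carrier_mat n n" using assms by (simp add: unitary_mat_def)
  have "(U * mat_adjoint U) $$ (a,b) = (if a = b then 1 else 0)"
    using unitary_mat_right[OF assms(1)] assms by simp
  then show ?thesis using U assms
    by (simp add: adjoint_index scalar_prod_def lessThan_atLeast0)
qed

lemma unitary_mat_sum_cols:
  assumes "unitary_mat n U" "a < n" "b < n"
  shows "(\<Sum>k<n. cnj (U $$ (k,a)) * U $$ (k,b)) = (if a = b then 1 else 0)"
proof -
  have U: "U \<in> carrier_mat n n" using assms by (simp add: unitary_mat_def)
  have "(mat_adjoint U * U) $$ (a,b) = (if a = b then 1 else 0)"
    using assms by (simp add: unitary_mat_def)
  then show ?thesis using U assms
    by (simp add: adjoint_index scalar_prod_def lessThan_atLeast0)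
qed

lemma spectral_fun_mult:
  assumes "unitary_mat n U" "a < n" "c < n"
  shows "(\<Sum>b<n. spectral_fun n U f $$ (a,b) * spectral_fun n U g $$ (b,c)) =
    spectral_fun n U (\<lambda>k. f k * g k) $$ (a,c)"
proof -
  have U: "U \<in> carrier_mat n n" using assms by (simp add: unitary_mat_def)
  have "(\<Sum>b<n. spectral_fun n U f $$ (a,b) * spectral_fun n U g $$ (b,c)) =
      (\<Sum>b<n. \<Sum>k<n. \<Sum>l<n. U $$ (a,k) * f k * g l * cnj (U $$ (c,l)) * (cnj (U $$ (b,k)) * U $$ (b,l)))"
    using U assms by (simp add: spectral_fun_index sum_product mult_ac)
  also have "\<dots> = (\<Sum>k<n. \<Sum>l<n. U $$ (a,k) * f k * g l * cnj (U $$ (c,l)) * (\<Sum>b<n. cnj (U $$ (b,k)) * U $$ (b,l)))"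
    by (simp only: sum_distrib_left) (rule sum_rotate3[symmetric])
  also have "\<dots> = (\<Sum>k<n. U $$ (a,k) * f k * g k * cnj (U $$ (c,k)))"
    by (intro sum.cong refl) (simp add: unitary_mat_sum_cols[OF assms(1)] sum_mult_delta cong: sum.cong_simp)
  finally show ?thesis using U assms by (simp add: spectral_fun_index mult_ac)
qed

lemma psd_spectral_fun:
  assumes "U \<in> carrier_mat n n" "\<And>k. k < n \<Longrightarrow> 0 \<le> f k"
  shows "psd_mat n (spectral_fun n U f)"
proof (rule psd_mat_gram[where m = n and C = "\<lambda>a k. U $$ (a,k) * complex_of_real (sqrt (f k))"])
  fix a b assume "a < n" "b < n"
  show "spectral_fun n U f $$ (a,b) =
      (\<Sum>k<n. U $$ (a,k) * complex_of_real (sqrt (f k)) * cnj (U $$ (b,k) * complex_of_real (sqrt (f k))))"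
    unfolding spectral_fun_index[OF assms(1) \<open>a < n\<close> \<open>b < n\<close>]
  proof (intro sum.cong refl)
    fix k assume "k \<in> {..<n}"
    then have "complex_of_real (f k) = complex_of_real (sqrt (f k)) * complex_of_real (sqrt (f k))"
      using assms(2)[of k] by (simp flip: of_real_mult)
    then show "U $$ (a,k) * f k * cnj (U $$ (b,k)) =
        U $$ (a,k) * complex_of_real (sqrt (f k)) * cnj (U $$ (b,k) * complex_of_real (sqrt (f k)))"
      by (subst \<open>complex_of_real (f k) = _\<close>) (simp add: mult_ac)
  qed
qed (use assms in auto)

lemma mtrace_mult:
  assumes "A \<in> carrier_mat n n" "B \<in> carrier_mat n n"
  shows "mtrace (A * B) = (\<Sum>a<n. \<Sum>b<n. A $$ (a,b) * B $$ (b,a))"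
  using assms by (auto simp: mtrace_def scalar_prod_def lessThan_atLeast0 intro!: sum.cong)

text \<open>Born's rule: for a state \<open>R\<close> the numbers
  \<open>(R *\<^sub>v col U k) \<bullet>c col U k\<close> are the outcome probabilities of a
  measurement in the basis \<open>U\<close>, and the trace is an expectation under them.\<close>

lemma trace_spectral_fun:
  assumes U: "U \<in> carrier_mat n n" and R: "R \<in> carrier_mat n n"
  shows "(\<Sum>a<n. \<Sum>b<n. spectral_fun n U f $$ (a,b) * R $$ (b,a)) =
    (\<Sum>k<n. f k * ((R *\<^sub>v col U k) \<bullet>c col U k))"
proof -
  have "(\<Sum>a<n. \<Sum>b<n. spectral_fun n U f $$ (a,b) * R $$ (b,a)) =
      (\<Sum>a<n. \<Sum>b<n. \<Sum>k<n. f k * (R $$ (b,a) * U $$ (a,k) * cnj (U $$ (b,k))))"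
    using U by (simp add: spectral_fun_index sum_distrib_left sum_distrib_right mult_ac)
  also have "\<dots> = (\<Sum>k<n. \<Sum>a<n. \<Sum>b<n. f k * (R $$ (b,a) * U $$ (a,k) * cnj (U $$ (b,k))))"
    by (rule sum_rotate3)
  also have "\<dots> = (\<Sum>k<n. \<Sum>b<n. \<Sum>a<n. f k * (R $$ (b,a) * U $$ (a,k) * cnj (U $$ (b,k))))"
    by (intro sum.cong refl sum.swap)
  also have "\<dots> = (\<Sum>k<n. f k * ((R *\<^sub>v col U k) \<bullet>c col U k))"
    using U R by (intro sum.cong refl) (simp add: quadratic_form_sum sum_distrib_left)
  finally show ?thesis .
qed

lemma spectral_fun_one:
  "unitary_mat n U \<Longrightarrow> a < n \<Longrightarrow> b < n \<Longrightarrow> spectral_fun n U (\<lambda>_. 1) $$ (a,b) = (if a = b then 1 else 0)"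
  using unitary_mat_sum_rows[of n U a b] by (simp add: spectral_fun_index unitary_mat_def)

lemma sum_spectral_fun_diag:
  assumes U: "unitary_mat n U"
  shows "(\<Sum>a<n. spectral_fun n U f $$ (a,a)) = (\<Sum>i<n. complex_of_real (f i))"
proof -
  have "(\<Sum>a<n. spectral_fun n U f $$ (a,a)) = (\<Sum>a<n. \<Sum>i<n. f i * (cnj (U $$ (a,i)) * U $$ (a,i)))"
    using U by (simp add: unitary_mat_def spectral_fun_index mult_ac)
  also have "\<dots> = (\<Sum>i<n. f i * (\<Sum>a<n. cnj (U $$ (a,i)) * U $$ (a,i)))"
    by (subst sum.swap) (simp add: sum_distrib_left)
  also have "\<dots> = (\<Sum>i<n. complex_of_real (f i))"
    by (intro sum.cong refl) (simp add: unitary_mat_sum_cols[OF U])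
  finally show ?thesis .
qed

lemma sum_spectral_weights:
  assumes U: "unitary_mat n U" and R: "R \<in> carrier_mat n n"
  shows "(\<Sum>k<n. (R *\<^sub>v col U k) \<bullet>c col U k) = mtrace R"
proof -
  have "(\<Sum>k<n. (R *\<^sub>v col U k) \<bullet>c col U k) = (\<Sum>a<n. \<Sum>b<n. spectral_fun n U (\<lambda>_. 1) $$ (a,b) * R $$ (b,a))"
    using U by (subst trace_spectral_fun[OF _ R]) (auto simp: unitary_mat_def)
  also have "\<dots> = (\<Sum>a<n. \<Sum>b<n. if a = b then R $$ (b,a) else 0)"
    by (intro sum.cong refl) (simp add: spectral_fun_one[OF U])
  also have "\<dots> = mtrace R" using R by (simp add: mtrace_def)
  finally show ?thesis .
qed

text \<open>Chebyshev's inequality for the distribution of outcomes of \<open>Z\<close>; accept means outcome at most \<open>\<tau>\<close>.\<close>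
lemma threshold_measurement:
  assumes Z: "Z \<in> carrier_mat n n" "hermitian_mat Z"
  shows "\<exists>M. accept_effect n M \<and>
    (\<forall>R m \<delta> V. psd_mat n R \<longrightarrow> mtrace R = 1 \<longrightarrow> 0 < \<delta> \<longrightarrow>
      Re (\<Sum>a<n. \<Sum>b<n. \<Sum>c<n. (Z $$ (a,b) - (if a = b then complex_of_real m else 0)) *
         (Z $$ (b,c) - (if b = c then complex_of_real m else 0)) * R $$ (c,a)) \<le> V \<longrightarrow>
      (m \<le> \<tau> - \<delta> \<longrightarrow> 1 - V / \<delta>\<^sup>2 \<le> accept_prob M R) \<and>
      (\<tau> + \<delta> \<le> m \<longrightarrow> accept_prob M R \<le> V / \<delta>\<^sup>2))"
proof -
  obtain U z where U: "unitary_mat n U" and ZU: "Z = spectral_fun n U z"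
    using hermitian_spectral[OF Z] by (auto simp: spectral_fun_def)
  have Uc: "U \<in> carrier_mat n n" using U by (simp add: unitary_mat_def)
  note one = spectral_fun_one[OF U]
  \<comment> \<open>\<open>M\<close> depends on \<open>Z\<close> and \<open>\<tau>\<close> only. The
    state, the centre \<open>m\<close> and the error bounds enter afterwards, so one effect serves
    all unknown states.\<close>
  define g where "g k = (if z k \<le> \<tau> then 1 else 0 :: real)" for k
  define M where "M = spectral_fun n U g"
  have Mc: "M \<in> carrier_mat n n" using Uc by (simp add: M_def)
  have "1\<^sub>m n - M = spectral_fun n U (\<lambda>k. 1 - g k)"
  proof (rule eq_matI)
    fix a b assume "a < dim_row (spectral_fun n U (\<lambda>k. 1 - g k))" "b < dim_col (spectral_fun n U (\<lambda>k. 1 - g k))"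
    then have ab: "a < n" "b < n" using spectral_fun_carrier[OF Uc, of "\<lambda>k. 1 - g k"] by auto
    have "(1\<^sub>m n - M) $$ (a,b) = spectral_fun n U (\<lambda>_. 1) $$ (a,b) - M $$ (a,b)"
      using ab Mc one by simp
    also have "\<dots> = spectral_fun n U (\<lambda>k. 1 - g k) $$ (a,b)"
      using ab Uc by (simp add: M_def spectral_fun_index sum_subtractf algebra_simps)
    finally show "(1\<^sub>m n - M) $$ (a,b) = spectral_fun n U (\<lambda>k. 1 - g k) $$ (a,b)" .
  qed (use Mc spectral_fun_carrier[OF Uc, of "\<lambda>k. 1 - g k"] in auto)
  then have M: "accept_effect n M"
    unfolding accept_effect_def using psd_spectral_fun[OF Uc]
    by (simp add: M_def g_def)
  moreover have "(m \<le> \<tau> - \<delta> \<longrightarrow> 1 - V / \<delta>\<^sup>2 \<le> accept_prob M R) \<and>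
      (\<tau> + \<delta> \<le> m \<longrightarrow> accept_prob M R \<le> V / \<delta>\<^sup>2)"
    if R: "psd_mat n R" "mtrace R = 1" and \<delta>: "0 < \<delta>"
      and V: "Re (\<Sum>a<n. \<Sum>b<n. \<Sum>c<n. (Z $$ (a,b) - (if a = b then complex_of_real m else 0)) *
         (Z $$ (b,c) - (if b = c then complex_of_real m else 0)) * R $$ (c,a)) \<le> V"
    for R m \<delta> V
  proof -
    have Rc: "R \<in> carrier_mat n n" using R by (simp add: psd_mat_def)
    define p where "p k = Re ((R *\<^sub>v col U k) \<bullet>c col U k)" for k
    have p: "0 \<le> p k" if "k < n" for k
      using R that Uc col_carrier_vec[OF that Uc] by (simp add: p_def psd_mat_def)
    have tr: "Re (\<Sum>a<n. \<Sum>b<n. spectral_fun n U f $$ (a,b) * R $$ (b,a)) = (\<Sum>k<n. f k * p k)" for f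
      by (simp add: trace_spectral_fun[OF Uc Rc] p_def)
    have p1: "(\<Sum>k<n. p k) = 1" using sum_spectral_weights[OF U Rc] R by (simp add: p_def flip: Re_sum)
    have acc: "accept_prob M R = (\<Sum>k<n. g k * p k)"
      by (simp only: accept_prob_def mtrace_mult[OF Mc Rc]) (simp only: M_def tr)
    have K: "Z $$ (a,b) - (if a = b then complex_of_real m else 0) = spectral_fun n U (\<lambda>k. z k - m) $$ (a,b)"
      if ab: "a < n" "b < n" for a b
    proof -
      have "(if a = b then complex_of_real m else 0) = m * spectral_fun n U (\<lambda>_. 1) $$ (a,b)"
        using one[OF ab] by simp
      then show ?thesis using ab Uc
        by (simp add: ZU spectral_fun_index sum_distrib_left sum_subtractf algebra_simps)
    qed
    have "(\<Sum>a<n. \<Sum>b<n. \<Sum>c<n. (Z $$ (a,b) - (if a = b then complex_of_real m else 0)) *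
         (Z $$ (b,c) - (if b = c then complex_of_real m else 0)) * R $$ (c,a)) =
       (\<Sum>a<n. \<Sum>b<n. \<Sum>c<n. spectral_fun n U (\<lambda>k. z k - m) $$ (a,b) *
         spectral_fun n U (\<lambda>k. z k - m) $$ (b,c) * R $$ (c,a))"
      by (intro sum.cong refl) (simp add: K)
    also have "\<dots> = (\<Sum>a<n. \<Sum>c<n. (\<Sum>b<n. spectral_fun n U (\<lambda>k. z k - m) $$ (a,b) *
         spectral_fun n U (\<lambda>k. z k - m) $$ (b,c)) * R $$ (c,a))"
      by (rule sum.cong[OF refl], subst sum.swap) (simp add: sum_distrib_right)
    also have "\<dots> = (\<Sum>a<n. \<Sum>c<n. spectral_fun n U (\<lambda>k. (z k - m) * (z k - m)) $$ (a,c) * R $$ (c,a))"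
      by (intro sum.cong refl) (simp add: spectral_fun_mult[OF U])
    finally have V': "(\<Sum>k<n. (z k - m)\<^sup>2 * p k) \<le> V"
      using V tr[of "\<lambda>k. (z k - m) * (z k - m)"] by (simp add: power2_eq_square)
    \<comment> \<open>\<open>h\<close> stands for the indicator of either error event:
      \<open>1 - g\<close> when \<open>m\<close> lies below the threshold, \<open>g\<close> when it
      lies above.\<close>
    have cheb: "(\<Sum>k<n. h k * p k) \<le> V / \<delta>\<^sup>2"
      if h: "\<And>k. h k \<noteq> 0 \<Longrightarrow> h k = 1 \<and> \<delta> \<le> \<bar>z k - m\<bar>" for h
    proof -
      have "h k * p k \<le> (z k - m)\<^sup>2 * p k / \<delta>\<^sup>2" if "k < n" for k
      proof (cases "h k = 0")
        case False
        then have "\<delta>\<^sup>2 \<le> (z k - m)\<^sup>2" "h k = 1" using h[of k] \<delta> by (auto simp: abs_le_square_iff[symmetric])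
        then show ?thesis using p[OF that] \<delta> mult_right_mono[of "\<delta>\<^sup>2" "(z k - m)\<^sup>2" "p k"]
          by (simp add: field_simps)
      qed (use p[OF that] in simp)
      then have "(\<Sum>k<n. h k * p k) \<le> (\<Sum>k<n. (z k - m)\<^sup>2 * p k / \<delta>\<^sup>2)" by (intro sum_mono) auto
      also have "\<dots> \<le> V / \<delta>\<^sup>2" using V' \<delta> by (simp add: sum_divide_distrib[symmetric] divide_right_mono)
      finally show ?thesis .
    qed
    have "1 - accept_prob M R = (\<Sum>k<n. (1 - g k) * p k)"
      unfolding acc by (simp add: algebra_simps sum_subtractf p1)
    then have "m \<le> \<tau> - \<delta> \<Longrightarrow> 1 - accept_prob M R \<le> V / \<delta>\<^sup>2"
      using cheb[of "\<lambda>k. 1 - g k"] \<delta> by (auto simp: g_def split: if_splits)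
    moreover have "\<tau> + \<delta> \<le> m \<Longrightarrow> accept_prob M R \<le> V / \<delta>\<^sup>2"
      unfolding acc using cheb[of g] \<delta> by (auto simp: g_def split: if_splits)
    ultimately show ?thesis by auto
  qed
  ultimately show ?thesis by blast
qed

section \<open>Gram factors and positivity of product states\<close>

lemma spectral_fun_form:
  assumes U: "unitary_mat n U" and k: "k < n"
  shows "(spectral_fun n U l *\<^sub>v col U k) \<bullet>c col U k = complex_of_real (l k)"
proof -
  have Uc: "U \<in> carrier_mat n n" using U by (simp add: unitary_mat_def)
  define R where "R = spectral_fun n U l"
  have R: "R \<in> carrier_mat n n" using Uc by (simp add: R_def)
  \<comment> \<open>The indicator of \<open>k\<close> makes \<open>spectral_fun n U e\<close> the
    projection onto column \<open>k\<close>. Its trace against \<open>R\<close> is evaluated twice,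
    by multiplying spectral functions and by \<open>trace_spectral_fun\<close>.\<close>
  define e where "e i = (if i = k then 1 else 0 :: real)" for i
  have "(\<Sum>a<n. \<Sum>b<n. spectral_fun n U e $$ (a,b) * R $$ (b,a)) = (\<Sum>a<n. spectral_fun n U (\<lambda>i. e i * l i) $$ (a,a))"
    unfolding R_def by (intro sum.cong refl) (simp add: spectral_fun_mult[OF U])
  also have "\<dots> = (\<Sum>i<n. complex_of_real (e i * l i))"
    by (rule sum_spectral_fun_diag[OF U])
  also have "\<dots> = l k" using k by (simp add: e_def if_distrib if_distribR cong: if_cong)
  finally have "(\<Sum>i<n. e i * ((R *\<^sub>v col U i) \<bullet>c col U i)) = complex_of_real (l k)"
    using trace_spectral_fun[OF Uc R, of e] by simp
  moreover have "(\<Sum>i<n. complex_of_real (e i) * ((R *\<^sub>v col U i) \<bullet>c col U i)) = (R *\<^sub>v col U k) \<bullet>c col U k"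
    using k by (simp add: e_def if_distrib if_distribR cong: if_cong)
  ultimately show ?thesis by (simp add: R_def)
qed

text \<open>Columns of \<open>U\<close> are scaled by the square roots of the eigenvalues, which are
  values of the quadratic form and so nonnegative. The factor serves twice: for positivity of tensor
  products and for Cauchy-Schwarz on the entries of a state.\<close>

lemma psd_mat_factor:
  assumes "psd_mat n R"
  shows "\<exists>C. \<forall>a<n. \<forall>b<n. R $$ (a,b) = (\<Sum>c<n. C a c * cnj (C b c))"
proof -
  have R: "R \<in> carrier_mat n n" "hermitian_mat R" using assms by (auto simp: psd_mat_def)
  obtain U l where U: "unitary_mat n U" and RU: "R = spectral_fun n U l"
    using hermitian_spectral[OF R] by (auto simp: spectral_fun_def)
  have Uc: "U \<in> carrier_mat n n" using U by (simp add: unitary_mat_def)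
  have l: "0 \<le> l k" if k: "k < n" for k
  proof -
    have "0 \<le> Re ((R *\<^sub>v col U k) \<bullet>c col U k)"
      using assms col_carrier_vec[OF k Uc] by (simp add: psd_mat_def)
    then show ?thesis by (simp add: RU spectral_fun_form[OF U k])
  qed
  define C where "C a k = U $$ (a,k) * complex_of_real (sqrt (l k))" for a k
  have "R $$ (a,b) = (\<Sum>c<n. C a c * cnj (C b c))" if "a < n" "b < n" for a b
    unfolding RU spectral_fun_index[OF Uc that]
  proof (intro sum.cong refl)
    fix k assume "k \<in> {..<n}"
    then have "complex_of_real (l k) = complex_of_real (sqrt (l k)) * complex_of_real (sqrt (l k))"
      using l[of k] by (simp flip: of_real_mult)
    then show "U $$ (a,k) * l k * cnj (U $$ (b,k)) = C a k * cnj (C b k)"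
      by (subst \<open>complex_of_real (l k) = _\<close>) (simp add: C_def mult_ac)
  qed
  then show ?thesis by blast
qed

lemma density_tensor_all:
  assumes "\<forall>t<T. density_mat d (\<rho> t)"
  shows "psd_mat (d ^ T) (tensor_all T \<rho>)" "mtrace (tensor_all T \<rho>) = 1"
proof -
  have psd: "psd_mat d (\<rho> t)" "mtrace (\<rho> t) = 1" if "t < T" for t
    using assms that by (auto simp: density_mat_def)
  then have c: "\<forall>t<T. \<rho> t \<in> carrier_mat d d" by (auto simp: psd_mat_def)
  note R = tensor_all_carrier[OF c]
  have "\<exists>C. t < T \<longrightarrow> (\<forall>a<d. \<forall>b<d. \<rho> t $$ (a,b) = (\<Sum>c<d. C a c * cnj (C b c)))" for t
    using psd_mat_factor psd by blast
  then obtain C where C: "\<And>t a b. t < T \<Longrightarrow> a < d \<Longrightarrow> b < d \<Longrightarrow> \<rho> t $$ (a,b) = (\<Sum>c<d. C t a c * cnj (C t b c))"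
    by metis
  show "psd_mat (d ^ T) (tensor_all T \<rho>)"
  proof (rule psd_mat_gram[OF R, where m = "d ^ T" and C = "\<lambda>a c. \<Prod>t<T. C t (dig d T t a) (dig d T t c)"])
    fix a b assume ab: "a < d ^ T" "b < d ^ T"
    show "tensor_all T \<rho> $$ (a,b) = (\<Sum>c<d ^ T. (\<Prod>t<T. C t (dig d T t a) (dig d T t c)) * cnj (\<Prod>t<T. C t (dig d T t b) (dig d T t c)))"
    \<comment> \<open>For \<open>T = 0\<close> the index range is \<open>{0}\<close> even if
      \<open>d = 0\<close>; only for positive \<open>T\<close> does an index below
      \<open>d ^ T\<close> give \<open>0 < d\<close>, which bounds the digits.\<close>
    proof (cases "T = 0")
      case False
      with ab have d: "0 < d" by (cases d; cases T) auto
      have "tensor_all T \<rho> $$ (a,b) = (\<Prod>t<T. \<Sum>c<d. C t (dig d T t a) c * cnj (C t (dig d T t b) c))"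
        unfolding tensor_all_index[OF c ab] by (intro prod.cong refl) (simp add: C dig_less d)
      then show ?thesis by (simp add: sum_prod_dig[symmetric] prod.distrib)
    qed (use tensor_all_index[OF c ab] in simp)
  qed
  have "mtrace (tensor_all T \<rho>) = (\<Sum>a<d ^ T. \<Prod>t<T. \<rho> t $$ (dig d T t a, dig d T t a))"
    using R by (simp add: mtrace_def tensor_all_index[OF c])
  also have "\<dots> = (\<Prod>t<T. \<Sum>i<d. \<rho> t $$ (i,i))" by (rule sum_prod_dig)
  also have "\<dots> = (\<Prod>t<T. mtrace (\<rho> t))" using c by (intro prod.cong) (auto simp: mtrace_def)
  finally show "mtrace (tensor_all T \<rho>) = 1" using psd by simp
qed

section \<open>Pair statistics on product states\<close>

text \<open>Operators are represented by their entries, so that sums and linear combinations carry no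
  dimension side conditions: \<open>mean n r X\<close> is the trace of \<open>X r\<close>, and \<open>mom n r X Y\<close> that of \<open>X Y r\<close>.\<close>
type_synonym kernel = "nat \<Rightarrow> nat \<Rightarrow> complex"

definition kid :: kernel where
  "kid i j = (if i = j then 1 else 0)"

definition mean :: "nat \<Rightarrow> kernel \<Rightarrow> kernel \<Rightarrow> complex" where
  "mean n r X = (\<Sum>i<n. \<Sum>j<n. X i j * r j i)"

definition mom :: "nat \<Rightarrow> kernel \<Rightarrow> kernel \<Rightarrow> kernel \<Rightarrow> complex" where
  "mom n r X Y = (\<Sum>i<n. \<Sum>j<n. \<Sum>k<n. X i j * Y j k * r k i)"

lemma mom_sum_left: "mom n r (\<lambda>a b. \<Sum>k\<in>A. X k a b) Y = (\<Sum>k\<in>A. mom n r (X k) Y)"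
  unfolding mom_def
  by (simp add: sum_distrib_right sum.swap[of _ "{..<n}" A])

lemma mom_sum_right: "mom n r Y (\<lambda>a b. \<Sum>k\<in>A. X k a b) = (\<Sum>k\<in>A. mom n r Y (X k))"
  unfolding mom_def
  by (simp add: sum_distrib_right sum_distrib_left sum.swap[of _ "{..<n}" A])

lemma mom_add_left: "mom n r (\<lambda>a b. X a b + X' a b) Y = mom n r X Y + mom n r X' Y"
  by (simp add: mom_def distrib_right sum.distrib)

lemma mom_add_right: "mom n r Y (\<lambda>a b. X a b + X' a b) = mom n r Y X + mom n r Y X'"
  by (simp add: mom_def distrib_right distrib_left sum.distrib)

lemma mom_smult_left: "mom n r (\<lambda>a b. z * X a b) Y = z * mom n r X Y"
  by (simp add: mom_def sum_distrib_left mult_ac)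

lemma mom_smult_right: "mom n r Y (\<lambda>a b. z * X a b) = z * mom n r Y X"
  by (simp add: mom_def sum_distrib_left mult_ac)

lemma mom_kid_left: "mom n r kid Y = mean n r Y"
proof -
  have "(\<Sum>j<n. \<Sum>k<n. kid i j * Y j k * r k i) = (\<Sum>j<n. if i = j then \<Sum>k<n. Y j k * r k i else 0)" for i
    by (intro sum.cong refl) (auto simp: kid_def)
  then show ?thesis by (simp add: mom_def mean_def)
qed

lemma mom_kid_right: "mom n r X kid = mean n r X"
  by (simp add: mom_def mean_def kid_def if_distrib if_distribR cong: if_cong)

lemma mean_kid: "mean n r kid = (\<Sum>i<n. r i i)"
  by (simp add: mean_def kid_def if_distrib if_distribR cong: if_cong)

lemma mean_sum: "mean n r (\<lambda>a b. \<Sum>k\<in>A. X k a b) = (\<Sum>k\<in>A. mean n r (X k))"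
  unfolding mean_def
  by (simp add: sum_distrib_right sum.swap[of _ "{..<n}" A])

lemma mean_smult: "mean n r (\<lambda>a b. z * X a b) = z * mean n r X"
  by (simp add: mean_def sum_distrib_left mult_ac)

lemma mean_diff: "mean n r (\<lambda>a b. X a b - Y a b) = mean n r X - mean n r Y"
  by (simp add: mean_def left_diff_distrib sum_subtractf)

lemma mom_cong:
  assumes "\<And>a b. a < n \<Longrightarrow> b < n \<Longrightarrow> r a b = r' a b"
    and "\<And>a b. a < n \<Longrightarrow> b < n \<Longrightarrow> X a b = X' a b" "\<And>a b. a < n \<Longrightarrow> b < n \<Longrightarrow> Y a b = Y' a b"
  shows "mom n r X Y = mom n r' X' Y'"
  unfolding mom_def by (intro sum.cong refl) (simp add: assms)

section \<open>Local operators on product states\<close>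

definition ten :: "nat \<Rightarrow> nat \<Rightarrow> (nat \<Rightarrow> kernel) \<Rightarrow> kernel" where
  "ten d T X a b = (\<Prod>t<T. X t (dig d T t a) (dig d T t b))"

text \<open>Second moments factorise over the copies. All independence used later comes from here:
  one vanishing factor kills the product, and a copy carrying the identity on both sides contributes
  its unit trace.\<close>

lemma mom_ten:
  "mom (d ^ T) (ten d T r) (ten d T X) (ten d T Y) = (\<Prod>t<T. mom d (r t) (X t) (Y t))"
proof -
  let ?g = "\<lambda>t i j k. X t i j * Y t j k * r t k i"
  have "mom (d ^ T) (ten d T r) (ten d T X) (ten d T Y) =
      (\<Sum>a<d ^ T. \<Sum>b<d ^ T. \<Sum>c<d ^ T. \<Prod>t<T. ?g t (dig d T t a) (dig d T t b) (dig d T t c))"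
    by (simp add: mom_def ten_def prod.distrib)
  also have "\<dots> = (\<Sum>a<d ^ T. \<Sum>b<d ^ T. \<Prod>t<T. \<Sum>k<d. ?g t (dig d T t a) (dig d T t b) k)"
    by (intro sum.cong refl sum_prod_dig)
  also have "\<dots> = (\<Sum>a<d ^ T. \<Prod>t<T. \<Sum>j<d. \<Sum>k<d. ?g t (dig d T t a) j k)"
    by (intro sum.cong refl sum_prod_dig)
  also have "\<dots> = (\<Prod>t<T. \<Sum>i<d. \<Sum>j<d. \<Sum>k<d. ?g t i j k)"
    by (rule sum_prod_dig)
  finally show ?thesis by (simp add: mom_def)
qed

lemma ten_kid: "a < d ^ T \<Longrightarrow> b < d ^ T \<Longrightarrow> ten d T (\<lambda>_. kid) a b = kid a b"
proof (induction T arbitrary: a b)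
  case (Suc T)
  have "0 < d" using Suc.prems by (cases d) auto
  then have p: "0 < d ^ T" by simp
  have "ten d (Suc T) (\<lambda>_. kid) a b = kid (a div d ^ T) (b div d ^ T) * ten d T (\<lambda>_. kid) (a mod d ^ T) (b mod d ^ T)"
    using Suc.prems unfolding ten_def
    by (simp only: prod.lessThan_Suc_shift dig_Suc_0) (simp add: dig_Suc_Suc)
  also have "ten d T (\<lambda>_. kid) (a mod d ^ T) (b mod d ^ T) = kid (a mod d ^ T) (b mod d ^ T)"
    using p by (intro Suc.IH) auto
  also have "kid (a div d ^ T) (b div d ^ T) * kid (a mod d ^ T) (b mod d ^ T) = kid a b"
    by (auto simp: kid_def) (metis div_mult_mod_eq)
  finally show ?case .
qed (simp add: ten_def kid_def)

definition loc1 :: "nat \<Rightarrow> kernel \<Rightarrow> nat \<Rightarrow> kernel" where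
  "loc1 s A = (\<lambda>_. kid)(s := A)"

text \<open>Meant for distinct \<open>s\<close> and \<open>t\<close>: for equal ones the later
  update would win and \<open>A\<close> would be lost.\<close>

definition loc2 :: "nat \<Rightarrow> nat \<Rightarrow> kernel \<Rightarrow> kernel \<Rightarrow> nat \<Rightarrow> kernel" where
  "loc2 s t A B = (\<lambda>_. kid)(s := A, t := B)"

lemma ten_upd:
  assumes "s < T"
  shows "ten d T (X(s := A)) a b =
    A (dig d T s a) (dig d T s b) * (\<Prod>t\<in>{..<T} - {s}. X t (dig d T t a) (dig d T t b))"
  using assms by (simp add: ten_def prod.remove[of "{..<T}" s])

lemma ten_upd_add:
  "s < T \<Longrightarrow> ten d T (X(s := (\<lambda>i j. A i j + B i j))) a b = ten d T (X(s := A)) a b + ten d T (X(s := B)) a b"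
  by (simp add: ten_upd distrib_right)

lemma ten_upd_smult:
  "s < T \<Longrightarrow> ten d T (X(s := (\<lambda>i j. z * A i j))) a b = z * ten d T (X(s := A)) a b"
  by (simp add: ten_upd)

lemma ten_upd_sum:
  "s < T \<Longrightarrow> ten d T (X(s := (\<lambda>i j. \<Sum>k\<in>K. A k i j))) a b = (\<Sum>k\<in>K. ten d T (X(s := A k)) a b)"
  by (simp add: ten_upd sum_distrib_right)

text \<open>Multilinearity in the two slots. With \<open>A\<close> and \<open>B\<close> centred and
  \<open>x\<close>, \<open>y\<close> their offsets, this splits a two-copy observable into a pair
  term, two single-copy terms and a constant.\<close>

lemma ten_loc2_expand:
  assumes "s < T" "t < T" "s \<noteq> t"
  shows "ten d T (loc2 s t (\<lambda>i j. A i j + x * kid i j) (\<lambda>i j. B i j + y * kid i j)) a b =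
    ten d T (loc2 s t A B) a b + y * ten d T (loc1 s A) a b + x * ten d T (loc1 t B) a b
      + x * y * ten d T (\<lambda>_. kid) a b"
proof -
  have kk: "(\<lambda>_. kid)(s := A, t := kid) = (\<lambda>_. kid)(s := A)" for A
    using assms by auto
  have ks: "(\<lambda>_. kid)(s := kid) = (\<lambda>_. kid)" by auto
  have tw: "f(s := A, t := B) = f(t := B, s := A)" for f :: "nat \<Rightarrow> kernel" and A B
    using assms by (simp add: fun_upd_twist)
  have L: "ten d T (f(s := (\<lambda>i j. A i j + x * kid i j))) a b = ten d T (f(s := A)) a b + x * ten d T (f(s := kid)) a b" for f
    using assms by (simp add: ten_upd_add[of s T d f A "\<lambda>i j. x * kid i j"] ten_upd_smult)
  have R: "ten d T (f(t := (\<lambda>i j. B i j + y * kid i j))) a b = ten d T (f(t := B)) a b + y * ten d T (f(t := kid)) a b" for f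
    using assms by (simp add: ten_upd_add[of t T d f B "\<lambda>i j. y * kid i j"] ten_upd_smult)
  have "ten d T (loc2 s t (\<lambda>i j. A i j + x * kid i j) (\<lambda>i j. B i j + y * kid i j)) a b =
     ten d T ((\<lambda>_. kid)(s := A, t := B)) a b + x * ten d T ((\<lambda>_. kid)(s := kid, t := B)) a b
     + y * (ten d T ((\<lambda>_. kid)(s := A)) a b + x * ten d T ((\<lambda>_. kid)(s := kid)) a b)"
    unfolding loc2_def R kk L by (subst (1 2 3) tw) (simp add: L)
  then show ?thesis by (simp add: loc1_def loc2_def ks algebra_simps)
qed

context
  fixes d T :: nat and r :: "nat \<Rightarrow> kernel"
  assumes tr: "\<And>t. t < T \<Longrightarrow> (\<Sum>i<d. r t i i) = 1"
begin

lemma mom_ten_zero: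
  "s < T \<Longrightarrow> mom d (r s) (X s) (Y s) = 0 \<Longrightarrow> mom (d ^ T) (ten d T r) (ten d T X) (ten d T Y) = 0"
  unfolding mom_ten by (rule prod_zero) auto

lemma mom_kid_kid: "t < T \<Longrightarrow> mom d (r t) kid kid = 1"
  by (simp add: mom_kid_left mean_kid tr)

lemma mom_ten_one:
  assumes "s < T" "\<And>u. u < T \<Longrightarrow> u \<noteq> s \<Longrightarrow> X u = kid \<and> Y u = kid"
  shows "mom (d ^ T) (ten d T r) (ten d T X) (ten d T Y) = mom d (r s) (X s) (Y s)"
  unfolding mom_ten using assms
  by (subst prod.remove[of "{..<T}" s]) (auto intro!: prod.neutral simp: mom_kid_kid)

lemma mom_ten_two:
  assumes "s < T" "t < T" "s \<noteq> t" "\<And>u. u < T \<Longrightarrow> u \<noteq> s \<Longrightarrow> u \<noteq> t \<Longrightarrow> X u = kid \<and> Y u = kid"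
  shows "mom (d ^ T) (ten d T r) (ten d T X) (ten d T Y) = mom d (r s) (X s) (Y s) * mom d (r t) (X t) (Y t)"
proof -
  have "(\<Prod>u\<in>{..<T} - {s} - {t}. mom d (r u) (X u) (Y u)) = 1"
    using assms by (intro prod.neutral) (auto simp: mom_kid_kid)
  then show ?thesis
    unfolding mom_ten using assms
    by (simp add: prod.remove[of "{..<T}" s] prod.remove[of "{..<T} - {s}" t])
qed

lemma mom_loc1:
  assumes "s < T" "t < T" "mean d (r s) A = 0"
  shows "mom (d ^ T) (ten d T r) (ten d T (loc1 s A)) (ten d T (loc1 t B)) = (if s = t then mom d (r s) A B else 0)"
proof (cases "s = t")
  case True
  then show ?thesis using assms by (subst mom_ten_one[of s]) (auto simp: loc1_def)
next
  case False
  then show ?thesis using assms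
    by (subst mom_ten_zero[of s]) (auto simp: loc1_def mom_kid_right)
qed

text \<open>A factor sitting alone on its copy contributes its mean, which is zero for centred operators.\<close>
lemma mom_loc2_loc1:
  assumes "s < T" "t < T" "s \<noteq> t" "mean d (r s) A = 0" "mean d (r t) B = 0"
  shows "mom (d ^ T) (ten d T r) (ten d T (loc2 s t A B)) (ten d T (loc1 u C)) = 0"
    and "mom (d ^ T) (ten d T r) (ten d T (loc1 u C)) (ten d T (loc2 s t A B)) = 0"
proof -
  consider "u \<noteq> s" | "u = s" "u \<noteq> t" using assms by auto
  then show "mom (d ^ T) (ten d T r) (ten d T (loc2 s t A B)) (ten d T (loc1 u C)) = 0"
    by cases (use assms in \<open>auto simp: loc1_def loc2_def mom_kid_right
        intro: mom_ten_zero[of s] mom_ten_zero[of t]\<close>)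
  consider "u \<noteq> s" | "u = s" "u \<noteq> t" using assms by auto
  then show "mom (d ^ T) (ten d T r) (ten d T (loc1 u C)) (ten d T (loc2 s t A B)) = 0"
    by cases (use assms in \<open>auto simp: loc1_def loc2_def mom_kid_left
        intro: mom_ten_zero[of s] mom_ten_zero[of t]\<close>)
qed

text \<open>Unless both ordered pairs have the same two members, one of \<open>s\<close> and
  \<open>t\<close> lies outside the second pair, and the centred factor there stands alone. What is
  left is the same pair in the same or the opposite orientation.\<close>

lemma mom_loc2_loc2:
  assumes "s < T" "t < T" "s \<noteq> t" "u < T" "v < T" "u \<noteq> v" "mean d (r s) A = 0" "mean d (r t) B = 0"
  shows "mom (d ^ T) (ten d T r) (ten d T (loc2 s t A B)) (ten d T (loc2 u v C D)) =
    (if u = s \<and> v = t then mom d (r s) A C * mom d (r t) B D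
     else if u = t \<and> v = s then mom d (r s) A D * mom d (r t) B C else 0)"
proof -
  consider "u = s" "v = t" | "u = t" "v = s" | "s \<noteq> u" "s \<noteq> v" | "t \<noteq> u" "t \<noteq> v"
    using assms by auto
  then show ?thesis
  proof cases
    case 1
    then show ?thesis using assms by (subst mom_ten_two[of s t]) (auto simp: loc2_def)
  next
    case 2
    then show ?thesis using assms by (subst mom_ten_two[of s t]) (auto simp: loc2_def)
  next
    case 3
    then show ?thesis using assms by (subst mom_ten_zero[of s]) (auto simp: loc2_def mom_kid_right)
  next
    case 4
    then show ?thesis using assms by (subst mom_ten_zero[of t]) (auto simp: loc2_def mom_kid_right)
  qed
qed

end

text \<open>\<open>sw p\<close> is the partner of \<open>p\<close>: in use \<open>p\<close> is an
  index pair, \<open>F p\<close> a matrix unit, \<open>sw\<close> exchanges the two indices, and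
  \<open>F (sw p)\<close> is the adjoint of \<open>F p\<close>.\<close>

definition pair_kernel :: "nat \<Rightarrow> nat \<Rightarrow> 'p set \<Rightarrow> ('p \<Rightarrow> kernel) \<Rightarrow> ('p \<Rightarrow> complex) \<Rightarrow> ('p \<Rightarrow> complex) \<Rightarrow> ('p \<Rightarrow> 'p) \<Rightarrow> kernel" where
  "pair_kernel d T P F w c sw a b = (\<Sum>s<T. \<Sum>t\<in>{..<T} - {s}. \<Sum>p\<in>P. w p *
     ten d T (loc2 s t (\<lambda>i j. F p i j - c p * kid i j) (\<lambda>i j. F (sw p) i j - c (sw p) * kid i j)) a b)"

text \<open>A single summand need not be Hermitian; taking adjoints sends the term of
  \<open>p\<close> to that of \<open>sw p\<close>, which has the same weight.\<close>

lemma pair_kernel_cnj: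
  assumes sw: "\<And>p. p \<in> P \<Longrightarrow> sw p \<in> P" "\<And>p. p \<in> P \<Longrightarrow> sw (sw p) = p" "\<And>p. p \<in> P \<Longrightarrow> w (sw p) = w p"
    and F: "\<And>p i j. p \<in> P \<Longrightarrow> F p j i = cnj (F (sw p) i j)"
    and w: "\<And>p. cnj (w p) = w p" and c: "\<And>p. p \<in> P \<Longrightarrow> cnj (c p) = c (sw p)"
  shows "pair_kernel d T P F w c sw b a = cnj (pair_kernel d T P F w c sw a b)"
proof -
  define G where "G p = (\<lambda>i j. F p i j - c p * kid i j)" for p
  have G: "cnj (G p i j) = G (sw p) j i" if "p \<in> P" for p i j
    using that c[of p] F[of "sw p" j i] by (simp add: G_def kid_def sw)
  have t: "ten d T (loc2 s t (G p) (G (sw p))) b a = cnj (ten d T (loc2 s t (G (sw p)) (G p)) a b)" if p: "p \<in> P" for s t p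
  proof -
    have "cnj (G (sw p) i j) = G p j i" for i j using G[OF sw(1)[OF p]] sw(2)[OF p] by simp
    then have "loc2 s t (G p) (G (sw p)) u j i = cnj (loc2 s t (G (sw p)) (G p) u i j)" for u i j
      using G[OF p] by (simp add: loc2_def kid_def)
    then show ?thesis unfolding ten_def cnj_prod by (intro prod.cong refl)
  qed
  have "(\<Sum>p\<in>P. w p * ten d T (loc2 s t (G p) (G (sw p))) b a) = cnj (\<Sum>p\<in>P. w p * ten d T (loc2 s t (G p) (G (sw p))) a b)" for s t
  proof -
    have "(\<Sum>p\<in>P. w p * ten d T (loc2 s t (G p) (G (sw p))) b a) = (\<Sum>p\<in>P. w p * cnj (ten d T (loc2 s t (G (sw p)) (G p)) a b))"
      by (intro sum.cong refl) (simp add: t)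
    also have "\<dots> = (\<Sum>p\<in>P. w p * cnj (ten d T (loc2 s t (G p) (G (sw p))) a b))"
      by (rule sum.reindex_bij_witness[of _ sw sw]) (auto simp: sw)
    finally show ?thesis by (simp add: w)
  qed
  then show ?thesis by (simp add: pair_kernel_def G_def)
qed

section \<open>Decomposition and variance of the pair statistic\<close>

locale pair_statistic =
  fixes d T :: nat and r :: "nat \<Rightarrow> kernel" and P :: "'p set" and F :: "'p \<Rightarrow> kernel"
    and w c :: "'p \<Rightarrow> complex" and sw :: "'p \<Rightarrow> 'p"
  assumes trace_one: "\<And>t. t < T \<Longrightarrow> (\<Sum>i<d. r t i i) = 1"
    and finP: "finite P"
    and sw: "\<And>p. p \<in> P \<Longrightarrow> sw p \<in> P" "\<And>p. p \<in> P \<Longrightarrow> sw (sw p) = p" "\<And>p. p \<in> P \<Longrightarrow> w (sw p) = w p"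
begin

abbreviation (input) "Z \<equiv> pair_kernel d T P F w c sw"

text \<open>Centred at the true mean on copy \<open>t\<close>, whereas \<open>pair_kernel\<close>
  centres at the hypothetical mean \<open>c\<close>; \<open>dev\<close> is the difference of the two
  centres.\<close>

definition cen :: "nat \<Rightarrow> 'p \<Rightarrow> kernel" where
  "cen t p = (\<lambda>i j. F p i j - mean d (r t) (F p) * kid i j)"

definition dev :: "nat \<Rightarrow> 'p \<Rightarrow> complex" where
  "dev t p = mean d (r t) (F p) - c p"

text \<open>The total operator on copy \<open>s\<close> alone. The inner sum collects the offsets of
  all other copies; the 2 arises because the first and the second slot contribute equally once
  \<open>p\<close> is exchanged with \<open>sw p\<close>.\<close>

definition lin :: "nat \<Rightarrow> kernel" where
  "lin s = (\<lambda>i j. \<Sum>p\<in>P. 2 * w p * (\<Sum>t\<in>{..<T} - {s}. dev t (sw p)) * cen s p i j)"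

definition m :: complex where
  "m = (\<Sum>s<T. \<Sum>t\<in>{..<T} - {s}. \<Sum>p\<in>P. w p * dev s p * dev t (sw p))"

abbreviation (input) "EE \<equiv> mom (d ^ T) (ten d T r)"

lemmas moment_loc1 = mom_loc1[where d = d and T = T and r = r, OF trace_one]
lemmas moment_loc2_loc1 = mom_loc2_loc1[where d = d and T = T and r = r, OF trace_one]
lemmas moment_loc2_loc2 = mom_loc2_loc2[where d = d and T = T and r = r, OF trace_one]

lemma sum_sw: "(\<Sum>p\<in>P. f (sw p)) = (\<Sum>p\<in>P. f p)"
  by (rule sum.reindex_bij_witness[of _ sw sw]) (auto simp: sw)

lemma sum_offdiag_swap:
  "(\<Sum>s<T. \<Sum>t\<in>{..<T} - {s}. f s t) = (\<Sum>t<T. \<Sum>s\<in>{..<T} - {t}. f s t)"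
proof -
  have "(\<Sum>s<T. \<Sum>t\<in>{..<T} - {s}. f s t) = (\<Sum>s<T. \<Sum>t<T. if s \<noteq> t then f s t else 0)"
    by (intro sum.cong refl sum.mono_neutral_cong_left) auto
  also have "\<dots> = (\<Sum>t<T. \<Sum>s<T. if s \<noteq> t then f s t else 0)"
    by (rule sum.swap)
  also have "\<dots> = (\<Sum>t<T. \<Sum>s\<in>{..<T} - {t}. f s t)"
    by (intro sum.cong refl sum.mono_neutral_cong_right) auto
  finally show ?thesis .
qed

lemma sum_offdiag_two:
  assumes "s < T" "t < T" "s \<noteq> t"
  shows "(\<Sum>u<T. \<Sum>v\<in>{..<T} - {u}. if u = s \<and> v = t then x else if u = t \<and> v = s then y else 0) = x + (y::complex)"
proof -
  have "(\<Sum>v\<in>{..<T} - {u}. if u = s \<and> v = t then x else if u = t \<and> v = s then y else 0) =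
      (if u = s then x else 0) + (if u = t then y else 0)" if "u < T" for u
  proof -
    have "(\<Sum>v\<in>{..<T} - {u}. if u = s \<and> v = t then x else if u = t \<and> v = s then y else 0) =
      (\<Sum>v\<in>{..<T} - {u}. (if v = t then if u = s then x else 0 else 0) + (if v = s then if u = t then y else 0 else 0))"
      using assms by (intro sum.cong) auto
    then show ?thesis using assms that by (auto simp: sum.distrib)
  qed
  then show ?thesis using assms by (simp add: sum.distrib)
qed

lemma mean_cen: "t < T \<Longrightarrow> mean d (r t) (cen t p) = 0"
  by (simp add: cen_def mean_diff mean_smult mean_kid trace_one)

lemma mom_cen:
  assumes "t < T"
  shows "mom d (r t) (cen t p) (cen t p') = mom d (r t) (F p) (F p') - mean d (r t) (F p) * mean d (r t) (F p')"
proof -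
  have e: "cen t p = (\<lambda>i j. F p i j + (- mean d (r t) (F p)) * kid i j)" for p
    by (simp add: cen_def)
  show ?thesis
    unfolding e mom_add_left mom_add_right mom_smult_left mom_smult_right mom_kid_left mom_kid_right mean_kid trace_one[OF assms]
    by (simp add: algebra_simps)
qed

lemma mean_lin: "t < T \<Longrightarrow> mean d (r t) (lin t) = 0"
  by (simp add: lin_def mean_sum mean_smult mean_cen)

text \<open>The Hoeffding decomposition of \<open>Z\<close>: each slot is written as
  \<open>cen\<close> plus \<open>dev\<close> times the identity, and the product is expanded and
  sorted by the number of copies acted on.\<close>

lemma Z_decomp:
  assumes "a < d ^ T" "b < d ^ T"
  shows "Z a b - m * kid a b =
    (\<Sum>s<T. \<Sum>t\<in>{..<T} - {s}. \<Sum>p\<in>P. w p * ten d T (loc2 s t (cen s p) (cen t (sw p))) a b) +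
    (\<Sum>s<T. ten d T (loc1 s (lin s)) a b)"
proof -
  have G: "(\<lambda>i j. F p i j - c p * kid i j) = (\<lambda>i j. cen t p i j + dev t p * kid i j)" for p t
    by (simp add: cen_def dev_def algebra_simps fun_eq_iff)
  have Z1: "Z a b = (\<Sum>s<T. \<Sum>t\<in>{..<T} - {s}. \<Sum>p\<in>P. w p * (ten d T (loc2 s t (cen s p) (cen t (sw p))) a b
      + dev t (sw p) * ten d T (loc1 s (cen s p)) a b + dev s p * ten d T (loc1 t (cen t (sw p))) a b
      + dev s p * dev t (sw p) * kid a b))"
    unfolding pair_kernel_def
  proof (intro sum.cong refl, goal_cases)
    case (1 s t p)
    then show ?case
      by (subst G[of p s], subst G[of "sw p" t], subst ten_loc2_expand) (auto simp: ten_kid assms)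
  qed
  have L1: "(\<Sum>s<T. \<Sum>t\<in>{..<T} - {s}. \<Sum>p\<in>P. w p * (dev s p * ten d T (loc1 t (cen t (sw p))) a b)) =
     (\<Sum>s<T. \<Sum>t\<in>{..<T} - {s}. \<Sum>p\<in>P. w p * (dev t (sw p) * ten d T (loc1 s (cen s p)) a b))"
  proof (subst sum_offdiag_swap, rule sum.cong[OF refl], rule sum.cong[OF refl])
    fix s t
    show "(\<Sum>p\<in>P. w p * (dev t p * ten d T (loc1 s (cen s (sw p))) a b)) =
      (\<Sum>p\<in>P. w p * (dev t (sw p) * ten d T (loc1 s (cen s p)) a b))"
      by (subst sum_sw[symmetric]) (auto intro!: sum.cong simp: sw)
  qed
  have L2: "(\<Sum>s<T. ten d T (loc1 s (lin s)) a b) =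
     2 * (\<Sum>s<T. \<Sum>t\<in>{..<T} - {s}. \<Sum>p\<in>P. w p * (dev t (sw p) * ten d T (loc1 s (cen s p)) a b))"
    unfolding sum_distrib_left
  proof (intro sum.cong refl)
    fix s assume "s \<in> {..<T}"
    then have "ten d T (loc1 s (lin s)) a b =
        (\<Sum>p\<in>P. 2 * w p * (\<Sum>t\<in>{..<T} - {s}. dev t (sw p)) * ten d T (loc1 s (cen s p)) a b)"
      by (simp add: loc1_def lin_def ten_upd_sum ten_upd_smult)
    also have "\<dots> = (\<Sum>p\<in>P. \<Sum>t\<in>{..<T} - {s}. 2 * (w p * (dev t (sw p) * ten d T (loc1 s (cen s p)) a b)))"
      by (simp add: sum_distrib_left sum_distrib_right mult_ac)
    finally show "ten d T (loc1 s (lin s)) a b =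
        (\<Sum>t\<in>{..<T} - {s}. \<Sum>p\<in>P. 2 * (w p * (dev t (sw p) * ten d T (loc1 s (cen s p)) a b)))"
      by (simp add: sum.swap[of _ P])
  qed
  show ?thesis
    unfolding Z1 L2 m_def distrib_left sum.distrib L1
    by (simp add: sum_distrib_right mult_ac) (simp add: sum_distrib_left mult_ac)
qed

text \<open>The parts of different degree are uncorrelated. The factor 2 in front of the pair sum
  counts the correlation of the ordered pair (s, t) with itself and with (t, s); substituting
  \<open>sw p'\<close> for \<open>p'\<close> shows that both are equal.\<close>

theorem variance:
  "EE (\<lambda>a b. Z a b - m * kid a b) (\<lambda>a b. Z a b - m * kid a b) =
    2 * (\<Sum>s<T. \<Sum>t\<in>{..<T} - {s}. \<Sum>p\<in>P. \<Sum>p'\<in>P. w p * w p' *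
      mom d (r s) (cen s p) (cen s p') * mom d (r t) (cen t (sw p)) (cen t (sw p'))) +
    (\<Sum>s<T. mom d (r s) (lin s) (lin s))"
proof -
  define Q where "Q a b = (\<Sum>s<T. \<Sum>t\<in>{..<T} - {s}. \<Sum>p\<in>P. w p * ten d T (loc2 s t (cen s p) (cen t (sw p))) a b)" for a b
  define L where "L a b = (\<Sum>s<T. ten d T (loc1 s (lin s)) a b)" for a b
  have QL: "EE Q L = 0"
    unfolding Q_def L_def mom_sum_left mom_sum_right mom_smult_left
    by (intro sum.neutral ballI) (simp add: moment_loc2_loc1 mean_cen)
  have LQ: "EE L Q = 0"
    unfolding Q_def L_def mom_sum_left mom_sum_right mom_smult_right
    by (intro sum.neutral ballI) (simp add: moment_loc2_loc1 mean_cen)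
  have LL: "EE L L = (\<Sum>s<T. mom d (r s) (lin s) (lin s))"
    unfolding L_def mom_sum_left mom_sum_right
    by (simp add: moment_loc1 mean_lin)
  have "EE Q Q = (\<Sum>s<T. \<Sum>t\<in>{..<T} - {s}. \<Sum>p\<in>P. w p * 
      (\<Sum>u<T. \<Sum>v\<in>{..<T} - {u}. \<Sum>p'\<in>P. w p' * EE (ten d T (loc2 s t (cen s p) (cen t (sw p)))) (ten d T (loc2 u v (cen u p') (cen v (sw p'))))))"
    unfolding Q_def mom_sum_left mom_sum_right mom_smult_left mom_smult_right ..
  also have "\<dots> = (\<Sum>s<T. \<Sum>t\<in>{..<T} - {s}. \<Sum>p\<in>P. w p * (2 * (\<Sum>p'\<in>P. w p' *
      (mom d (r s) (cen s p) (cen s p') * mom d (r t) (cen t (sw p)) (cen t (sw p'))))))"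
  proof (intro sum.cong refl arg_cong2[of _ _ _ _ times])
    fix s t p assume st: "s \<in> {..<T}" "t \<in> {..<T} - {s}" and p: "p \<in> P"
    define x where "x = (\<Sum>p'\<in>P. w p' * (mom d (r s) (cen s p) (cen s p') * mom d (r t) (cen t (sw p)) (cen t (sw p'))))"
    have y: "(\<Sum>p'\<in>P. w p' * (mom d (r s) (cen s p) (cen s (sw p')) * mom d (r t) (cen t (sw p)) (cen t p'))) = x"
      unfolding x_def by (subst sum_sw[symmetric]) (auto intro!: sum.cong simp: sw)
    have "(\<Sum>u<T. \<Sum>v\<in>{..<T} - {u}. \<Sum>p'\<in>P. w p' * EE (ten d T (loc2 s t (cen s p) (cen t (sw p)))) (ten d T (loc2 u v (cen u p') (cen v (sw p'))))) =
      (\<Sum>u<T. \<Sum>v\<in>{..<T} - {u}. if u = s \<and> v = t then x else if u = t \<and> v = s then x else 0)"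
    proof (intro sum.cong refl)
      fix u v assume uv: "u \<in> {..<T}" "v \<in> {..<T} - {u}"
      have "(\<Sum>p'\<in>P. w p' * EE (ten d T (loc2 s t (cen s p) (cen t (sw p)))) (ten d T (loc2 u v (cen u p') (cen v (sw p'))))) =
        (\<Sum>p'\<in>P. w p' * (if u = s \<and> v = t then mom d (r s) (cen s p) (cen u p') * mom d (r t) (cen t (sw p)) (cen v (sw p'))
     else if u = t \<and> v = s then mom d (r s) (cen s p) (cen v (sw p')) * mom d (r t) (cen t (sw p)) (cen u p') else 0))"
        using st uv by (intro sum.cong refl arg_cong2[of _ _ _ _ times], subst moment_loc2_loc2) (auto simp: mean_cen)
      also have "\<dots> = (if u = s \<and> v = t then x else if u = t \<and> v = s then x else 0)"
      proof (cases "u = s \<and> v = t")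
        case True
        then show ?thesis by (simp add: x_def)
      next
        case False
        then show ?thesis using st y by (cases "u = t \<and> v = s") auto
      qed
      finally show "(\<Sum>p'\<in>P. w p' * EE (ten d T (loc2 s t (cen s p) (cen t (sw p)))) (ten d T (loc2 u v (cen u p') (cen v (sw p'))))) =
        (if u = s \<and> v = t then x else if u = t \<and> v = s then x else 0)" .
    qed
    also have "\<dots> = 2 * x" using st by (subst sum_offdiag_two) auto
    finally show "(\<Sum>u<T. \<Sum>v\<in>{..<T} - {u}. \<Sum>p'\<in>P. w p' * EE (ten d T (loc2 s t (cen s p) (cen t (sw p)))) (ten d T (loc2 u v (cen u p') (cen v (sw p'))))) =
      2 * (\<Sum>p'\<in>P. w p' * (mom d (r s) (cen s p) (cen s p') * mom d (r t) (cen t (sw p)) (cen t (sw p'))))"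
      by (simp add: x_def)
  qed
  finally have QQ: "EE Q Q = 2 * (\<Sum>s<T. \<Sum>t\<in>{..<T} - {s}. \<Sum>p\<in>P. \<Sum>p'\<in>P. w p * w p' *
      mom d (r s) (cen s p) (cen s p') * mom d (r t) (cen t (sw p)) (cen t (sw p')))"
    by (simp add: sum_distrib_left mult_ac)
  have "EE (\<lambda>a b. Z a b - m * kid a b) (\<lambda>a b. Z a b - m * kid a b) = EE (\<lambda>a b. Q a b + L a b) (\<lambda>a b. Q a b + L a b)"
    by (rule mom_cong) (simp_all add: Z_decomp Q_def L_def)
  also have "\<dots> = EE Q Q + EE L L"
    by (simp add: mom_add_left mom_add_right QL LQ)
  finally show ?thesis unfolding QQ LL .
qed

end

section \<open>Bounds in the eigenbasis\<close>

lemma Cauchy_Schwarz_sum: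
  fixes f g :: "'a \<Rightarrow> real"
  shows "(\<Sum>i\<in>A. f i * g i)\<^sup>2 \<le> (\<Sum>i\<in>A. (f i)\<^sup>2) * (\<Sum>i\<in>A. (g i)\<^sup>2)"
proof -
  have "\<bar>\<Sum>i\<in>A. f i * g i\<bar> \<le> L2_set f A * L2_set g A"
    using L2_set_mult_ineq[of f g A] sum_abs[of "\<lambda>i. f i * g i" A] by (simp add: abs_mult)
  then have "(\<Sum>i\<in>A. f i * g i)\<^sup>2 \<le> (L2_set f A * L2_set g A)\<^sup>2"
    by (metis abs_ge_zero power2_abs power_mono)
  then show ?thesis by (simp add: L2_set_def power_mult_distrib sum_nonneg)
qed

lemma cmod_sum_mult_le:
  fixes f g :: "'a \<Rightarrow> complex"
  shows "cmod (\<Sum>i\<in>A. f i * g i) \<le> sqrt (\<Sum>i\<in>A. (cmod (f i))\<^sup>2) * sqrt (\<Sum>i\<in>A. (cmod (g i))\<^sup>2)"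
proof -
  have "cmod (\<Sum>i\<in>A. f i * g i) \<le> (\<Sum>i\<in>A. \<bar>cmod (f i)\<bar> * \<bar>cmod (g i)\<bar>)"
    by (rule order_trans[OF norm_sum]) (simp add: norm_mult)
  also have "\<dots> \<le> sqrt (\<Sum>i\<in>A. (cmod (f i))\<^sup>2) * sqrt (\<Sum>i\<in>A. (cmod (g i))\<^sup>2)"
    using L2_set_mult_ineq[of "\<lambda>i. cmod (f i)" "\<lambda>i. cmod (g i)" A] by (simp add: L2_set_def)
  finally show ?thesis .
qed

text \<open>Writing each state as \<open>D D\<^sup>\<dagger>\<close> makes positivity available as Cauchy-Schwarz. The weights are
  constrained at all indices, also beyond \<open>d\<close>, only to save range conditions.\<close>
locale gram_family =
  fixes d T :: nat and D :: "nat \<Rightarrow> nat \<Rightarrow> nat \<Rightarrow> complex" and q \<alpha> :: "nat \<Rightarrow> real" and \<gamma> :: real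
  assumes trace_D: "\<And>t. t < T \<Longrightarrow> (\<Sum>i<d. \<Sum>k<d. (cmod (D t i k))\<^sup>2) = 1"
    and gamma: "0 < \<gamma>" "\<And>i. \<gamma> \<le> \<alpha> i"
    and q: "\<And>i. 0 \<le> q i" "\<And>i. q i \<le> 2 * \<alpha> i" and sum_q: "(\<Sum>i<d. q i) = 1"
    and T: "0 < T"
begin

definition R :: "nat \<Rightarrow> nat \<Rightarrow> nat \<Rightarrow> complex" where
  "R t i j = (\<Sum>k<d. D t i k * cnj (D t j k))"

definition a :: "nat \<Rightarrow> nat \<Rightarrow> real" where
  "a t i = sqrt (\<Sum>k<d. (cmod (D t i k))\<^sup>2)"

definition e :: "nat \<Rightarrow> real" where
  "e i = 1 / sqrt (\<alpha> i)"

definition w :: "nat \<Rightarrow> nat \<Rightarrow> real" where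
  "w i j = 2 / (\<alpha> i + \<alpha> j)"

text \<open>The trace of copy \<open>t\<close> against the inverse weights. It can be as large as 1
  / \<gamma> for a single copy, but it is linear in the state, so its sum is controlled by the
  average (\<open>sum_tau_le\<close>).\<close>

definition \<tau> :: "nat \<Rightarrow> real" where
  "\<tau> t = (\<Sum>i<d. (a t i)\<^sup>2 / \<alpha> i)"

definition c :: "nat \<Rightarrow> nat \<Rightarrow> complex" where
  "c i j = (if i = j then complex_of_real (q i) else 0)"

definition \<Delta> :: "nat \<Rightarrow> nat \<Rightarrow> complex" where
  "\<Delta> i j = (\<Sum>t<T. R t i j) / of_nat T - c i j"

definition \<chi> :: real where
  "\<chi> = (\<Sum>i<d. \<Sum>j<d. w i j * (cmod (\<Delta> i j))\<^sup>2)"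

lemma alpha_pos: "0 < \<alpha> i"
  using gamma(1) gamma(2)[of i] by linarith

lemma a_nonneg: "0 \<le> a t i"
  by (simp add: a_def sum_nonneg)

lemma e_nonneg: "0 \<le> e i"
  using alpha_pos[of i] by (simp add: e_def)

lemma w_pos: "0 < w i j"
  using alpha_pos[of i] alpha_pos[of j] by (simp add: w_def)

lemma w_sym: "w i j = w j i"
  by (simp add: w_def add.commute)

lemma sum_a2: "t < T \<Longrightarrow> (\<Sum>i<d. (a t i)\<^sup>2) = 1"
  using trace_D[of t] by (simp add: a_def sum_nonneg)

lemma R_diag: "R t i i = complex_of_real ((a t i)\<^sup>2)"
  by (simp add: R_def a_def sum_nonneg complex_norm_square del: of_real_power)

lemma R_cnj: "cnj (R t i j) = R t j i"
  by (simp add: R_def mult.commute)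

lemma cmod_R: "cmod (R t i j) \<le> a t i * a t j"
  using cmod_sum_mult_le[of "\<lambda>k. D t i k" "\<lambda>k. cnj (D t j k)" "{..<d}"] by (simp add: R_def a_def)

lemma w_le: "w i j \<le> e i * e j"
proof -
  have p: "0 < \<alpha> i" "0 < \<alpha> j" by (rule alpha_pos)+
  have "sqrt (\<alpha> i) * sqrt (\<alpha> j) \<le> (\<alpha> i + \<alpha> j) / 2"
    using arith_geo_mean_sqrt[of "\<alpha> i" "\<alpha> j"] p by (simp add: real_sqrt_mult)
  then have "1 / ((\<alpha> i + \<alpha> j) / 2) \<le> 1 / (sqrt (\<alpha> i) * sqrt (\<alpha> j))"
    using p by (intro divide_left_mono) auto
  then show ?thesis by (simp add: w_def e_def)
qed

lemma e2: "(e i)\<^sup>2 = 1 / \<alpha> i"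
  using alpha_pos[of i] by (simp add: e_def power_divide)

lemma tau_e: "\<tau> t = (\<Sum>i<d. (e i * a t i)\<^sup>2)"
  by (simp add: \<tau>_def power_mult_distrib e2)

lemma tau_nonneg: "0 \<le> \<tau> t"
  by (simp add: tau_e sum_nonneg)

text \<open>Cauchy-Schwarz, with \<open>a t\<close> a unit vector. The sum is symmetric in the two
  copies, so it is controlled by either of \<open>\<tau> s\<close> and
  \<open>\<tau> t\<close>.\<close>

lemma sum_eaa_le:
  assumes "t < T"
  shows "(\<Sum>i<d. e i * a s i * a t i)\<^sup>2 \<le> \<tau> s"
  using Cauchy_Schwarz_sum[of "\<lambda>i. e i * a s i" "a t" "{..<d}"] sum_a2[OF assms]
  by (simp add: tau_e)

text \<open>The covariance in copy \<open>t\<close> of the matrix units with index pairs (i, j) and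
  (k, l), in the operator order of \<open>mom\<close>.\<close>

definition cov :: "nat \<Rightarrow> nat \<Rightarrow> nat \<Rightarrow> nat \<Rightarrow> nat \<Rightarrow> complex" where
  "cov t i j k l = (if j = k then R t l i else 0) - R t j i * R t l k"

lemma cmod_cov: "cmod (cov t i j k l) \<le> (if j = k then a t i * a t l else 0) + a t i * a t j * a t k * a t l"
proof -
  have "cmod (R t j i * R t l k) \<le> (a t j * a t i) * (a t l * a t k)"
    unfolding norm_mult by (intro mult_mono cmod_R) (auto simp: a_nonneg)
  then show ?thesis
    using norm_triangle_ineq4[of "if j = k then R t l i else 0" "R t j i * R t l k"] cmod_R[of t l i]
    unfolding cov_def by (auto simp: mult_ac)
qed

text \<open>Each of the four products arising from the two covariances is dominated by a product of
  one-index sums.\<close>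
lemma pair_bound:
  assumes st: "s < T" "t < T"
  shows "cmod (\<Sum>i<d. \<Sum>j<d. \<Sum>k<d. \<Sum>l<d. w i j * w k l * cov s i j k l * cov t j i l k) \<le> 4 * \<tau> s * \<tau> t"
proof -
  define f where "f i = e i * a s i * a t i" for i
  define S where "S = (\<Sum>i<d. f i)"
  have S: "S\<^sup>2 \<le> \<tau> s" "S\<^sup>2 \<le> \<tau> t"
    using sum_eaa_le[OF st(2), of s] sum_eaa_le[OF st(1), of t] by (simp_all add: S_def f_def mult_ac)
  have f0: "0 \<le> f i" for i by (simp add: f_def a_nonneg e_nonneg)
  let ?d = "\<lambda>i j. if i = j then 1 else 0 :: real"
  have b: "cmod (w i j * w k l * cov s i j k l * cov t j i l k) \<le>
      ?d j k * ?d i l * ((e i * a s i)\<^sup>2 * (e j * a t j)\<^sup>2) + ?d j k * ((e j * a t j)\<^sup>2 * (f i * f l))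
      + ?d i l * ((e i * a s i)\<^sup>2 * (f j * f k)) + f i * f j * f k * f l" for i j k l
  proof -
    have m1: "w i j * w k l \<le> (e i * e j) * (e k * e l)"
      by (intro mult_mono w_le) (auto simp: w_pos less_imp_le e_nonneg)
    have m2: "cmod (cov s i j k l) * cmod (cov t j i l k) \<le>
       ((if j = k then a s i * a s l else 0) + a s i * a s j * a s k * a s l) *
       ((if i = l then a t j * a t k else 0) + a t j * a t i * a t l * a t k)"
      by (intro mult_mono cmod_cov) (auto simp: a_nonneg)
    have "(w i j * w k l) * (cmod (cov s i j k l) * cmod (cov t j i l k)) \<le>
      ((e i * e j) * (e k * e l)) * (((if j = k then a s i * a s l else 0) + a s i * a s j * a s k * a s l) *
       ((if i = l then a t j * a t k else 0) + a t j * a t i * a t l * a t k))"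
      by (rule mult_mono[OF m1 m2]) (auto simp: e_nonneg)
    also have "\<dots> = ?d j k * ?d i l * ((e i * a s i)\<^sup>2 * (e j * a t j)\<^sup>2) + ?d j k * ((e j * a t j)\<^sup>2 * (f i * f l))
      + ?d i l * ((e i * a s i)\<^sup>2 * (f j * f k)) + f i * f j * f k * f l"
      by (auto simp: f_def power2_eq_square algebra_simps)
    finally show ?thesis by (simp add: norm_mult w_pos less_imp_le abs_of_pos mult_ac)
  qed
  have "cmod (\<Sum>i<d. \<Sum>j<d. \<Sum>k<d. \<Sum>l<d. w i j * w k l * cov s i j k l * cov t j i l k) \<le>
     (\<Sum>i<d. \<Sum>j<d. \<Sum>k<d. \<Sum>l<d. cmod (w i j * w k l * cov s i j k l * cov t j i l k))"
    by (intro order_trans[OF norm_sum] sum_mono) auto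
  also have "\<dots> \<le> (\<Sum>i<d. \<Sum>j<d. \<Sum>k<d. \<Sum>l<d.
      ?d j k * ?d i l * ((e i * a s i)\<^sup>2 * (e j * a t j)\<^sup>2) + ?d j k * ((e j * a t j)\<^sup>2 * (f i * f l))
      + ?d i l * ((e i * a s i)\<^sup>2 * (f j * f k)) + f i * f j * f k * f l)"
    by (intro sum_mono b)
  also have "\<dots> = \<tau> s * \<tau> t + S\<^sup>2 * \<tau> t + \<tau> s * S\<^sup>2 + S\<^sup>2 * S\<^sup>2"
  proof -
    have SP: "(\<Sum>i<d. \<Sum>j<d. f i * g j) = S * (\<Sum>j<d. g j)" for g
      by (simp only: S_def sum_product)
    have SS: "(\<Sum>i<d. f i * x) = S * x" for x
      by (simp only: S_def sum_distrib_right)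
    have delta: "(\<Sum>l<d. ?d i l) = 1" if "i < d" for i using that by simp
    have 1: "(\<Sum>i<d. \<Sum>j<d. \<Sum>k<d. \<Sum>l<d. ?d j k * ?d i l * ((e i * a s i)\<^sup>2 * (e j * a t j)\<^sup>2)) = \<tau> s * \<tau> t"
    proof -
      have "(\<Sum>k<d. \<Sum>l<d. ?d j k * ?d i l * x) = x" if "i < d" "j < d" for i j x
      proof -
        have "(\<Sum>k<d. \<Sum>l<d. ?d j k * ?d i l * x) = (\<Sum>k<d. ?d j k) * (\<Sum>l<d. ?d i l) * x"
          by (simp only: sum_distrib_right) (simp only: sum_distrib_left sum_distrib_right)
        then show ?thesis using that by (simp only: delta mult_1)
      qed
      then show ?thesis by (simp add: tau_e sum_product)
    qed
    have 2: "(\<Sum>i<d. \<Sum>j<d. \<Sum>k<d. \<Sum>l<d. ?d j k * ((e j * a t j)\<^sup>2 * (f i * f l))) = S\<^sup>2 * \<tau> t"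
    proof -
      have "(\<Sum>k<d. \<Sum>l<d. ?d j k * (x * (y * f l))) = y * (x * S)" if "j < d" for j x y
      proof -
        have "(\<Sum>k<d. \<Sum>l<d. ?d j k * (x * (y * f l))) = (\<Sum>k<d. ?d j k) * (\<Sum>l<d. x * (y * f l))"
          by (simp only: sum_product)
        then show ?thesis using that by (simp only: delta) (simp add: S_def sum_distrib_left mult_ac)
      qed
      then have "(\<Sum>i<d. \<Sum>j<d. \<Sum>k<d. \<Sum>l<d. ?d j k * ((e j * a t j)\<^sup>2 * (f i * f l))) =
         (\<Sum>i<d. \<Sum>j<d. f i * ((e j * a t j)\<^sup>2 * S))"
        by simp
      also have "\<dots> = S * (\<tau> t * S)"
        by (simp only: SP tau_e sum_distrib_right)
      finally show ?thesis by (simp add: power2_eq_square mult_ac)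
    qed
    have 3: "(\<Sum>i<d. \<Sum>j<d. \<Sum>k<d. \<Sum>l<d. ?d i l * ((e i * a s i)\<^sup>2 * (f j * f k))) = \<tau> s * S\<^sup>2"
    proof -
      have "(\<Sum>l<d. ?d i l * x) = x" if "i < d" for i x
        using delta[OF that] by (simp only: sum_distrib_right[symmetric] mult_1)
      then have "(\<Sum>i<d. \<Sum>j<d. \<Sum>k<d. \<Sum>l<d. ?d i l * ((e i * a s i)\<^sup>2 * (f j * f k))) =
         (\<Sum>i<d. \<Sum>j<d. \<Sum>k<d. (e i * a s i)\<^sup>2 * (f j * f k))"
        by simp
      also have "\<dots> = (\<Sum>i<d. (e i * a s i)\<^sup>2 * (S * S))"
        by (simp only: SP S_def[symmetric] sum_distrib_left[symmetric] sum_distrib_right[symmetric])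
      also have "\<dots> = \<tau> s * (S * S)" by (simp only: tau_e sum_distrib_right)
      finally show ?thesis by (simp add: power2_eq_square)
    qed
    have 4: "(\<Sum>i<d. \<Sum>j<d. \<Sum>k<d. \<Sum>l<d. f i * f j * f k * f l) = S\<^sup>2 * S\<^sup>2"
    proof -
      have "(\<Sum>i<d. \<Sum>j<d. \<Sum>k<d. \<Sum>l<d. f i * f j * f k * f l) = (\<Sum>i<d. \<Sum>j<d. f i * f j * (S * S))"
        by (simp only: SS S_def[symmetric] sum_distrib_left[symmetric] mult.assoc)
      also have "\<dots> = S * S * (S * S)"
        by (simp only: SS sum_distrib_left[symmetric] mult.assoc)
      finally show ?thesis by (simp add: power2_eq_square)
    qed
    show ?thesis by (simp only: sum.distrib 1 2 3 4)
  qed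
  also have "\<dots> \<le> \<tau> s * \<tau> t + \<tau> s * \<tau> t + \<tau> s * \<tau> t + \<tau> s * \<tau> t"
    using S tau_nonneg by (intro add_mono mult_mono) auto
  finally show ?thesis by simp
qed

section \<open>Second moments of the single-copy term\<close>

definition NN :: "nat \<Rightarrow> (nat \<Rightarrow> nat \<Rightarrow> complex) \<Rightarrow> real" where
  "NN s h = (\<Sum>k<d. \<Sum>j<d. (cmod (\<Sum>l<d. h j l * D s l k))\<^sup>2)"

lemma NN_nonneg: "0 \<le> NN s h"
  by (simp add: NN_def sum_nonneg)

text \<open>For Hermitian \<open>h\<close> the squared Frobenius norm of \<open>h\<close> times the
  Gram factor of copy \<open>s\<close> is the second moment Tr(h^2 \<rho>). Defining
  \<open>NN\<close> as a norm makes nonnegativity and \<open>NN_add3\<close> immediate; the trace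
  form is linear in the state.\<close>

lemma NN_eq:
  assumes h: "\<And>i j. cnj (h i j) = h j i"
  shows "complex_of_real (NN s h) = (\<Sum>i<d. \<Sum>j<d. \<Sum>l<d. h i j * h j l * R s l i)"
proof -
  have "complex_of_real (NN s h) = (\<Sum>k<d. \<Sum>j<d. (\<Sum>i<d. h i j * cnj (D s i k)) * (\<Sum>l<d. h j l * D s l k))"
    by (simp add: NN_def complex_norm_square h mult.commute del: of_real_power)
  also have "\<dots> = (\<Sum>k<d. \<Sum>j<d. \<Sum>i<d. \<Sum>l<d. h i j * h j l * (D s l k * cnj (D s i k)))"
    by (simp only: sum_product) (simp only: mult_ac)
  also have "\<dots> = (\<Sum>k<d. \<Sum>i<d. \<Sum>j<d. \<Sum>l<d. h i j * h j l * (D s l k * cnj (D s i k)))"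
    by (rule sum.cong[OF refl], rule sum.swap)
  also have "\<dots> = (\<Sum>i<d. \<Sum>k<d. \<Sum>j<d. \<Sum>l<d. h i j * h j l * (D s l k * cnj (D s i k)))"
    by (rule sum.swap)
  also have "\<dots> = (\<Sum>i<d. \<Sum>j<d. \<Sum>l<d. \<Sum>k<d. h i j * h j l * (D s l k * cnj (D s i k)))"
    by (rule sum.cong[OF refl], rule sum_rotate3[symmetric])
  finally show ?thesis by (simp add: R_def sum_distrib_left)
qed

lemma NN_smult: "NN s (\<lambda>i j. z * h i j) = (cmod z)\<^sup>2 * NN s h"
  by (simp add: NN_def sum_distrib_left[symmetric] mult.assoc norm_mult power_mult_distrib)

lemma cmod_add3: "(cmod (x + y + z))\<^sup>2 \<le> 3 * ((cmod x)\<^sup>2 + (cmod y)\<^sup>2 + (cmod z)\<^sup>2)"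
proof -
  have "cmod (x + y + z) \<le> cmod x + cmod y + cmod z"
    by (rule order_trans[OF norm_triangle_ineq add_right_mono[OF norm_triangle_ineq]])
  then have "(cmod (x + y + z))\<^sup>2 \<le> (cmod x + cmod y + cmod z)\<^sup>2"
    by (intro power_mono) auto
  also have "\<dots> \<le> 3 * ((cmod x)\<^sup>2 + (cmod y)\<^sup>2 + (cmod z)\<^sup>2)"
    using sum_squares_bound[of "cmod x" "cmod y"] sum_squares_bound[of "cmod x" "cmod z"]
      sum_squares_bound[of "cmod y" "cmod z"]
    by (simp add: power2_eq_square algebra_simps)
  finally show ?thesis .
qed

lemma NN_add3: "NN s (\<lambda>i j. x i j + y i j + z i j) \<le> 3 * (NN s x + NN s y + NN s z)"
proof -
  have "NN s (\<lambda>i j. x i j + y i j + z i j) \<le> (\<Sum>k<d. \<Sum>j<d. 3 * ((cmod (\<Sum>l<d. x j l * D s l k))\<^sup>2 +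
      (cmod (\<Sum>l<d. y j l * D s l k))\<^sup>2 + (cmod (\<Sum>l<d. z j l * D s l k))\<^sup>2))"
    unfolding NN_def by (intro sum_mono) (simp only: distrib_right sum.distrib cmod_add3)
  also have "\<dots> = 3 * (NN s x + NN s y + NN s z)"
    by (simp add: NN_def sum.distrib sum_distrib_left distrib_left)
  finally show ?thesis .
qed

lemma NN_diag:
  assumes "s < T" "\<And>i. 0 \<le> \<kappa> i" "\<And>i. \<kappa> i \<le> 2"
  shows "NN s (\<lambda>i j. if i = j then complex_of_real (\<kappa> i) else 0) \<le> 4"
proof -
  have e: "(\<Sum>l<d. (if j = l then complex_of_real (\<kappa> j) else 0) * D s l k) = \<kappa> j * D s j k" if "j < d" for j k
  proof -
    have "(\<Sum>l<d. (if j = l then complex_of_real (\<kappa> j) else 0) * D s l k) =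
      (\<Sum>l<d. if j = l then \<kappa> j * D s l k else 0)" by (intro sum.cong) auto
    then show ?thesis using that by simp
  qed
  have "NN s (\<lambda>i j. if i = j then complex_of_real (\<kappa> i) else 0) = (\<Sum>k<d. \<Sum>j<d. (\<kappa> j)\<^sup>2 * (cmod (D s j k))\<^sup>2)"
    unfolding NN_def by (intro sum.cong refl) (simp add: e norm_mult power_mult_distrib)
  also have "\<dots> \<le> (\<Sum>k<d. \<Sum>j<d. 4 * (cmod (D s j k))\<^sup>2)"
  proof (intro sum_mono mult_right_mono)
    fix j
    show "(\<kappa> j)\<^sup>2 \<le> 4" using power_mono[OF assms(3)[of j] assms(2)[of j], of 2] by simp
  qed auto
  also have "\<dots> = 4 * (\<Sum>j<d. \<Sum>k<d. (cmod (D s j k))\<^sup>2)"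
    by (subst sum.swap) (simp add: sum_distrib_left)
  finally show ?thesis using trace_D[OF assms(1)] by simp
qed

text \<open>After entrywise bounds the triple sum splits by index: the middle one yields
  \<open>\<tau> s\<close>, each outer one yields \<open>G\<close>, and
  \<open>G\<^sup>2 \<le> \<tau> s\<close>.\<close>

lemma NN_R:
  assumes s: "s < T"
  shows "NN s (\<lambda>i j. w i j * R s i j) \<le> (\<tau> s)\<^sup>2"
proof -
  define g where "g i = e i * a s i * a s i" for i
  define G where "G = (\<Sum>i<d. g i)"
  have G: "G\<^sup>2 \<le> \<tau> s" using sum_eaa_le[OF s, of s] by (simp add: G_def g_def)
  have wr: "cmod (w i j * R s i j) \<le> (e i * e j) * (a s i * a s j)" for i j
  proof -
    have "w i j * cmod (R s i j) \<le> (e i * e j) * (a s i * a s j)"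
      by (intro mult_mono w_le cmod_R) (auto simp: e_nonneg)
    then show ?thesis using w_pos[of i j] by (simp add: norm_mult)
  qed
  have "NN s (\<lambda>i j. w i j * R s i j) = cmod (\<Sum>i<d. \<Sum>j<d. \<Sum>l<d. w i j * R s i j * (w j l * R s j l) * R s l i)"
    by (subst NN_eq[symmetric]) (simp_all add: R_cnj w_sym NN_nonneg)
  also have "\<dots> \<le> (\<Sum>i<d. \<Sum>j<d. \<Sum>l<d. cmod (w i j * R s i j * (w j l * R s j l) * R s l i))"
    by (intro order_trans[OF norm_sum] sum_mono) auto
  also have "\<dots> \<le> (\<Sum>i<d. \<Sum>j<d. \<Sum>l<d. g i * ((e j * a s j)\<^sup>2 * g l))"
  proof (intro sum_mono)
    fix i j l
    have "cmod (w i j * R s i j * (w j l * R s j l) * R s l i) \<le>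
        ((e i * e j) * (a s i * a s j)) * ((e j * e l) * (a s j * a s l)) * (a s l * a s i)"
      unfolding norm_mult[of _ "R s l i"] norm_mult[of "_ * R s i j"]
      by (intro mult_mono wr cmod_R) (auto simp: e_nonneg a_nonneg)
    then show "cmod (w i j * R s i j * (w j l * R s j l) * R s l i) \<le> g i * ((e j * a s j)\<^sup>2 * g l)"
      by (simp add: g_def power2_eq_square mult_ac)
  qed
  also have "\<dots> = G * (\<tau> s * G)"
    by (simp only: sum_distrib_left[symmetric] sum_distrib_right[symmetric] G_def[symmetric] tau_e[symmetric])
  also have "\<dots> = G\<^sup>2 * \<tau> s" by (simp add: power2_eq_square)
  also have "\<dots> \<le> \<tau> s * \<tau> s" using G tau_nonneg by (intro mult_right_mono)
  finally show ?thesis by (simp add: power2_eq_square)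
qed

lemma Delta_cnj: "cnj (\<Delta> i j) = \<Delta> j i"
  by (simp add: \<Delta>_def R_cnj c_def)

lemma chi_nonneg: "0 \<le> \<chi>"
  unfolding \<chi>_def by (intro sum_nonneg mult_nonneg_nonneg) (auto simp: w_pos less_imp_le)

text \<open>The solution \<open>L\<close> of \<open>\<alpha> L + L \<alpha> = 2 \<Delta>\<close>, which governs the single-copy fluctuations.\<close>
definition L :: "nat \<Rightarrow> nat \<Rightarrow> complex" where
  "L i j = w i j * \<Delta> i j"

lemma L_cnj: "cnj (L i j) = L j i"
  by (simp add: L_def Delta_cnj w_sym)

lemma cmod_L_sym: "cmod (L i j) = cmod (L j i)"
  by (metis L_cnj complex_mod_cnj)

lemma cmod_Delta: "cmod (\<Delta> i j) = (\<alpha> i + \<alpha> j) / 2 * cmod (L i j)"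
proof -
  have "cmod (L i j) = w i j * cmod (\<Delta> i j)"
    using w_pos[of i j] by (simp add: L_def norm_mult)
  then show ?thesis using alpha_pos[of i] alpha_pos[of j] by (simp add: w_def)
qed

text \<open>In terms of \<open>L\<close> the weight of an entry is (\<alpha> i + \<alpha> j) / 2.
  Since the moduli of \<open>L\<close> are symmetric, both halves have the same sum, and one index
  alone can carry the weight.\<close>

lemma sum_alpha_L: "(\<Sum>i<d. \<Sum>j<d. \<alpha> i * (cmod (L i j))\<^sup>2) = \<chi>"
proof -
  have "w i j * (cmod (\<Delta> i j))\<^sup>2 = (\<alpha> i * (cmod (L i j))\<^sup>2 + \<alpha> j * (cmod (L j i))\<^sup>2) / 2" for i j
    using alpha_pos[of i] alpha_pos[of j] unfolding cmod_Delta cmod_L_sym[of j i]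
    by (simp add: w_def power2_eq_square field_simps)
  then have "\<chi> = (\<Sum>i<d. \<Sum>j<d. \<alpha> i * (cmod (L i j))\<^sup>2) / 2 + (\<Sum>i<d. \<Sum>j<d. \<alpha> j * (cmod (L j i))\<^sup>2) / 2"
    by (simp add: \<chi>_def sum.distrib sum_divide_distrib add_divide_distrib)
  also have "(\<Sum>i<d. \<Sum>j<d. \<alpha> j * (cmod (L j i))\<^sup>2) = (\<Sum>i<d. \<Sum>j<d. \<alpha> i * (cmod (L i j))\<^sup>2)"
    by (rule sum.swap)
  finally show ?thesis by simp
qed

lemma sum_L2: "(\<Sum>i<d. \<Sum>j<d. (cmod (L i j))\<^sup>2) \<le> \<chi> / \<gamma>"
proof -
  have "\<gamma> * (\<Sum>i<d. \<Sum>j<d. (cmod (L i j))\<^sup>2) \<le> (\<Sum>i<d. \<Sum>j<d. \<alpha> i * (cmod (L i j))\<^sup>2)"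
    unfolding sum_distrib_left by (intro sum_mono mult_right_mono gamma) auto
  then show ?thesis using gamma(1) by (simp add: sum_alpha_L field_simps)
qed

text \<open>\<open>cmod_Delta\<close> turns the third factor into \<open>L\<close> with weight
  (\<alpha> l + \<alpha> i) / 2, and the two halves agree after a cyclic relabelling. For fixed
  \<open>i\<close>, Cauchy-Schwarz over pairs (j, l) separates the Frobenius norm of
  \<open>L\<close>, bounded by \<open>sum_L2\<close>, from the squared norm of row \<open>i\<close>;
  summing the rows with weight \<open>\<alpha> i\<close> restores \<open>\<chi>\<close>.\<close>

lemma cubic_bound:
  "(\<Sum>i<d. \<Sum>j<d. \<Sum>l<d. cmod (L i j) * cmod (L j l) * cmod (\<Delta> l i)) \<le> sqrt (\<chi> / \<gamma>) * \<chi>"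
proof -
  define x where "x i j = cmod (L i j)" for i j
  have x: "0 \<le> x i j" "x i j = x j i" for i j by (simp_all add: x_def cmod_L_sym[of i j])
  have half: "(\<Sum>i<d. \<Sum>j<d. \<Sum>l<d. \<alpha> i * (x i j * x j l * x l i)) \<le> sqrt (\<chi> / \<gamma>) * \<chi>"
  proof -
    have "(\<Sum>j<d. \<Sum>l<d. x i j * x j l * x l i) \<le> sqrt (\<chi> / \<gamma>) * (\<Sum>j<d. (x i j)\<^sup>2)" for i
    proof -
      have "(\<Sum>j<d. \<Sum>l<d. x i j * x j l * x l i) = (\<Sum>p\<in>{..<d} \<times> {..<d}. x (fst p) (snd p) * (x i (fst p) * x i (snd p)))"
        by (simp add: sum.cartesian_product case_prod_unfold x(2)[of _ i] mult_ac)
      also have "\<dots> \<le> sqrt ((\<Sum>p\<in>{..<d} \<times> {..<d}. (x (fst p) (snd p))\<^sup>2) * (\<Sum>p\<in>{..<d} \<times> {..<d}. (x i (fst p) * x i (snd p))\<^sup>2))"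
        by (rule real_le_rsqrt[OF Cauchy_Schwarz_sum])
      also have "(\<Sum>p\<in>{..<d} \<times> {..<d}. (x i (fst p) * x i (snd p))\<^sup>2) = (\<Sum>j<d. (x i j)\<^sup>2)\<^sup>2"
        by (simp add: sum.cartesian_product case_prod_unfold power_mult_distrib power2_eq_square[of "sum _ _"] sum_product)
      also have "sqrt ((\<Sum>p\<in>{..<d} \<times> {..<d}. (x (fst p) (snd p))\<^sup>2) * (\<Sum>j<d. (x i j)\<^sup>2)\<^sup>2) =
          sqrt (\<Sum>i<d. \<Sum>j<d. (x i j)\<^sup>2) * (\<Sum>j<d. (x i j)\<^sup>2)"
        by (simp add: real_sqrt_mult sum_nonneg sum.cartesian_product case_prod_unfold)
      also have "\<dots> \<le> sqrt (\<chi> / \<gamma>) * (\<Sum>j<d. (x i j)\<^sup>2)"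
        using sum_L2 by (intro mult_right_mono) (auto simp: x_def sum_nonneg)
      finally show ?thesis .
    qed
    then have "(\<Sum>i<d. \<alpha> i * (\<Sum>j<d. \<Sum>l<d. x i j * x j l * x l i)) \<le> (\<Sum>i<d. \<alpha> i * (sqrt (\<chi> / \<gamma>) * (\<Sum>j<d. (x i j)\<^sup>2)))"
      using alpha_pos by (intro sum_mono mult_left_mono) (auto simp: less_imp_le)
    also have "\<dots> = sqrt (\<chi> / \<gamma>) * (\<Sum>i<d. \<Sum>j<d. \<alpha> i * (x i j)\<^sup>2)"
      by (simp add: sum_distrib_left mult_ac)
    finally show ?thesis using sum_alpha_L by (simp add: x_def sum_distrib_left)
  qed
  have "(\<Sum>i<d. \<Sum>j<d. \<Sum>l<d. cmod (L i j) * cmod (L j l) * cmod (\<Delta> l i)) =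
      (\<Sum>i<d. \<Sum>j<d. \<Sum>l<d. \<alpha> l * (x i j * x j l * x l i)) / 2 + (\<Sum>i<d. \<Sum>j<d. \<Sum>l<d. \<alpha> i * (x i j * x j l * x l i)) / 2"
    unfolding cmod_Delta x_def[symmetric]
    by (simp add: sum.distrib[symmetric] sum_divide_distrib field_simps)
  also have "(\<Sum>i<d. \<Sum>j<d. \<Sum>l<d. \<alpha> l * (x i j * x j l * x l i)) = (\<Sum>l<d. \<Sum>i<d. \<Sum>j<d. \<alpha> l * (x i j * x j l * x l i))"
    by (rule sum_rotate3)
  also have "\<dots> = (\<Sum>l<d. \<Sum>i<d. \<Sum>j<d. \<alpha> l * (x l i * x i j * x j l))"
    by (simp add: mult_ac)
  finally show ?thesis using half by simp
qed

text \<open>Linearity in the state replaces the sum over copies by T times the average, which is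
  \<open>\<Delta>\<close> plus the diagonal of \<open>q\<close>. The diagonal part costs 2
  \<open>\<chi>\<close> by \<open>q i \<le> 2 * \<alpha> i\<close>; the part with
  \<open>\<Delta>\<close> is the cubic sum.\<close>

lemma sum_NN_L: "(\<Sum>s<T. NN s L) \<le> T * (\<chi> * (2 + sqrt (\<chi> / \<gamma>)))"
proof -
  have RT: "(\<Sum>s<T. R s l i) = T * (\<Delta> l i + c l i)" for l i
    using T by (simp add: \<Delta>_def)
  have "complex_of_real (\<Sum>s<T. NN s L) = (\<Sum>s<T. \<Sum>i<d. \<Sum>j<d. \<Sum>l<d. L i j * L j l * R s l i)"
    by (simp add: NN_eq L_cnj)
  also have "\<dots> = (\<Sum>i<d. \<Sum>s<T. \<Sum>j<d. \<Sum>l<d. L i j * L j l * R s l i)"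
    by (rule sum.swap)
  also have "\<dots> = (\<Sum>i<d. \<Sum>j<d. \<Sum>l<d. \<Sum>s<T. L i j * L j l * R s l i)"
    by (rule sum.cong[OF refl], rule sum_rotate3[symmetric])
  also have "\<dots> = of_nat T * ((\<Sum>i<d. \<Sum>j<d. \<Sum>l<d. L i j * L j l * \<Delta> l i) + (\<Sum>i<d. \<Sum>j<d. \<Sum>l<d. L i j * L j l * c l i))"
  proof -
    have "(\<Sum>s<T. L i j * L j l * R s l i) = of_nat T * (L i j * L j l * \<Delta> l i) + of_nat T * (L i j * L j l * c l i)" for i j l
      by (simp only: sum_distrib_left[symmetric] RT) (simp add: algebra_simps)
    then show ?thesis by (simp only: sum.distrib sum_distrib_left[symmetric] distrib_left)
  qed
  also have "(\<Sum>i<d. \<Sum>j<d. \<Sum>l<d. L i j * L j l * c l i) = (\<Sum>i<d. \<Sum>j<d. complex_of_real (q i * (cmod (L i j))\<^sup>2))"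
  proof (intro sum.cong refl)
    fix i j assume "i \<in> {..<d}"
    have "(\<Sum>l<d. L i j * L j l * c l i) = (\<Sum>l<d. if l = i then L i j * L j i * q i else 0)"
      by (intro sum.cong) (auto simp: c_def)
    also have "\<dots> = L i j * cnj (L i j) * q i" using \<open>i \<in> _\<close> by (simp add: L_cnj)
    finally show "(\<Sum>l<d. L i j * L j l * c l i) = complex_of_real (q i * (cmod (L i j))\<^sup>2)"
      by (simp add: complex_norm_square mult_ac del: of_real_power)
  qed
  finally have eq: "complex_of_real (\<Sum>s<T. NN s L) = of_nat T * ((\<Sum>i<d. \<Sum>j<d. \<Sum>l<d. L i j * L j l * \<Delta> l i)
      + complex_of_real (\<Sum>i<d. \<Sum>j<d. q i * (cmod (L i j))\<^sup>2))" by simp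
  have q0: "0 \<le> (\<Sum>i<d. \<Sum>j<d. q i * (cmod (L i j))\<^sup>2)"
    using q by (intro sum_nonneg) auto
  have "(\<Sum>s<T. NN s L) = cmod (complex_of_real (\<Sum>s<T. NN s L))"
    by (simp add: sum_nonneg NN_nonneg del: of_real_sum)
  also have "\<dots> \<le> T * (cmod (\<Sum>i<d. \<Sum>j<d. \<Sum>l<d. L i j * L j l * \<Delta> l i) + (\<Sum>i<d. \<Sum>j<d. q i * (cmod (L i j))\<^sup>2))"
    unfolding eq norm_mult norm_of_nat
    using q0 norm_triangle_ineq[of "\<Sum>i<d. \<Sum>j<d. \<Sum>l<d. L i j * L j l * \<Delta> l i" "complex_of_real (\<Sum>i<d. \<Sum>j<d. q i * (cmod (L i j))\<^sup>2)"]
    by (intro mult_left_mono) (auto simp del: of_real_sum)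
  also have "\<dots> \<le> T * (sqrt (\<chi> / \<gamma>) * \<chi> + 2 * \<chi>)"
  proof (intro mult_left_mono add_mono)
    have "cmod (\<Sum>i<d. \<Sum>j<d. \<Sum>l<d. L i j * L j l * \<Delta> l i) \<le> (\<Sum>i<d. \<Sum>j<d. \<Sum>l<d. cmod (L i j) * cmod (L j l) * cmod (\<Delta> l i))"
      by (intro order_trans[OF norm_sum] sum_mono) (simp add: norm_mult)
    then show "cmod (\<Sum>i<d. \<Sum>j<d. \<Sum>l<d. L i j * L j l * \<Delta> l i) \<le> sqrt (\<chi> / \<gamma>) * \<chi>"
      using cubic_bound by linarith
    have "(\<Sum>i<d. \<Sum>j<d. q i * (cmod (L i j))\<^sup>2) \<le> (\<Sum>i<d. \<Sum>j<d. 2 * \<alpha> i * (cmod (L i j))\<^sup>2)"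
      using q by (intro sum_mono mult_right_mono) auto
    also have "\<dots> = 2 * \<chi>" by (simp add: sum_alpha_L[symmetric] sum_distrib_left mult.assoc)
    finally show "(\<Sum>i<d. \<Sum>j<d. q i * (cmod (L i j))\<^sup>2) \<le> 2 * \<chi>" .
  qed simp
  finally show ?thesis by (simp add: algebra_simps)
qed

text \<open>For the test observable these are the coefficients of \<open>lin s\<close> with respect
  to the centred matrix units of the eigenbasis.\<close>

definition H :: "nat \<Rightarrow> nat \<Rightarrow> nat \<Rightarrow> complex" where
  "H s i j = 2 * w i j * (\<Sum>t\<in>{..<T} - {s}. R t i j - c i j)"

lemma H_cnj: "cnj (H s i j) = H s j i"
  by (simp add: H_def R_cnj w_sym c_def)

lemma sum_dev: "(\<Sum>t<T. R t i j - c i j) = of_nat T * \<Delta> i j"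
  using T by (simp add: \<Delta>_def sum_subtractf field_simps)

text \<open>Adding and subtracting the missing copy \<open>s\<close> turns the offset sum into T
  times \<open>\<Delta>\<close>, a term from copy \<open>s\<close> itself and a diagonal term with
  entries at most 2. The 12 is 3 from \<open>NN_add3\<close> times the square of the common factor
  2.\<close>

lemma NN_H:
  assumes s: "s < T"
  shows "NN s (H s) \<le> 12 * ((real T)\<^sup>2 * NN s L + (\<tau> s)\<^sup>2 + 4)"
proof -
  define K where "K i j = (if i = j then complex_of_real (q i / \<alpha> i) else 0)" for i j
  have "H s i j = (2 * of_nat T) * L i j + (-2) * (w i j * R s i j) + 2 * K i j" for i j
  proof -
    have "(\<Sum>t\<in>{..<T} - {s}. R t i j - c i j) = of_nat T * \<Delta> i j - (R s i j - c i j)"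
      unfolding sum_dev[symmetric] using s by (simp add: sum.remove[of "{..<T}" s])
    then have "H s i j = 2 * w i j * (of_nat T * \<Delta> i j - (R s i j - c i j))"
      by (simp only: H_def)
    also have "\<dots> = (2 * of_nat T) * (w i j * \<Delta> i j) + (-2) * (w i j * R s i j) + 2 * (w i j * c i j)"
      by (simp add: algebra_simps)
    also have "w i j * c i j = K i j"
      using alpha_pos[of i] by (simp add: c_def K_def w_def)
    finally show ?thesis by (simp only: L_def)
  qed
  then have Hs: "H s = (\<lambda>i j. (2 * of_nat T) * L i j + (-2) * (w i j * R s i j) + 2 * K i j)"
    by (intro ext)
  have "NN s (H s) \<le> 3 * (NN s (\<lambda>i j. (2 * of_nat T) * L i j) + NN s (\<lambda>i j. (-2) * (w i j * R s i j)) + NN s (\<lambda>i j. 2 * K i j))"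
    unfolding Hs by (rule NN_add3)
  also have "\<dots> = 12 * ((real T)\<^sup>2 * NN s L + NN s (\<lambda>i j. w i j * R s i j) + NN s K)"
    unfolding NN_smult by (simp add: norm_mult power_mult_distrib)
  also have "\<dots> \<le> 12 * ((real T)\<^sup>2 * NN s L + (\<tau> s)\<^sup>2 + 4)"
  proof -
    have "NN s K \<le> 4" unfolding K_def
      using NN_diag[OF s, of "\<lambda>i. q i / \<alpha> i"] q alpha_pos by (simp add: divide_le_eq less_imp_le)
    then show ?thesis by (intro mult_left_mono add_mono NN_R[OF s]) auto
  qed
  finally show ?thesis .
qed

text \<open>The 20 is 8 from the pair terms plus 12 from the copies' own squares
  \<open>(\<tau> s)\<^sup>2\<close>, whose sum is at most the square of the sum; 48 is 12 times the
  constant 4 of \<open>NN_H\<close>.\<close>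

lemma variance_bound:
  "2 * (\<Sum>s<T. \<Sum>t\<in>{..<T} - {s}. 4 * \<tau> s * \<tau> t) + (\<Sum>s<T. NN s (H s)) \<le>
    20 * (\<Sum>s<T. \<tau> s)\<^sup>2 + 48 * T + 12 * real T ^ 3 * (\<chi> * (2 + sqrt (\<chi> / \<gamma>)))"
proof -
  let ?S = "\<Sum>s<T. \<tau> s"
  have S2: "?S\<^sup>2 = (\<Sum>s<T. \<Sum>t<T. \<tau> s * \<tau> t)" by (simp add: power2_eq_square sum_product)
  have "(\<Sum>s<T. \<Sum>t\<in>{..<T} - {s}. 4 * \<tau> s * \<tau> t) \<le> (\<Sum>s<T. \<Sum>t<T. 4 * \<tau> s * \<tau> t)"
    by (intro sum_mono sum_mono2) (auto simp: tau_nonneg)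
  also have "\<dots> = 4 * ?S\<^sup>2" by (simp add: S2 sum_distrib_left mult_ac)
  finally have 1: "2 * (\<Sum>s<T. \<Sum>t\<in>{..<T} - {s}. 4 * \<tau> s * \<tau> t) \<le> 8 * ?S\<^sup>2" by simp
  have "(\<Sum>s<T. (\<tau> s)\<^sup>2) \<le> (\<Sum>s<T. \<Sum>t<T. \<tau> s * \<tau> t)"
  proof (intro sum_mono)
    fix s assume s: "s \<in> {..<T}"
    have "(\<Sum>t\<in>{s}. \<tau> s * \<tau> t) \<le> (\<Sum>t<T. \<tau> s * \<tau> t)"
      using s by (intro sum_mono2) (auto simp: tau_nonneg)
    then show "(\<tau> s)\<^sup>2 \<le> (\<Sum>t<T. \<tau> s * \<tau> t)" by (simp add: power2_eq_square)
  qed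
  then have 2: "(\<Sum>s<T. (\<tau> s)\<^sup>2) \<le> ?S\<^sup>2" by (simp add: S2)
  have "(\<Sum>s<T. NN s (H s)) \<le> (\<Sum>s<T. 12 * ((real T)\<^sup>2 * NN s L + (\<tau> s)\<^sup>2 + 4))"
    by (intro sum_mono NN_H) auto
  also have "\<dots> = 12 * (real T)\<^sup>2 * (\<Sum>s<T. NN s L) + 12 * (\<Sum>s<T. (\<tau> s)\<^sup>2) + 48 * T"
    by (simp add: sum.distrib sum_distrib_left distrib_left mult.assoc)
  also have "\<dots> \<le> 12 * (real T)\<^sup>2 * (T * (\<chi> * (2 + sqrt (\<chi> / \<gamma>)))) + 12 * ?S\<^sup>2 + 48 * T"
    using 2 sum_NN_L by (intro add_mono mult_left_mono) auto
  finally show ?thesis using 1 by (simp add: power2_eq_square power3_eq_cube mult_ac)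
qed

section \<open>Mean and bias of the statistic\<close>

lemma sum_w_R:
  assumes "s < T"
  shows "(\<Sum>i<d. \<Sum>j<d. w i j * (cmod (R s i j))\<^sup>2) \<le> \<tau> s"
proof -
  define g where "g i = e i * a s i * a s i" for i
  have "(\<Sum>i<d. \<Sum>j<d. w i j * (cmod (R s i j))\<^sup>2) \<le> (\<Sum>i<d. \<Sum>j<d. g i * g j)"
  proof (intro sum_mono)
    fix i j
    have "w i j * (cmod (R s i j))\<^sup>2 \<le> (e i * e j) * (a s i * a s j)\<^sup>2"
      by (intro mult_mono w_le power_mono cmod_R) (auto simp: e_nonneg)
    then show "w i j * (cmod (R s i j))\<^sup>2 \<le> g i * g j"
      by (simp add: g_def power2_eq_square mult_ac)
  qed
  also have "\<dots> = (\<Sum>i<d. g i)\<^sup>2" by (simp add: power2_eq_square sum_product)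
  finally show ?thesis using sum_eaa_le[OF assms, of s] by (simp add: g_def)
qed

text \<open>The diagonal terms \<open>s = t\<close> that the pair statistic leaves out.\<close>
definition bias :: real where
  "bias = (\<Sum>s<T. \<Sum>i<d. \<Sum>j<d. w i j * (cmod (R s i j - c i j))\<^sup>2)"

lemma bias_nonneg: "0 \<le> bias"
  unfolding bias_def by (intro sum_nonneg mult_nonneg_nonneg) (auto simp: w_pos less_imp_le)

lemma bias_le: "bias \<le> 2 * (\<Sum>s<T. \<tau> s) + 4 * T"
proof -
  have "(\<Sum>i<d. \<Sum>j<d. w i j * (cmod (R s i j - c i j))\<^sup>2) \<le> 2 * \<tau> s + 4" if s: "s < T" for s
  proof -
    have "(cmod (x - y))\<^sup>2 \<le> 2 * (cmod x)\<^sup>2 + 2 * (cmod y)\<^sup>2" for x y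
    proof -
      have "(cmod (x - y))\<^sup>2 \<le> (cmod x + cmod y)\<^sup>2"
        by (intro power_mono norm_triangle_ineq4) auto
      also have "\<dots> \<le> 2 * (cmod x)\<^sup>2 + 2 * (cmod y)\<^sup>2"
        using sum_squares_bound[of "cmod x" "cmod y"] by (simp add: power2_eq_square algebra_simps)
      finally show ?thesis .
    qed
    then have "(\<Sum>i<d. \<Sum>j<d. w i j * (cmod (R s i j - c i j))\<^sup>2) \<le>
      (\<Sum>i<d. \<Sum>j<d. w i j * (2 * (cmod (R s i j))\<^sup>2 + 2 * (cmod (c i j))\<^sup>2))"
      using w_pos by (intro sum_mono mult_left_mono) (auto simp: less_imp_le)
    also have "\<dots> = 2 * (\<Sum>i<d. \<Sum>j<d. w i j * (cmod (R s i j))\<^sup>2) + 2 * (\<Sum>i<d. \<Sum>j<d. w i j * (cmod (c i j))\<^sup>2)"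
      by (simp add: sum.distrib sum_distrib_left distrib_left mult_ac)
    \<comment> \<open>\<open>c\<close> is diagonal, so this is the sum of
      \<open>(q i)\<^sup>2 / \<alpha> i\<close>, and \<open>q i \<le> 2 * \<alpha> i\<close> bounds
      it by twice the trace.\<close>
    also have "(\<Sum>i<d. \<Sum>j<d. w i j * (cmod (c i j))\<^sup>2) \<le> 2"
    proof -
      have "(\<Sum>i<d. \<Sum>j<d. w i j * (cmod (c i j))\<^sup>2) = (\<Sum>i<d. \<Sum>j<d. if i = j then w i i * (q i)\<^sup>2 else 0)"
        by (intro sum.cong refl) (auto simp: c_def)
      also have "\<dots> = (\<Sum>i<d. w i i * (q i)\<^sup>2)" by simp
      also have "\<dots> \<le> (\<Sum>i<d. 2 * q i)"
      proof (intro sum_mono)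
        fix i
        have "q i * q i \<le> (2 * \<alpha> i) * q i" using q by (intro mult_right_mono) auto
        then show "w i i * (q i)\<^sup>2 \<le> 2 * q i"
          using alpha_pos[of i] by (simp add: w_def power2_eq_square field_simps)
      qed
      finally show ?thesis using sum_q by (simp add: sum_distrib_left[symmetric])
    qed
    finally show ?thesis using sum_w_R[OF s] by simp
  qed
  then have "bias \<le> (\<Sum>s<T. 2 * \<tau> s + 4)" unfolding bias_def by (intro sum_mono) auto
  then show ?thesis by (simp add: sum.distrib sum_distrib_left)
qed

text \<open>Over all pairs of copies the double sum would factor into T \<open>\<Delta>\<close>
  times its conjugate and give T^2 \<open>\<chi>\<close>; leaving out \<open>s = t\<close> subtracts
  \<open>bias\<close>.\<close>

lemma mean_eq:
  "(\<Sum>s<T. \<Sum>t\<in>{..<T} - {s}. \<Sum>i<d. \<Sum>j<d. w i j * (R s j i - c j i) * (R t i j - c i j)) =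
    complex_of_real ((real T)\<^sup>2 * \<chi> - bias)"
proof -
  have x: "(\<Sum>s<T. \<Sum>t\<in>{..<T} - {s}. f s * g t) = (\<Sum>s<T. f s) * (\<Sum>t<T. g t) - (\<Sum>s<T. f s * g s)"
    for f g :: "nat \<Rightarrow> complex"
  proof -
    have "(\<Sum>t\<in>{..<T} - {s}. f s * g t) = (\<Sum>t<T. f s * g t) - f s * g s" if "s < T" for s
      using that by (simp add: sum_diff1)
    then show ?thesis by (simp add: sum_subtractf sum_product)
  qed
  have "(\<Sum>s<T. \<Sum>t\<in>{..<T} - {s}. \<Sum>i<d. \<Sum>j<d. w i j * (R s j i - c j i) * (R t i j - c i j)) =
    (\<Sum>s<T. \<Sum>i<d. \<Sum>j<d. \<Sum>t\<in>{..<T} - {s}. w i j * (R s j i - c j i) * (R t i j - c i j))"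
    by (rule sum.cong[OF refl], rule sum_rotate3[symmetric])
  also have "\<dots> = (\<Sum>i<d. \<Sum>j<d. \<Sum>s<T. \<Sum>t\<in>{..<T} - {s}. w i j * (R s j i - c j i) * (R t i j - c i j))"
    by (rule sum_rotate3[symmetric])
  also have "\<dots> = (\<Sum>i<d. \<Sum>j<d. complex_of_real (w i j * ((real T)\<^sup>2 * (cmod (\<Delta> i j))\<^sup>2)) -
      (\<Sum>s<T. complex_of_real (w i j * (cmod (R s i j - c i j))\<^sup>2)))"
  proof (intro sum.cong refl)
    fix i j
    have cc: "R s j i - c j i = cnj (R s i j - c i j)" for s by (simp add: R_cnj c_def)
    have "(\<Sum>s<T. \<Sum>t\<in>{..<T} - {s}. w i j * (R s j i - c j i) * (R t i j - c i j)) =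
      w i j * ((of_nat T * \<Delta> j i) * (of_nat T * \<Delta> i j) - (\<Sum>s<T. (R s j i - c j i) * (R s i j - c i j)))"
      unfolding sum_dev[symmetric] x[symmetric] by (simp add: sum_distrib_left mult.assoc)
    also have "\<dots> = complex_of_real (w i j * ((real T)\<^sup>2 * (cmod (\<Delta> i j))\<^sup>2)) -
      (\<Sum>s<T. complex_of_real (w i j * (cmod (R s i j - c i j))\<^sup>2))"
      unfolding cc Delta_cnj[of i j, symmetric]
      by (simp only: of_real_mult complex_norm_square)
        (simp add: right_diff_distrib sum_distrib_left power2_eq_square mult_ac del: complex_cnj_diff)
    finally show "(\<Sum>s<T. \<Sum>t\<in>{..<T} - {s}. w i j * (R s j i - c j i) * (R t i j - c i j)) = \<dots>" .
  qed
  also have "\<dots> = complex_of_real ((\<Sum>i<d. \<Sum>j<d. w i j * ((real T)\<^sup>2 * (cmod (\<Delta> i j))\<^sup>2)) -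
      (\<Sum>i<d. \<Sum>j<d. \<Sum>s<T. w i j * (cmod (R s i j - c i j))\<^sup>2))"
    by (simp add: sum_subtractf)
  also have "(\<Sum>i<d. \<Sum>j<d. \<Sum>s<T. w i j * (cmod (R s i j - c i j))\<^sup>2) = bias"
    unfolding bias_def by (rule sum_rotate3)
  also have "(\<Sum>i<d. \<Sum>j<d. w i j * ((real T)\<^sup>2 * (cmod (\<Delta> i j))\<^sup>2)) = (real T)\<^sup>2 * \<chi>"
    by (simp add: \<chi>_def sum_distrib_left mult_ac)
  finally show ?thesis .
qed

text \<open>The diagonal of the average is that of \<open>\<Delta>\<close> plus \<open>q\<close>.
  The \<open>q\<close> part gives 2 d. For the rest, Cauchy-Schwarz splits
  \<open>1 / \<alpha> i\<close> evenly: one half completes the diagonal terms of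
  \<open>\<chi>\<close>, the other sums to at most d / \<gamma>.\<close>

lemma sum_tau_le: "(\<Sum>s<T. \<tau> s) \<le> T * (2 * d + sqrt (\<chi> * d / \<gamma>))"
proof -
  have aT: "(\<Sum>s<T. (a s i)\<^sup>2) = T * (Re (\<Delta> i i) + q i)" for i
  proof -
    have "of_nat T * (\<Delta> i i + c i i) = (\<Sum>s<T. R s i i)" using T by (simp add: \<Delta>_def)
    also have "\<dots> = complex_of_real (\<Sum>s<T. (a s i)\<^sup>2)" by (simp add: R_diag)
    finally have "Re (of_nat T * (\<Delta> i i + c i i)) = (\<Sum>s<T. (a s i)\<^sup>2)" by simp
    then show ?thesis by (simp add: c_def)
  qed
  have "(\<Sum>s<T. \<tau> s) = (\<Sum>i<d. (\<Sum>s<T. (a s i)\<^sup>2) / \<alpha> i)"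
    unfolding \<tau>_def sum_divide_distrib by (rule sum.swap)
  also have "\<dots> = T * (\<Sum>i<d. Re (\<Delta> i i) / \<alpha> i + q i / \<alpha> i)"
    by (simp add: aT sum_distrib_left add_divide_distrib distrib_left)
  also have "\<dots> \<le> T * (\<Sum>i<d. cmod (\<Delta> i i) / \<alpha> i + 2)"
  proof (intro mult_left_mono sum_mono add_mono)
    fix i
    show "Re (\<Delta> i i) / \<alpha> i \<le> cmod (\<Delta> i i) / \<alpha> i"
      using alpha_pos[of i] by (intro divide_right_mono complex_Re_le_cmod) auto
    show "q i / \<alpha> i \<le> 2" using q alpha_pos[of i] by (simp add: divide_le_eq)
  qed simp
  also have "(\<Sum>i<d. cmod (\<Delta> i i) / \<alpha> i + 2) = (\<Sum>i<d. cmod (\<Delta> i i) / \<alpha> i) + 2 * d"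
    by (simp add: sum.distrib)
  also have "(\<Sum>i<d. cmod (\<Delta> i i) / \<alpha> i) \<le> sqrt (\<chi> * d / \<gamma>)"
  proof (rule real_le_rsqrt)
    have "(\<Sum>i<d. cmod (\<Delta> i i) / \<alpha> i) = (\<Sum>i<d. (cmod (\<Delta> i i) * e i) * e i)"
      using e2 by (simp add: power2_eq_square mult.assoc)
    then have "(\<Sum>i<d. cmod (\<Delta> i i) / \<alpha> i)\<^sup>2 \<le> (\<Sum>i<d. (cmod (\<Delta> i i) * e i)\<^sup>2) * (\<Sum>i<d. (e i)\<^sup>2)"
      using Cauchy_Schwarz_sum[of "\<lambda>i. cmod (\<Delta> i i) * e i" e "{..<d}"] by simp
    also have "\<dots> \<le> \<chi> * (d * (1 / \<gamma>))"
    proof (rule mult_mono)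
      have "(\<Sum>i<d. (cmod (\<Delta> i i) * e i)\<^sup>2) = (\<Sum>i<d. \<Sum>j\<in>{i}. w i j * (cmod (\<Delta> i j))\<^sup>2)"
        using alpha_pos by (simp add: power_mult_distrib e2 w_def)
      also have "\<dots> \<le> \<chi>" unfolding \<chi>_def
        by (intro sum_mono sum_mono2) (auto simp: w_pos less_imp_le)
      finally show "(\<Sum>i<d. (cmod (\<Delta> i i) * e i)\<^sup>2) \<le> \<chi>" .
      have "(\<Sum>i<d. (e i)\<^sup>2) \<le> (\<Sum>i<d. 1 / \<gamma>)"
        unfolding e2 using gamma by (intro sum_mono divide_left_mono) (auto simp: alpha_pos)
      then show "(\<Sum>i<d. (e i)\<^sup>2) \<le> d * (1 / \<gamma>)" by simp
    qed (auto simp: chi_nonneg sum_nonneg)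
    finally show "(\<Sum>i<d. cmod (\<Delta> i i) / \<alpha> i)\<^sup>2 \<le> \<chi> * d / \<gamma>" by simp
  qed
  finally show ?thesis using T by (simp add: add.commute)
qed

end

section \<open>The chi-square test\<close>

text \<open>\<open>F\<close> at (i, j) is the matrix unit of columns i and j of \<open>U\<close>,
  and \<open>c\<close> is its mean under the state with spectrum \<open>q\<close>. With unit weights
  and no centring, the two-copy operator is the swap.\<close>

definition test_kernel :: "nat \<Rightarrow> nat \<Rightarrow> complex mat \<Rightarrow> (nat \<Rightarrow> real) \<Rightarrow> (nat \<Rightarrow> real) \<Rightarrow> kernel" where
  "test_kernel d T U q \<alpha> = pair_kernel d T ({..<d} \<times> {..<d})
     (\<lambda>p x y. U $$ (x, fst p) * cnj (U $$ (y, snd p)))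
     (\<lambda>p. complex_of_real (2 / (\<alpha> (fst p) + \<alpha> (snd p))))
     (\<lambda>p. if fst p = snd p then complex_of_real (q (fst p)) else 0) prod.swap"

definition chi_dev :: "nat \<Rightarrow> complex mat \<Rightarrow> (nat \<Rightarrow> real) \<Rightarrow> (nat \<Rightarrow> real) \<Rightarrow> complex mat \<Rightarrow> real" where
  "chi_dev d U q \<alpha> X = (\<Sum>i<d. \<Sum>j<d. 2 / (\<alpha> i + \<alpha> j) *
     (cmod ((mat_adjoint U * X * U) $$ (i,j) - (if i = j then complex_of_real (q i) else 0)))\<^sup>2)"

lemma test_kernel_cnj: "test_kernel d T U q \<alpha> b a = cnj (test_kernel d T U q \<alpha> a b)"
  unfolding test_kernel_def by (rule pair_kernel_cnj) (auto simp: add.commute)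

lemma conj_index:
  assumes U: "U \<in> carrier_mat d d" and X: "X \<in> carrier_mat d d" and ij: "i < d" "j < d"
  shows "(mat_adjoint U * X * U) $$ (i,j) = (\<Sum>x<d. \<Sum>y<d. cnj (U $$ (x,i)) * X $$ (x,y) * U $$ (y,j))"
proof -
  have "(mat_adjoint U * X * U) $$ (i,j) = (\<Sum>y<d. (\<Sum>x<d. cnj (U $$ (x,i)) * X $$ (x,y)) * U $$ (y,j))"
    using assms by (simp add: scalar_prod_def adjoint_index lessThan_atLeast0)
  also have "\<dots> = (\<Sum>x<d. \<Sum>y<d. cnj (U $$ (x,i)) * X $$ (x,y) * U $$ (y,j))"
    by (simp only: sum_distrib_right) (rule sum.swap)
  finally show ?thesis .
qed

lemma sum_pairs: "(\<Sum>p\<in>A \<times> B. f p) = (\<Sum>i\<in>A. \<Sum>j\<in>B. f (i,j))"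
  by (simp add: sum.cartesian_product)

text \<open>The witnesses are the true mean of the observable for \<open>\<mu>\<close> and the sum
  of the traces \<open>\<tau>\<close> for \<open>S\<close>. Quantifying over them keeps the
  constants of the two locales out of the test.\<close>

lemma test_kernel_moments:
  assumes U: "unitary_mat d U" and \<rho>: "\<forall>t<T. density_mat d (\<rho> t)"
    and gamma: "0 < \<gamma>" "\<And>i. \<gamma> \<le> \<alpha> i"
    and q: "\<And>i. 0 \<le> q i" "\<And>i. q i \<le> 2 * \<alpha> i" and sum_q: "(\<Sum>i<d. q i) = 1"
    and T: "0 < T"
  defines "\<chi> \<equiv> chi_dev d U q \<alpha> (avg_state d T \<rho>)"
  shows "\<exists>\<mu> S. real T ^ 2 * \<chi> - (2 * S + 4 * real T) \<le> \<mu> \<and> \<mu> \<le> real T ^ 2 * \<chi> \<and>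
    0 \<le> S \<and> S \<le> real T * (2 * real d + sqrt (\<chi> * real d / \<gamma>)) \<and>
    Re (mom (d ^ T) (\<lambda>a b. tensor_all T \<rho> $$ (a,b))
       (\<lambda>a b. test_kernel d T U q \<alpha> a b - complex_of_real \<mu> * kid a b)
       (\<lambda>a b. test_kernel d T U q \<alpha> a b - complex_of_real \<mu> * kid a b)) \<le>
      20 * S\<^sup>2 + 48 * real T + 12 * real T ^ 3 * (\<chi> * (2 + sqrt (\<chi> / \<gamma>)))"
proof -
  have Uc: "U \<in> carrier_mat d d" using U by (simp add: unitary_mat_def)
  have psd: "psd_mat d (\<rho> t)" "mtrace (\<rho> t) = 1" if "t < T" for t
    using \<rho> that by (auto simp: density_mat_def)
  then have c: "\<forall>t<T. \<rho> t \<in> carrier_mat d d" by (auto simp: psd_mat_def)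
  have "\<exists>C. t < T \<longrightarrow> (\<forall>a<d. \<forall>b<d. \<rho> t $$ (a,b) = (\<Sum>c<d. C a c * cnj (C b c)))" for t
    using psd_mat_factor psd by blast
  then obtain C where C: "\<And>t a b. t < T \<Longrightarrow> a < d \<Longrightarrow> b < d \<Longrightarrow> \<rho> t $$ (a,b) = (\<Sum>c<d. C t a c * cnj (C t b c))"
    by metis
  \<comment> \<open>The Gram factor of \<open>\<rho> t\<close> expressed in the eigenbasis;
    \<open>R\<close> is then \<open>\<rho> t\<close> conjugated by \<open>U\<close>.\<close>
  define D where "D t i k = (\<Sum>x<d. cnj (U $$ (x,i)) * C t x k)" for t i k
  define r where "r t i j = \<rho> t $$ (i,j)" for t i j
  define R where "R t i j = (\<Sum>k<d. D t i k * cnj (D t j k))" for t i j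
  have Rr: "R t i j = (\<Sum>x<d. \<Sum>y<d. cnj (U $$ (x,i)) * r t x y * U $$ (y,j))" if t: "t < T" for t i j
  proof -
    have "R t i j = (\<Sum>k<d. \<Sum>x<d. \<Sum>y<d. cnj (U $$ (x,i)) * (C t x k * cnj (C t y k)) * U $$ (y,j))"
      by (simp add: R_def D_def sum_product mult_ac)
    also have "\<dots> = (\<Sum>x<d. \<Sum>y<d. \<Sum>k<d. cnj (U $$ (x,i)) * (C t x k * cnj (C t y k)) * U $$ (y,j))"
      by (rule sum_rotate3[symmetric])
    also have "\<dots> = (\<Sum>x<d. \<Sum>y<d. cnj (U $$ (x,i)) * r t x y * U $$ (y,j))"
      by (intro sum.cong refl) (simp add: r_def C[OF t] sum_distrib_left sum_distrib_right)
    finally show ?thesis .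
  qed
  have tr_r: "(\<Sum>i<d. r t i i) = 1" if "t < T" for t
    using psd(2)[OF that] carrier_matD(1)[OF c[rule_format, OF that]] by (simp add: mtrace_def r_def)
  have tr_R: "(\<Sum>i<d. R t i i) = 1" if t: "t < T" for t
  proof -
    have "(\<Sum>i<d. R t i i) = (\<Sum>x<d. \<Sum>y<d. \<Sum>i<d. r t x y * (U $$ (y,i) * cnj (U $$ (x,i))))"
      unfolding Rr[OF t] by (subst sum_rotate3) (simp add: mult_ac)
    also have "\<dots> = (\<Sum>x<d. \<Sum>y<d. if y = x then r t x y else 0)"
      by (intro sum.cong refl) (simp add: sum_distrib_left[symmetric] unitary_mat_sum_rows[OF U])
    finally show ?thesis using tr_r[OF t] by simp
  qed
  interpret G: gram_family d T D q \<alpha> \<gamma>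
  proof
    fix t assume t: "t < T"
    have "complex_of_real (\<Sum>i<d. \<Sum>k<d. (cmod (D t i k))\<^sup>2) = 1"
      using tr_R[OF t] by (simp add: R_def complex_norm_square del: of_real_power)
    then show "(\<Sum>i<d. \<Sum>k<d. (cmod (D t i k))\<^sup>2) = 1"
      by (simp only: of_real_eq_1_iff)
  qed (use gamma q sum_q T in auto)
  have GR: "G.R = R" by (intro ext) (simp add: G.R_def R_def)
  let ?P = "{..<d} \<times> {..<d}"
  let ?F = "\<lambda>p x y. U $$ (x, fst p) * cnj (U $$ (y, snd p))"
  let ?w = "\<lambda>p. complex_of_real (2 / (\<alpha> (fst p) + \<alpha> (snd p)))"
  let ?c = "\<lambda>p. if fst p = snd p then complex_of_real (q (fst p)) else 0"
  interpret Q: pair_statistic d T r ?P ?F ?w ?c prod.swap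
    by unfold_locales (auto simp: tr_r add.commute)
  have mean: "mean d (r t) (?F (i,j)) = R t j i" if "t < T" for t i j
    unfolding Rr[OF that] mean_def by (subst sum.swap) (simp add: mult_ac)
  have mom: "mom d (r t) (?F (i,j)) (?F (k,l)) = (if j = k then R t l i else 0)"
    if t: "t < T" and jk: "j < d" "k < d" for t i j k l
  proof -
    have "mom d (r t) (?F (i,j)) (?F (k,l)) =
      (\<Sum>x<d. \<Sum>y<d. \<Sum>z<d. (U $$ (x,i) * r t z x * cnj (U $$ (z,l))) * (cnj (U $$ (y,j)) * U $$ (y,k)))"
      by (simp add: mom_def mult_ac)
    also have "\<dots> = (\<Sum>x<d. \<Sum>z<d. \<Sum>y<d. (U $$ (x,i) * r t z x * cnj (U $$ (z,l))) * (cnj (U $$ (y,j)) * U $$ (y,k)))"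
      by (rule sum.cong[OF refl], rule sum.swap)
    also have "\<dots> = (\<Sum>x<d. \<Sum>z<d. (U $$ (x,i) * r t z x * cnj (U $$ (z,l))) * (if j = k then 1 else 0))"
      by (simp only: sum_distrib_left[symmetric] unitary_mat_sum_cols[OF U jk])
    also have "\<dots> = (if j = k then R t l i else 0)"
      unfolding Rr[OF t] by (subst sum.swap) (simp add: mult_ac)
    finally show ?thesis .
  qed
  have cov: "mom d (r t) (Q.cen t (i,j)) (Q.cen t (k,l)) = G.cov t i j k l"
    if "t < T" "j < d" "k < d" for t i j k l
    unfolding Q.mom_cen[OF that(1)] mom[OF that] mean[OF that(1)] G.cov_def GR ..
  have dev: "Q.dev t (i,j) = R t j i - G.c j i" if "t < T" for t i j
    by (simp only: Q.dev_def mean[OF that]) (simp add: G.c_def)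
  have chi: "\<chi> = G.\<chi>"
  proof -
    have "avg_state d T \<rho> $$ (x,y) = (\<Sum>t<T. r t x y) / of_nat T" if "x < d" "y < d" for x y
      using that by (simp add: avg_state_def r_def)
    moreover have ac: "avg_state d T \<rho> \<in> carrier_mat d d" by (simp add: avg_state_def)
    ultimately have "(mat_adjoint U * avg_state d T \<rho> * U) $$ (i,j) = (\<Sum>t<T. R t i j) / of_nat T"
      if "i < d" "j < d" for i j
    proof -
      have "(mat_adjoint U * avg_state d T \<rho> * U) $$ (i,j) =
          (\<Sum>x<d. \<Sum>y<d. \<Sum>t<T. cnj (U $$ (x,i)) * r t x y * U $$ (y,j) / of_nat T)"
        unfolding conj_index[OF Uc ac that]
        by (intro sum.cong refl) (simp add: avg_state_def r_def sum_distrib_left sum_distrib_right sum_divide_distrib)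
      also have "\<dots> = (\<Sum>t<T. \<Sum>x<d. \<Sum>y<d. cnj (U $$ (x,i)) * r t x y * U $$ (y,j) / of_nat T)"
        by (rule sum_rotate3)
      finally show ?thesis by (simp add: Rr sum_divide_distrib)
    qed
    then show ?thesis
      by (simp add: \<chi>_def chi_dev_def G.\<chi>_def G.w_def G.\<Delta>_def GR G.c_def)
  qed
  have m: "Q.m = complex_of_real ((real T)\<^sup>2 * G.\<chi> - G.bias)"
  proof -
    have "Q.m = (\<Sum>s<T. \<Sum>t\<in>{..<T} - {s}. \<Sum>i<d. \<Sum>j<d. G.w i j * (R s j i - G.c j i) * (R t i j - G.c i j))"
      unfolding Q.m_def sum.cartesian_product
      by (intro sum.cong refl) (auto simp: dev G.w_def case_prod_unfold)
    also have "\<dots> = complex_of_real ((real T)\<^sup>2 * G.\<chi> - G.bias)"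
      using G.mean_eq unfolding GR .
    finally show ?thesis .
  qed
  have lin: "Re (mom d (r s) (Q.lin s) (Q.lin s)) \<le> G.NN s (G.H s)" if s: "s < T" for s
  proof -
    have "Q.lin s = (\<lambda>x y. \<Sum>p\<in>?P. G.H s (fst p) (snd p) * Q.cen s p x y)"
      unfolding Q.lin_def G.H_def GR
      by (intro ext sum.cong refl) (auto simp: dev G.w_def intro!: arg_cong2[of _ _ _ _ times])
    then have "mom d (r s) (Q.lin s) (Q.lin s) = (\<Sum>p\<in>?P. \<Sum>p'\<in>?P. G.H s (fst p) (snd p) * G.H s (fst p') (snd p') *
        mom d (r s) (Q.cen s p) (Q.cen s p'))"
      by (simp add: mom_sum_left mom_sum_right mom_smult_left mom_smult_right sum_distrib_left mult_ac)
    also have "\<dots> = (\<Sum>p\<in>?P. \<Sum>p'\<in>?P. G.H s (fst p) (snd p) * G.H s (fst p') (snd p') *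
        G.cov s (fst p) (snd p) (fst p') (snd p'))"
      using s by (intro sum.cong refl) (auto simp: cov)
    also have "\<dots> = (\<Sum>i<d. \<Sum>j<d. \<Sum>k<d. \<Sum>l<d. G.H s i j * G.H s k l * G.cov s i j k l)"
      by (simp only: sum_pairs fst_conv snd_conv)
    also have "\<dots> = (\<Sum>i<d. \<Sum>j<d. \<Sum>k<d. \<Sum>l<d. if j = k then G.H s i j * G.H s k l * R s l i else 0)
        - (\<Sum>i<d. \<Sum>j<d. \<Sum>k<d. \<Sum>l<d. (G.H s i j * R s j i) * (G.H s k l * R s l k))"
      unfolding sum_subtractf[symmetric]
      by (intro sum.cong refl) (simp add: G.cov_def GR algebra_simps)
    also have "(\<Sum>i<d. \<Sum>j<d. \<Sum>k<d. \<Sum>l<d. if j = k then G.H s i j * G.H s k l * R s l i else 0) =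
        (\<Sum>i<d. \<Sum>j<d. \<Sum>l<d. G.H s i j * G.H s j l * R s l i)"
    proof (rule sum.cong[OF refl], rule sum.cong[OF refl])
      fix i j assume j: "j \<in> {..<d}"
      have "(\<Sum>k<d. \<Sum>l<d. if j = k then G.H s i j * G.H s k l * R s l i else 0) =
         (\<Sum>k<d. if j = k then (\<Sum>l<d. G.H s i j * G.H s k l * R s l i) else 0)"
        by (intro sum.cong refl) auto
      then show "(\<Sum>k<d. \<Sum>l<d. if j = k then G.H s i j * G.H s k l * R s l i else 0) =
         (\<Sum>l<d. G.H s i j * G.H s j l * R s l i)" using j by simp
    qed
    also have "\<dots> = complex_of_real (G.NN s (G.H s))"
      using G.NN_eq[of "G.H s" s] unfolding GR by (simp add: G.H_cnj)
    also have "(\<Sum>i<d. \<Sum>j<d. \<Sum>k<d. \<Sum>l<d. (G.H s i j * R s j i) * (G.H s k l * R s l k)) =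
        (\<Sum>i<d. \<Sum>j<d. G.H s i j * R s j i) * (\<Sum>k<d. \<Sum>l<d. G.H s k l * R s l k)"
      by (simp only: sum_distrib_left[symmetric] sum_distrib_right[symmetric])
    finally have eq: "mom d (r s) (Q.lin s) (Q.lin s) = complex_of_real (G.NN s (G.H s)) -
        (\<Sum>i<d. \<Sum>j<d. G.H s i j * R s j i) * (\<Sum>k<d. \<Sum>l<d. G.H s k l * R s l k)" .
    \<comment> \<open>This is the mean of a Hermitian operator in a state, hence real. Its square is
      nonnegative, so a second moment bounds the variance.\<close>
    have "cnj (\<Sum>i<d. \<Sum>j<d. G.H s i j * R s j i) = (\<Sum>i<d. \<Sum>j<d. G.H s j i * R s i j)"
      using G.R_cnj unfolding GR by (simp add: G.H_cnj)
    also have "\<dots> = (\<Sum>i<d. \<Sum>j<d. G.H s i j * R s j i)" by (rule sum.swap)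
    finally have "Im (\<Sum>i<d. \<Sum>j<d. G.H s i j * R s j i) = 0"
      by (simp only: complex_eq_iff cnj.sel) simp
    then show ?thesis unfolding eq by (simp only: minus_complex.sel times_complex.sel Re_complex_of_real) simp
  qed
  have quad: "Re (\<Sum>p\<in>?P. \<Sum>p'\<in>?P. ?w p * ?w p' *
      mom d (r s) (Q.cen s p) (Q.cen s p') * mom d (r t) (Q.cen t (prod.swap p)) (Q.cen t (prod.swap p'))) \<le> 4 * G.\<tau> s * G.\<tau> t"
    if st: "s < T" "t < T" for s t
  proof -
    have "(\<Sum>p\<in>?P. \<Sum>p'\<in>?P. ?w p * ?w p' *
      mom d (r s) (Q.cen s p) (Q.cen s p') * mom d (r t) (Q.cen t (prod.swap p)) (Q.cen t (prod.swap p'))) =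
      (\<Sum>p\<in>?P. \<Sum>p'\<in>?P. complex_of_real (G.w (fst p) (snd p) * G.w (fst p') (snd p')) *
      G.cov s (fst p) (snd p) (fst p') (snd p') * G.cov t (snd p) (fst p) (snd p') (fst p'))"
      using st by (intro sum.cong refl) (auto simp: cov G.w_def)
    also have "\<dots> = (\<Sum>i<d. \<Sum>j<d. \<Sum>k<d. \<Sum>l<d. complex_of_real (G.w i j * G.w k l) * G.cov s i j k l * G.cov t j i l k)"
      by (simp only: sum_pairs fst_conv snd_conv)
    finally show ?thesis
      using order_trans[OF complex_Re_le_cmod G.pair_bound[OF st]] by (simp only:)
  qed
  have ten: "ten d T r a b = tensor_all T \<rho> $$ (a,b)" if "a < d ^ T" "b < d ^ T" for a b
    using tensor_all_index[OF c that] by (simp add: ten_def r_def)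
  have "mom (d ^ T) (\<lambda>a b. tensor_all T \<rho> $$ (a,b))
       (\<lambda>a b. test_kernel d T U q \<alpha> a b - Q.m * kid a b)
       (\<lambda>a b. test_kernel d T U q \<alpha> a b - Q.m * kid a b) =
     2 * (\<Sum>s<T. \<Sum>t\<in>{..<T} - {s}. \<Sum>p\<in>?P. \<Sum>p'\<in>?P. ?w p * ?w p' *
      mom d (r s) (Q.cen s p) (Q.cen s p') * mom d (r t) (Q.cen t (prod.swap p)) (Q.cen t (prod.swap p'))) +
    (\<Sum>s<T. mom d (r s) (Q.lin s) (Q.lin s))"
    unfolding Q.variance[symmetric] test_kernel_def by (rule mom_cong) (simp_all add: ten)
  then have "Re (mom (d ^ T) (\<lambda>a b. tensor_all T \<rho> $$ (a,b))
       (\<lambda>a b. test_kernel d T U q \<alpha> a b - Q.m * kid a b)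
       (\<lambda>a b. test_kernel d T U q \<alpha> a b - Q.m * kid a b)) =
     2 * (\<Sum>s<T. \<Sum>t\<in>{..<T} - {s}. Re (\<Sum>p\<in>?P. \<Sum>p'\<in>?P. ?w p * ?w p' *
      mom d (r s) (Q.cen s p) (Q.cen s p') * mom d (r t) (Q.cen t (prod.swap p)) (Q.cen t (prod.swap p')))) +
    (\<Sum>s<T. Re (mom d (r s) (Q.lin s) (Q.lin s)))"
    by (simp only: Re_sum plus_complex.sel times_complex.sel) simp
  also have "\<dots> \<le> 2 * (\<Sum>s<T. \<Sum>t\<in>{..<T} - {s}. 4 * G.\<tau> s * G.\<tau> t) + (\<Sum>s<T. G.NN s (G.H s))"
    by (intro add_mono mult_left_mono sum_mono quad lin) auto
  also have "\<dots> \<le> 20 * (\<Sum>s<T. G.\<tau> s)\<^sup>2 + 48 * real T + 12 * real T ^ 3 * (G.\<chi> * (2 + sqrt (G.\<chi> / \<gamma>)))"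
    using G.variance_bound by simp
  finally have V: "Re (mom (d ^ T) (\<lambda>a b. tensor_all T \<rho> $$ (a,b))
       (\<lambda>a b. test_kernel d T U q \<alpha> a b - Q.m * kid a b)
       (\<lambda>a b. test_kernel d T U q \<alpha> a b - Q.m * kid a b)) \<le>
       20 * (\<Sum>s<T. G.\<tau> s)\<^sup>2 + 48 * real T + 12 * real T ^ 3 * (G.\<chi> * (2 + sqrt (G.\<chi> / \<gamma>)))" .
  show ?thesis
    unfolding chi
    by (rule exI[of _ "(real T)\<^sup>2 * G.\<chi> - G.bias"], rule exI[of _ "\<Sum>s<T. G.\<tau> s"])
      (use V[unfolded m] G.bias_le G.bias_nonneg G.sum_tau_le G.tau_nonneg in \<open>auto intro: sum_nonneg\<close>)
qed

text \<open>Any large enough \<open>K\<close> works: bias and variance are at most \<open>10 T\<^sup>2 x / K\<close> and \<open>264 T\<^sup>4 x\<^sup>2 / K\<close>, against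
  the gap \<open>0.005 T\<^sup>2 x\<close> between either case and the threshold \<open>0.995 \<theta> T\<^sup>2\<close>.\<close>
lemma error_budget:
  fixes T d :: nat and K \<theta> \<chi> \<gamma> S \<mu> V x :: real
  assumes K: "K = 10 ^ 10" and d: "0 < d" and T: "0 < T" and gamma: "0 < \<gamma>" and \<theta>: "0 < \<theta>" and \<chi>: "0 \<le> \<chi>"
    and h1: "K * d \<le> T * \<theta>" and h2: "K\<^sup>2 * d \<le> (real T)\<^sup>2 * \<theta> * \<gamma>"
    and x: "x = max \<theta> \<chi>"
    and S: "0 \<le> S" "S \<le> real T * (2 * real d + sqrt (\<chi> * real d / \<gamma>))"
    and V: "V = 20 * S\<^sup>2 + 48 * real T + 12 * real T ^ 3 * (\<chi> * (2 + sqrt (\<chi> / \<gamma>)))"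
  shows "2 * S + 4 * real T \<le> (real T)\<^sup>2 * x / 1000" and "V / ((real T)\<^sup>2 * x * 0.004)\<^sup>2 \<le> 0.01"
proof -
  define t where "t = real T"
  \<comment> \<open>The common scale: 1, \<open>d\<close> and both square roots are at most
    \<open>y\<close>. The condition \<open>h1\<close> gives this for \<open>d\<close>, and
    \<open>h2\<close> with \<open>x\<close> above both \<open>\<theta>\<close> and
    \<open>\<chi>\<close> gives it for the roots, so bias and variance become multiples of
    \<open>t * y\<close> and its square.\<close>
  define y where "y = t * x / K"
  have t: "1 \<le> t" using T by (simp add: t_def)
  have x0: "0 < x" "\<theta> \<le> x" "\<chi> \<le> x" using \<theta> x by auto
  have K0: "0 < K" using K by simp
  have dy: "d \<le> y"
  proof -
    have "t * \<theta> \<le> t * x" using x0 t by (intro mult_left_mono) auto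
    then have "K * d \<le> t * x" using h1 unfolding t_def by linarith
    then show ?thesis using K0 by (simp add: y_def field_simps)
  qed
  have y1: "1 \<le> y" using d dy by linarith
  have sq: "sqrt (\<chi> * d / \<gamma>) \<le> y"
  proof (rule real_le_lsqrt)
    have "K\<^sup>2 * (\<chi> * d) = \<chi> * (K\<^sup>2 * d)" by simp
    also have "\<dots> \<le> x * (t\<^sup>2 * x * \<gamma>)"
    proof (rule mult_mono)
      show "K\<^sup>2 * d \<le> t\<^sup>2 * x * \<gamma>"
        by (rule order_trans[OF h2[folded t_def]]) (use x0 gamma in \<open>intro mult_right_mono mult_left_mono, auto\<close>)
    qed (use x0 \<chi> in auto)
    finally show "\<chi> * d / \<gamma> \<le> y\<^sup>2"
      using gamma K0 by (simp add: y_def power_divide power_mult_distrib field_simps power2_eq_square)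
  qed (use y1 in auto)
  have sq': "sqrt (\<chi> / \<gamma>) \<le> y"
  proof -
    have "\<chi> / \<gamma> \<le> \<chi> * d / \<gamma>" using \<chi> d gamma by (intro divide_right_mono) (auto simp: mult_le_cancel_left1)
    then show ?thesis using sq real_sqrt_le_mono order_trans by blast
  qed
  have S3: "S \<le> 3 * (t * y)"
  proof -
    have "S \<le> t * (2 * y + y)" using S(2) dy sq t
      by (elim order_trans) (auto simp: t_def intro!: mult_left_mono add_mono)
    then show ?thesis by simp
  qed
  have ty: "t \<le> t * y" using t y1 by simp
  have yK: "t * y = t\<^sup>2 * x / K" by (simp add: y_def power2_eq_square)
  have t2x: "0 < t\<^sup>2 * x" using t x0 by simp
  show "2 * S + 4 * real T \<le> (real T)\<^sup>2 * x / 1000"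
  proof -
    have "2 * S + 4 * t \<le> 10 * (t * y)" using S3 ty by simp
    also have "\<dots> \<le> t\<^sup>2 * x / 1000" unfolding yK K using t2x by (simp add: field_simps less_imp_le)
    finally show ?thesis by (simp add: t_def)
  qed
  have "S\<^sup>2 \<le> (3 * (t * y))\<^sup>2" using S S3 by (intro power_mono) auto
  moreover have "t \<le> (t * y)\<^sup>2"
  proof -
    have "1 \<le> t * y" using ty t by linarith
    then have "0 \<le> t * y" by linarith
    then have "t * 1 \<le> (t * y) * (t * y)" by (rule mult_mono[OF ty \<open>1 \<le> t * y\<close>]) simp
    then show ?thesis by (simp add: power2_eq_square)
  qed
  moreover have "t ^ 3 * (\<chi> * (2 + sqrt (\<chi> / \<gamma>))) \<le> 3 * (t * y) * (t\<^sup>2 * x)"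
  proof -
    have "\<chi> * (2 + sqrt (\<chi> / \<gamma>)) \<le> x * (3 * y)"
      using sq' y1 x0 \<chi> gamma by (intro mult_mono) auto
    then have "t ^ 3 * (\<chi> * (2 + sqrt (\<chi> / \<gamma>))) \<le> t ^ 3 * (x * (3 * y))"
      using t by (intro mult_left_mono) auto
    then show ?thesis by (simp add: power2_eq_square power3_eq_cube mult_ac)
  qed
  ultimately have "V \<le> 228 * (t * y)\<^sup>2 + 36 * (t * y) * (t\<^sup>2 * x)"
    unfolding V t_def[symmetric] by (simp add: power_mult_distrib)
  also have "\<dots> = (228 / K\<^sup>2 + 36 / K) * (t\<^sup>2 * x)\<^sup>2"
    unfolding yK by (simp add: power_divide power2_eq_square algebra_simps)
  \<comment> \<open>The size of \<open>K\<close> matters only here and in the bias estimate: 228 /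
    K^2 + 36 / K is about 3.6 / 10^9, while 0.01 * 0.004^2 is 1.6 / 10^7.\<close>
  also have "\<dots> \<le> (0.01 * 0.004\<^sup>2) * (t\<^sup>2 * x)\<^sup>2"
    unfolding K by (intro mult_right_mono) (simp_all add: power2_eq_square)
  also have "\<dots> = 0.01 * (t\<^sup>2 * x * 0.004)\<^sup>2"
    by (simp add: power2_eq_square)
  finally show "V / ((real T)\<^sup>2 * x * 0.004)\<^sup>2 \<le> 0.01"
    using t2x by (simp add: divide_le_eq t_def)
qed

text \<open>The effect is fixed by \<open>d\<close>, \<open>T\<close>, \<open>U\<close>,
  \<open>q\<close>, \<open>\<alpha>\<close> and \<open>\<theta>\<close> before any state is given.
  The deviation allowed in Chebyshev's inequality is chosen per state, proportional to max(\<theta>,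
  \<chi>), so a large \<chi> with its large variance is still rejected.\<close>

theorem chi_dev_test:
  assumes U: "unitary_mat d U" and d: "0 < d" and T: "0 < T"
    and gamma: "0 < \<gamma>" "\<And>i. \<gamma> \<le> \<alpha> i"
    and q: "\<And>i. 0 \<le> q i" "\<And>i. q i \<le> 2 * \<alpha> i" and sum_q: "(\<Sum>i<d. q i) = 1"
    and \<theta>: "0 < \<theta>" and K: "K = 10 ^ 10"
    and h1: "K * d \<le> T * \<theta>" and h2: "K\<^sup>2 * d \<le> (real T)\<^sup>2 * \<theta> * \<gamma>"
  shows "\<exists>M. accept_effect (d ^ T) M \<and> (\<forall>\<rho>. (\<forall>t<T. density_mat d (\<rho> t)) \<longrightarrow>
     (chi_dev d U q \<alpha> (avg_state d T \<rho>) \<le> 0.99 * \<theta> \<longrightarrow> 0.99 \<le> accept_prob M (tensor_all T \<rho>)) \<and>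
     (\<theta> < chi_dev d U q \<alpha> (avg_state d T \<rho>) \<longrightarrow> accept_prob M (tensor_all T \<rho>) \<le> 0.01))"
proof -
  define n where "n = d ^ T"
  define Z where "Z = mat n n (\<lambda>(a,b). test_kernel d T U q \<alpha> a b)"
  have Z: "Z \<in> carrier_mat n n" by (simp add: Z_def)
  have "hermitian_mat Z" unfolding hermitian_mat_def
    by (rule eq_matI) (auto simp: Z_def adjoint_index test_kernel_cnj[symmetric])
  from threshold_measurement[OF Z this, of "0.995 * \<theta> * (real T)\<^sup>2"] obtain M where
    M: "accept_effect n M" and
    test: "\<And>R m \<delta> V. psd_mat n R \<Longrightarrow> mtrace R = 1 \<Longrightarrow> 0 < \<delta> \<Longrightarrow>
      Re (\<Sum>a<n. \<Sum>b<n. \<Sum>c<n. (Z $$ (a,b) - (if a = b then complex_of_real m else 0)) *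
         (Z $$ (b,c) - (if b = c then complex_of_real m else 0)) * R $$ (c,a)) \<le> V \<Longrightarrow>
      (m \<le> 0.995 * \<theta> * (real T)\<^sup>2 - \<delta> \<longrightarrow> 1 - V / \<delta>\<^sup>2 \<le> accept_prob M R) \<and>
      (0.995 * \<theta> * (real T)\<^sup>2 + \<delta> \<le> m \<longrightarrow> accept_prob M R \<le> V / \<delta>\<^sup>2)" by blast
  have "(chi_dev d U q \<alpha> (avg_state d T \<rho>) \<le> 0.99 * \<theta> \<longrightarrow> 0.99 \<le> accept_prob M (tensor_all T \<rho>)) \<and>
     (\<theta> < chi_dev d U q \<alpha> (avg_state d T \<rho>) \<longrightarrow> accept_prob M (tensor_all T \<rho>) \<le> 0.01)"
    if \<rho>: "\<forall>t<T. density_mat d (\<rho> t)" for \<rho>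
  proof -
    define \<chi> where "\<chi> = chi_dev d U q \<alpha> (avg_state d T \<rho>)"
    have \<chi>: "0 \<le> \<chi>"
    proof -
      have "0 < \<alpha> i" for i using gamma(1) gamma(2)[of i] by linarith
      then have "0 \<le> 2 / (\<alpha> i + \<alpha> j)" for i j by (simp add: add_nonneg_nonneg less_imp_le)
      then show ?thesis unfolding \<chi>_def chi_dev_def by (intro sum_nonneg mult_nonneg_nonneg) auto
    qed
    obtain \<mu> S :: real where \<mu>: "(real T)\<^sup>2 * \<chi> - (2 * S + 4 * real T) \<le> \<mu>" "\<mu> \<le> (real T)\<^sup>2 * \<chi>"
      and S: "0 \<le> S" "S \<le> real T * (2 * real d + sqrt (\<chi> * real d / \<gamma>))"
      and V: "Re (mom (d ^ T) (\<lambda>a b. tensor_all T \<rho> $$ (a,b))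
       (\<lambda>a b. test_kernel d T U q \<alpha> a b - complex_of_real \<mu> * kid a b)
       (\<lambda>a b. test_kernel d T U q \<alpha> a b - complex_of_real \<mu> * kid a b)) \<le>
      20 * S\<^sup>2 + 48 * real T + 12 * real T ^ 3 * (\<chi> * (2 + sqrt (\<chi> / \<gamma>)))"
      using test_kernel_moments[OF U \<rho> gamma q sum_q T] unfolding \<chi>_def by blast
    define V' where "V' = 20 * S\<^sup>2 + 48 * real T + 12 * real T ^ 3 * (\<chi> * (2 + sqrt (\<chi> / \<gamma>)))"
    define x where "x = max \<theta> \<chi>"
    \<comment> \<open>0.004 is the gap 0.005 less the 0.001 granted to the bias. In the rejecting
      case this is exactly enough: 0.999 \<chi> \<ge> 0.995 \<theta> + 0.004 \<chi> whenever \<chi>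
      \<ge> \<theta>.\<close>
    define \<delta> where "\<delta> = (real T)\<^sup>2 * x * 0.004"
    have \<delta>: "0 < \<delta>" using T \<theta> by (simp add: \<delta>_def x_def)
    note num = error_budget[OF K d T gamma(1) \<theta> \<chi> h1 h2 x_def S V'_def]
    have "Re (\<Sum>a<n. \<Sum>b<n. \<Sum>c<n. (Z $$ (a,b) - (if a = b then complex_of_real \<mu> else 0)) *
         (Z $$ (b,c) - (if b = c then complex_of_real \<mu> else 0)) * tensor_all T \<rho> $$ (c,a)) \<le> V'"
    proof -
      have e: "Z $$ (a,b) - (if a = b then complex_of_real \<mu> else 0) =
          test_kernel d T U q \<alpha> a b - complex_of_real \<mu> * kid a b" if "a < n" "b < n" for a b
        using that by (simp add: Z_def kid_def)
      have "(\<Sum>a<n. \<Sum>b<n. \<Sum>c<n. (Z $$ (a,b) - (if a = b then complex_of_real \<mu> else 0)) *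
         (Z $$ (b,c) - (if b = c then complex_of_real \<mu> else 0)) * tensor_all T \<rho> $$ (c,a)) =
        mom (d ^ T) (\<lambda>a b. tensor_all T \<rho> $$ (a,b))
       (\<lambda>a b. test_kernel d T U q \<alpha> a b - complex_of_real \<mu> * kid a b)
       (\<lambda>a b. test_kernel d T U q \<alpha> a b - complex_of_real \<mu> * kid a b)"
        unfolding mom_def n_def[symmetric] by (intro sum.cong refl) (simp only: e lessThan_iff)
      then show ?thesis using V by (simp only: V'_def)
    qed
    from test[OF density_tensor_all[OF \<rho>, folded n_def] \<delta> this]
    have low: "\<mu> \<le> 0.995 * \<theta> * (real T)\<^sup>2 - \<delta> \<Longrightarrow> 1 - V' / \<delta>\<^sup>2 \<le> accept_prob M (tensor_all T \<rho>)"
      and high: "0.995 * \<theta> * (real T)\<^sup>2 + \<delta> \<le> \<mu> \<Longrightarrow> accept_prob M (tensor_all T \<rho>) \<le> V' / \<delta>\<^sup>2"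
      by blast+
    have V: "V' / \<delta>\<^sup>2 \<le> 0.01" using num(2) by (simp only: \<delta>_def)
    have T2: "0 < (real T)\<^sup>2" using T by simp
    have "0.99 \<le> accept_prob M (tensor_all T \<rho>)" if "\<chi> \<le> 0.99 * \<theta>"
    proof -
      have "x = \<theta>" using that \<theta> by (simp add: x_def)
      moreover have "(real T)\<^sup>2 * \<chi> \<le> (real T)\<^sup>2 * (0.99 * \<theta>)" using that by (intro mult_left_mono) auto
      moreover have "0 < (real T)\<^sup>2 * \<theta>" using T2 \<theta> by simp
      ultimately have "\<mu> \<le> 0.995 * \<theta> * (real T)\<^sup>2 - \<delta>" using \<mu>(2) by (simp add: \<delta>_def algebra_simps)
      then show ?thesis using low V by simp
    qed
    moreover have "accept_prob M (tensor_all T \<rho>) \<le> 0.01" if "\<theta> < \<chi>"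
    proof -
      have "x = \<chi>" using that by (simp add: x_def)
      moreover have "(real T)\<^sup>2 * \<theta> \<le> (real T)\<^sup>2 * \<chi>" using that by (intro mult_left_mono) auto
      moreover have "0 \<le> (real T)\<^sup>2 * \<chi>" using T2 \<chi> by simp
      ultimately have "0.995 * \<theta> * (real T)\<^sup>2 + \<delta> \<le> \<mu>" using \<mu>(1) num(1) by (simp add: \<delta>_def algebra_simps)
      then show ?thesis using order_trans[OF high V] by simp
    qed
    ultimately show ?thesis by (simp only: \<chi>_def) blast
  qed
  then show ?thesis using M unfolding n_def by blast
qed

section \<open>Divergence and trace distance\<close>

lemma spectral_fun_dims:
  "U \<in> carrier_mat n n \<Longrightarrow> dim_row (spectral_fun n U f) = n"
  "U \<in> carrier_mat n n \<Longrightarrow> dim_col (spectral_fun n U f) = n"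
  using carrier_matD[OF spectral_fun_carrier] by blast+

lemma hermitian_index:
  assumes "A \<in> carrier_mat n n" "hermitian_mat A" "i < n" "j < n"
  shows "cnj (A $$ (i,j)) = A $$ (j,i)"
proof -
  have "A $$ (j,i) = mat_adjoint A $$ (j,i)" using assms by (simp add: hermitian_mat_def)
  then show ?thesis using assms by (simp add: adjoint_index)
qed

lemma density_avg_state:
  assumes T: "0 < T" and \<rho>: "\<forall>t<T. density_mat d (\<rho> t)"
  shows "density_mat d (avg_state d T \<rho>)"
proof -
  have psd: "psd_mat d (\<rho> t)" "mtrace (\<rho> t) = 1" if "t < T" for t
    using \<rho> that by (auto simp: density_mat_def)
  then have c: "\<rho> t \<in> carrier_mat d d" "hermitian_mat (\<rho> t)" if "t < T" for t
    using that by (auto simp: psd_mat_def)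
  define A where "A = avg_state d T \<rho>"
  have A: "A \<in> carrier_mat d d" by (simp add: A_def avg_state_def)
  have Ai: "A $$ (i,j) = (\<Sum>t<T. \<rho> t $$ (i,j)) / of_nat T" if "i < d" "j < d" for i j
    using that by (simp add: A_def avg_state_def)
  have "hermitian_mat A" unfolding hermitian_mat_def
    by (rule eq_matI) (use A in \<open>auto simp: adjoint_index Ai hermitian_index[OF c]\<close>)
  moreover have "0 \<le> Re ((A *\<^sub>v v) \<bullet>c v)" if v: "v \<in> carrier_vec d" for v
  proof -
    have "(A *\<^sub>v v) \<bullet>c v = (\<Sum>a<d. \<Sum>b<d. \<Sum>t<T. \<rho> t $$ (a,b) * v $ b * cnj (v $ a) / of_nat T)"
      unfolding quadratic_form_sum[OF A v]
      by (intro sum.cong refl) (simp add: Ai sum_distrib_right sum_divide_distrib)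
    also have "\<dots> = (\<Sum>t<T. \<Sum>a<d. \<Sum>b<d. \<rho> t $$ (a,b) * v $ b * cnj (v $ a) / of_nat T)"
      by (rule sum_rotate3)
    also have "\<dots> = (\<Sum>t<T. ((\<rho> t *\<^sub>v v) \<bullet>c v) / of_nat T)"
      by (intro sum.cong refl) (simp add: quadratic_form_sum[OF c(1) v] sum_divide_distrib)
    finally have "Re ((A *\<^sub>v v) \<bullet>c v) = (\<Sum>t<T. Re ((\<rho> t *\<^sub>v v) \<bullet>c v) / T)"
      by simp
    also have "\<dots> \<ge> 0" using psd(1) v by (intro sum_nonneg divide_nonneg_nonneg) (auto simp: psd_mat_def)
    finally show ?thesis .
  qed
  moreover have "mtrace A = 1"
  proof -
    have "mtrace A = (\<Sum>i<d. \<Sum>t<T. \<rho> t $$ (i,i) / of_nat T)"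
      using A by (simp add: mtrace_def Ai sum_divide_distrib)
    also have "\<dots> = (\<Sum>t<T. mtrace (\<rho> t) / of_nat T)"
      by (subst sum.swap) (use c in \<open>auto simp: mtrace_def sum_divide_distrib intro!: sum.cong\<close>)
    also have "\<dots> = 1" using psd(2) T by simp
    finally show ?thesis .
  qed
  ultimately show ?thesis using A by (simp add: density_mat_def psd_mat_def A_def)
qed

lemma spectral_density:
  assumes U: "unitary_mat d U" and \<sigma>: "density_mat d (spectral_fun d U q)"
  shows "(\<Sum>i<d. q i) = 1" and "i < d \<Longrightarrow> 0 \<le> q i"
proof -
  let ?s = "spectral_fun d U q"
  have c: "?s \<in> carrier_mat d d" using U by (simp add: unitary_mat_def)
  have "complex_of_real (\<Sum>i<d. q i) = mtrace ?s"
    using sum_spectral_fun_diag[OF U, of q] carrier_matD(1)[OF c] by (simp add: mtrace_def)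
  then have "complex_of_real (\<Sum>i<d. q i) = 1" using \<sigma> by (simp add: density_mat_def)
  then show "(\<Sum>i<d. q i) = 1" by (simp only: of_real_eq_1_iff)
  show "0 \<le> q i" if i: "i < d"
  proof -
    have "col U i \<in> carrier_vec d" using U i by (auto simp: unitary_mat_def)
    then have "0 \<le> Re ((?s *\<^sub>v col U i) \<bullet>c col U i)"
      using \<sigma> by (simp add: density_mat_def psd_mat_def)
    then show ?thesis by (simp add: spectral_fun_form[OF U i])
  qed
qed

lemma spectral_fun_mult_right:
  assumes U: "unitary_mat d U"
  shows "spectral_fun d U q * U = U * mat_diag d (\<lambda>i. complex_of_real (q i))"
proof -
  have Uc: "U \<in> carrier_mat d d" and UU: "mat_adjoint U * U = 1\<^sub>m d"
    using U by (auto simp: unitary_mat_def)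
  let ?D = "mat_diag d (\<lambda>i. complex_of_real (q i))"
  have "spectral_fun d U q * U = (U * ?D) * (mat_adjoint U * U)"
    unfolding spectral_fun_def
    by (rule assoc_mult_mat[of _ d d _ d _ d]) (use Uc in \<open>auto intro!: mult_carrier_mat[of _ d d]\<close>)
  then show ?thesis using Uc by (simp add: UU right_mult_one_mat[of _ d d] mult_carrier_mat[of _ d d])
qed

text \<open>Columns of \<open>U\<close> are nonzero eigenvectors, so each \<open>q i\<close> belongs
  to the finite spectrum.\<close>

lemma min_eigenvalue_le:
  assumes U: "unitary_mat d U" and i: "i < d"
  shows "min_eigenvalue (spectral_fun d U q) \<le> q i"
proof -
  let ?s = "spectral_fun d U q"
  have Uc: "U \<in> carrier_mat d d" using U by (simp add: unitary_mat_def)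
  have c: "?s \<in> carrier_mat d d" using Uc by simp
  have v: "col U i \<in> carrier_vec d" using i Uc by auto
  have "col U i \<noteq> 0\<^sub>v d"
  proof
    assume "col U i = 0\<^sub>v d"
    then have "U $$ (x,i) = 0" if "x < d" for x
      using that i Uc by (metis carrier_matD index_col index_zero_vec(1))
    then have "(\<Sum>x<d. cnj (U $$ (x,i)) * U $$ (x,i)) = 0" by simp
    then show False using unitary_mat_sum_cols[OF U i i] by simp
  qed
  moreover have "?s *\<^sub>v col U i = complex_of_real (q i) \<cdot>\<^sub>v col U i"
  proof -
    have "?s *\<^sub>v col U i = col (?s * U) i" using c Uc i by (simp add: col_mult2[of _ d d _ d])
    also have "\<dots> = complex_of_real (q i) \<cdot>\<^sub>v col U i"
      unfolding spectral_fun_mult_right[OF U] using Uc i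
      by (intro eq_vecI) (auto simp: mat_diag_mult_right[of _ d d])
    finally show ?thesis .
  qed
  ultimately have "eigenvector ?s (col U i) (complex_of_real (q i))"
    using v carrier_matD(1)[OF c] by (simp add: eigenvector_def)
  then have "complex_of_real (q i) \<in> spectrum ?s"
    by (auto simp: spectrum_def eigenvalue_def)
  then have "q i \<in> Re ` spectrum ?s" by (metis Re_complex_of_real imageI)
  then show ?thesis unfolding min_eigenvalue_def
    using card_finite_spectrum(1)[OF c] by (intro Min_le) auto
qed

lemma conj_spectral_fun:
  assumes U: "unitary_mat d U" and V: "V \<in> carrier_mat d d"
  shows "mat_adjoint U * spectral_fun d V l * U = spectral_fun d (mat_adjoint U * V) l"
  using U V unfolding spectral_fun_def unitary_mat_def
  by (simp add: assoc_mult_mat[of _ d d _ d _ d] mult_carrier_mat[of _ d d _ d] adjoint_mult[of _ d d _ d])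

lemma unitary_adjoint: "unitary_mat d U \<Longrightarrow> unitary_mat d (mat_adjoint U)"
  using unitary_mat_right[of d U] by (simp add: unitary_mat_def)

lemma conj_spectral_self:
  assumes U: "unitary_mat d U" and ij: "i < d" "j < d"
  shows "(mat_adjoint U * spectral_fun d U q * U) $$ (i,j) = (if i = j then complex_of_real (q i) else 0)"
proof -
  have Uc: "U \<in> carrier_mat d d" and UU: "mat_adjoint U * U = 1\<^sub>m d"
    using U by (auto simp: unitary_mat_def)
  show ?thesis
    unfolding conj_spectral_fun[OF U Uc] UU spectral_fun_index[OF one_carrier_mat ij]
  proof -
    have "(\<Sum>k<d. 1\<^sub>m d $$ (i,k) * complex_of_real (q k) * cnj (1\<^sub>m d $$ (j,k))) =
      (\<Sum>k<d. if i = k then if i = j then complex_of_real (q i) else 0 else 0)"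
      using ij by (intro sum.cong refl) auto
    then show "(\<Sum>k<d. 1\<^sub>m d $$ (i,k) * complex_of_real (q k) * cnj (1\<^sub>m d $$ (j,k))) =
      (if i = j then complex_of_real (q i) else 0)" using ij by simp
  qed
qed

lemma mtrace_conj:
  assumes W: "unitary_mat d W" and A: "A \<in> carrier_mat d d" and B: "B \<in> carrier_mat d d"
  shows "mtrace ((mat_adjoint W * A * W) * (mat_adjoint W * B * W)) = mtrace (A * B)"
proof -
  have Wc: "W \<in> carrier_mat d d" and WW: "W * mat_adjoint W = 1\<^sub>m d"
    using W unitary_mat_right[OF W] by (auto simp: unitary_mat_def)
  have comm: "mtrace (X * Y) = mtrace (Y * X)" if "X \<in> carrier_mat d d" "Y \<in> carrier_mat d d" for X Y
    unfolding mtrace_mult[OF that] mtrace_mult[OF that(2,1)] by (subst sum.swap) (simp add: mult.commute)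
  have [simp]: "W * (mat_adjoint W * X) = X" if "X \<in> carrier_mat d d" for X
    using that Wc by (simp add: assoc_mult_mat[of _ d d _ d _ d, symmetric] WW left_mult_one_mat[of _ d d])
  note car = mult_carrier_mat[of _ d d _ d]
  have "mtrace ((mat_adjoint W * A * W) * (mat_adjoint W * B * W)) = mtrace (mat_adjoint W * (A * (B * W)))"
    using A B Wc by (simp add: assoc_mult_mat[of _ d d _ d _ d] car)
  also have "\<dots> = mtrace ((A * (B * W)) * mat_adjoint W)"
    using A B Wc by (intro comm) (auto intro!: car)
  also have "(A * (B * W)) * mat_adjoint W = A * B"
    using A B Wc by (simp add: assoc_mult_mat[of _ d d _ d _ d] car WW right_mult_one_mat[of _ d d])
  finally show ?thesis .
qed

section \<open>Basis independence of the Bures divergence\<close>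

definition chi_sum :: "nat \<Rightarrow> complex mat \<Rightarrow> (nat \<Rightarrow> real) \<Rightarrow> complex mat \<Rightarrow> real" where
  "chi_sum d U q X = (\<Sum>i<d. \<Sum>j<d. 2 / (q i + q j) * (cmod ((mat_adjoint U * X * U) $$ (i,j)))\<^sup>2)"

text \<open>For Hermitian matrices the squared modulus of entry (i, j) is the product of entries (i,
  j) and (j, i). The sum becomes the trace of a product, a form invariant under unitary
  conjugation.\<close>

lemma chi_sum_trace:
  assumes U: "U \<in> carrier_mat d d" and X: "X \<in> carrier_mat d d" "hermitian_mat X"
  shows "complex_of_real (chi_sum d U q X) =
    mtrace (mat d d (\<lambda>(i,j). complex_of_real (2 / (q i + q j)) * (mat_adjoint U * X * U) $$ (i,j)) * (mat_adjoint U * X * U))"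
proof -
  define Y where "Y = mat_adjoint U * X * U"
  have Y: "Y \<in> carrier_mat d d" using U X(1) by (auto simp: Y_def intro!: mult_carrier_mat[of _ d d _ d])
  have "mat_adjoint Y = Y"
    using U X by (simp add: Y_def hermitian_mat_def adjoint_mult[of _ d d _ d] mult_carrier_mat[of _ d d _ d] assoc_mult_mat[of _ d d _ d _ d])
  then have "hermitian_mat Y" by (simp add: hermitian_mat_def)
  note h = hermitian_index[OF Y this]
  show ?thesis unfolding chi_sum_def Y_def[symmetric]
    using Y by (subst mtrace_mult[of _ d]) (auto simp: complex_norm_square h simp del: of_real_power intro!: sum.cong)
qed

text \<open>\<open>U\<^sup>\<dagger> V\<close> intertwines the two diagonal forms, so the weights agree wherever it has a nonzero entry.\<close>
lemma chi_sum_basis_independent: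
  assumes U: "unitary_mat d U" and V: "unitary_mat d V"
    and eq: "spectral_fun d U q = spectral_fun d V p"
    and X: "X \<in> carrier_mat d d" "hermitian_mat X"
  shows "chi_sum d U q X = chi_sum d V p X"
proof -
  have Uc: "U \<in> carrier_mat d d" and UU: "mat_adjoint U * U = 1\<^sub>m d" "U * mat_adjoint U = 1\<^sub>m d"
    using U unitary_mat_right[OF U] by (auto simp: unitary_mat_def)
  have Vc: "V \<in> carrier_mat d d" and VV: "mat_adjoint V * V = 1\<^sub>m d" "V * mat_adjoint V = 1\<^sub>m d"
    using V unitary_mat_right[OF V] by (auto simp: unitary_mat_def)
  note car = mult_carrier_mat[of _ d d _ d] and assoc = assoc_mult_mat[of _ d d _ d _ d]
  define W where "W = mat_adjoint U * V"
  have W: "unitary_mat d W" unfolding W_def by (intro unitary_mat_mult unitary_adjoint U V)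
  then have Wc: "W \<in> carrier_mat d d" by (simp add: unitary_mat_def)
  have V': "V = U * W"
    using Uc Vc by (simp add: W_def assoc[symmetric] UU left_mult_one_mat[of _ d d])
  define Y where "Y = mat_adjoint U * X * U"
  define Y' where "Y' = mat_adjoint V * X * V"
  have Y: "Y \<in> carrier_mat d d" unfolding Y_def using Uc X by (auto intro!: car)
  have Y': "Y' = mat_adjoint W * Y * W"
    unfolding Y'_def Y_def V' using Uc Wc X by (simp add: assoc car adjoint_mult[of _ d d _ d])
  \<comment> \<open>Both sides are entries of the same matrix conjugated by \<open>U\<close> on the
    left and \<open>V\<close> on the right, diagonalised once from each side.\<close>
  have inter: "complex_of_real (q i) * W $$ (i,j) = W $$ (i,j) * complex_of_real (p j)" if ij: "i < d" "j < d" for i j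
  proof -
    have "mat_diag d (\<lambda>i. complex_of_real (q i)) * W = mat_adjoint U * spectral_fun d U q * V"
      unfolding W_def spectral_fun_def using Uc Vc
      by (simp add: assoc car) (simp add: assoc[symmetric] car UU left_mult_one_mat[of _ d d])
    also have "\<dots> = mat_adjoint U * (spectral_fun d V p * V)"
      unfolding eq using Uc Vc by (simp add: assoc)
    also have "\<dots> = W * mat_diag d (\<lambda>i. complex_of_real (p i))"
      unfolding spectral_fun_mult_right[OF V] W_def using Uc Vc by (simp add: assoc)
    finally have "(mat_diag d (\<lambda>i. complex_of_real (q i)) * W) $$ (i,j) = (W * mat_diag d (\<lambda>i. complex_of_real (p i))) $$ (i,j)"
      by simp
    then show ?thesis using ij Wc by (simp add: mat_diag_mult_left[of _ d d] mat_diag_mult_right[of _ d d])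
  qed
  have qp: "q i = p j" if "i < d" "j < d" "W $$ (i,j) \<noteq> 0" for i j
    using inter[OF that(1,2)] that(3) by simp
  \<comment> \<open>\<open>L\<close> and \<open>L'\<close> are the entrywise weighted matrices in
    the two eigenbases. By \<open>qp\<close> the weights match on every nonzero term of the
    conjugation by \<open>W\<close>, so \<open>L'\<close> is \<open>L\<close> conjugated by
    \<open>W\<close>, just as \<open>Y'\<close> is \<open>Y\<close>.\<close>
  define L where "L = mat d d (\<lambda>(i,j). complex_of_real (2 / (q i + q j)) * Y $$ (i,j))"
  define L' where "L' = mat d d (\<lambda>(i,j). complex_of_real (2 / (p i + p j)) * Y' $$ (i,j))"
  have L: "L \<in> carrier_mat d d" by (simp add: L_def)
  have "L' = mat_adjoint W * L * W"
  proof (rule eq_matI)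
    fix i j assume "i < dim_row (mat_adjoint W * L * W)" "j < dim_col (mat_adjoint W * L * W)"
    then have ij: "i < d" "j < d" using Wc by (auto simp: adjoint_index)
    have "L' $$ (i,j) = (\<Sum>x<d. \<Sum>y<d. complex_of_real (2 / (p i + p j)) * (cnj (W $$ (x,i)) * Y $$ (x,y) * W $$ (y,j)))"
      using ij by (simp add: L'_def Y' conj_index[OF Wc Y] sum_distrib_left sum_divide_distrib)
    also have "\<dots> = (\<Sum>x<d. \<Sum>y<d. cnj (W $$ (x,i)) * L $$ (x,y) * W $$ (y,j))"
    proof (intro sum.cong refl)
      fix x y assume "x \<in> {..<d}" "y \<in> {..<d}"
      then have xy: "x < d" "y < d" by auto
      show "complex_of_real (2 / (p i + p j)) * (cnj (W $$ (x,i)) * Y $$ (x,y) * W $$ (y,j)) = cnj (W $$ (x,i)) * L $$ (x,y) * W $$ (y,j)"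
      proof (cases "W $$ (x,i) = 0 \<or> W $$ (y,j) = 0")
        case False
        then show ?thesis using qp[OF xy(1) ij(1)] qp[OF xy(2) ij(2)] xy by (simp add: L_def)
      qed auto
    qed
    also have "\<dots> = (mat_adjoint W * L * W) $$ (i,j)" using conj_index[OF Wc L ij] by simp
    finally show "L' $$ (i,j) = (mat_adjoint W * L * W) $$ (i,j)" .
  qed (use Wc in \<open>auto simp: L'_def adjoint_index\<close>)
  then have "mtrace (L' * Y') = mtrace (L * Y)"
    using mtrace_conj[OF W L Y] by (simp add: Y')
  then have "complex_of_real (chi_sum d V p X) = complex_of_real (chi_sum d U q X)"
    unfolding chi_sum_trace[OF Uc X] chi_sum_trace[OF Vc X] L_def L'_def Y_def Y'_def .
  then show ?thesis by simp
qed

text \<open>Expanding the square about \<open>q\<close> changes diagonal terms only, each by 2 Re(Y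
  i i) - q i. These add up to 2 - 1 because both traces are one, and this is the 1 subtracted in the
  divergence.\<close>

lemma chi_sum_eq_dev:
  assumes U: "unitary_mat d U" and \<rho>: "\<rho> \<in> carrier_mat d d" "mtrace \<rho> = 1"
    and q: "(\<Sum>i<d. q i) = 1" "\<And>i. i < d \<Longrightarrow> 0 < q i"
  shows "chi_sum d U q \<rho> - 1 = chi_dev d U q q \<rho>"
proof -
  have Uc: "U \<in> carrier_mat d d" using U by (simp add: unitary_mat_def)
  define Y where "Y i j = (mat_adjoint U * \<rho> * U) $$ (i,j)" for i j
  have tr: "(\<Sum>i<d. Y i i) = 1"
  proof -
    have "(\<Sum>i<d. Y i i) = (\<Sum>x<d. \<Sum>y<d. \<Sum>i<d. \<rho> $$ (x,y) * (U $$ (y,i) * cnj (U $$ (x,i))))"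
      unfolding Y_def by (subst sum_rotate3) (simp add: conj_index[OF Uc \<rho>(1)] mult_ac)
    also have "\<dots> = (\<Sum>x<d. \<Sum>y<d. if y = x then \<rho> $$ (x,y) else 0)"
      by (intro sum.cong refl) (simp add: sum_distrib_left[symmetric] unitary_mat_sum_rows[OF U])
    also have "\<dots> = mtrace \<rho>" using \<rho> by (simp add: mtrace_def)
    finally show ?thesis using \<rho> by simp
  qed
  have "2 / (q i + q j) * (cmod (Y i j))\<^sup>2 =
     2 / (q i + q j) * (cmod (Y i j - (if i = j then complex_of_real (q i) else 0)))\<^sup>2 + (if i = j then 2 * Re (Y i i) - q i else 0)"
    if "i < d" for i j
  proof (cases "i = j")
    case True
    have "(cmod (Y i i))\<^sup>2 = (cmod (Y i i - q i))\<^sup>2 + q i * (2 * Re (Y i i) - q i)"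
      unfolding cmod_power2 by (simp add: power2_eq_square algebra_simps)
    then show ?thesis using q(2)[OF that] True by (simp add: field_simps)
  qed simp
  then have "chi_sum d U q \<rho> = chi_dev d U q q \<rho> + (\<Sum>i<d. 2 * Re (Y i i) - q i)"
    unfolding chi_sum_def chi_dev_def Y_def[symmetric] by (simp add: sum.distrib)
  also have "(\<Sum>i<d. 2 * Re (Y i i) - q i) = 2 * Re (\<Sum>i<d. Y i i) - (\<Sum>i<d. q i)"
    by (simp add: sum_subtractf sum_distrib_left)
  finally show ?thesis by (simp add: tr q)
qed

text \<open>The choice is well defined: a positive minimum eigenvalue makes the denominators
  positive in every diagonalisation, so infinity does not occur, and all diagonalisations give the
  same value.\<close>

lemma D_chi2_eq:
  assumes U: "unitary_mat d U" and \<rho>: "density_mat d \<rho>" and \<sigma>: "density_mat d (spectral_fun d U q)"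
    and pos: "0 < min_eigenvalue (spectral_fun d U q)"
  shows "D_chi2 d \<rho> (spectral_fun d U q) = ereal (chi_dev d U q q \<rho>)"
proof -
  let ?s = "spectral_fun d U q"
  have \<rho>': "\<rho> \<in> carrier_mat d d" "hermitian_mat \<rho>" "mtrace \<rho> = 1"
    using \<rho> by (auto simp: density_mat_def psd_mat_def)
  have v: "(\<Sum>i<d. \<Sum>j<d. chi2_term (2 * (cmod ((mat_adjoint V * \<rho> * V) $$ (i,j)))\<^sup>2) (p i + p j)) - 1 = ereal (chi_dev d U q q \<rho>)"
    if V: "unitary_mat d V" and p: "?s = spectral_fun d V p" for V p
  proof -
    have qpos: "0 < q i" if "i < d" for i using min_eigenvalue_le[OF U that, of q] pos by linarith
    have ppos: "0 < p i" if "i < d" for i using min_eigenvalue_le[OF V that, of p] pos p by simp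
    have "chi2_term (2 * x) (p i + p j) = ereal (2 / (p i + p j) * x)" if "i < d" "j < d" for i j x
      using ppos[OF that(1)] ppos[OF that(2)] by (auto simp: chi2_term_def zero_ereal_def)
    then have "(\<Sum>i<d. \<Sum>j<d. chi2_term (2 * (cmod ((mat_adjoint V * \<rho> * V) $$ (i,j)))\<^sup>2) (p i + p j)) = ereal (chi_sum d V p \<rho>)"
      by (simp add: chi_sum_def sum_ereal[symmetric] del: sum_ereal)
    also have "chi_sum d V p \<rho> = chi_sum d U q \<rho>"
      using chi_sum_basis_independent[OF U V p \<rho>'(1,2)] by simp
    finally show ?thesis
      using chi_sum_eq_dev[OF U \<rho>'(1,3) spectral_density(1)[OF U \<sigma>] qpos] by (simp add: one_ereal_def)
  qed
  show ?thesis unfolding D_chi2_def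
  proof (rule some_equality, goal_cases)
    case 1
    show ?case using v[OF U refl] U by (intro exI[of _ U] exI[of _ q]) (simp add: spectral_fun_def)
  next
    case (2 x)
    then show ?case using v by (auto simp: spectral_fun_def)
  qed
qed

section \<open>Trace distance\<close>

lemma trace_norm_herm_spectral:
  assumes "A \<in> carrier_mat d d" "hermitian_mat A"
  shows "\<exists>V l. unitary_mat d V \<and> A = spectral_fun d V l \<and> trace_norm_herm d A = (\<Sum>i<d. \<bar>l i\<bar>)"
proof -
  have "\<exists>v V l. unitary_mat d V \<and> A = V * mat_diag d (\<lambda>i. complex_of_real (l i)) * mat_adjoint V \<and> v = (\<Sum>i<d. \<bar>l i\<bar>)"
    using hermitian_spectral[OF assms] by blast
  \<comment> \<open>The choice is resolved to some diagonalisation attaining the chosen value; both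
    uses below bound the sum for an arbitrary one.\<close>
  from someI_ex[OF this] show ?thesis
    unfolding trace_norm_herm_def spectral_fun_def by blast
qed

lemma hermitian_minus:
  assumes "A \<in> carrier_mat d d" "hermitian_mat A" "B \<in> carrier_mat d d" "hermitian_mat B"
  shows "hermitian_mat (A - B)"
  unfolding hermitian_mat_def
  by (rule eq_matI) (use assms in \<open>auto simp: adjoint_index hermitian_index[OF assms(1,2)] hermitian_index[OF assms(3,4)]\<close>)

text \<open>Each eigenvalue of the difference is a difference of two nonnegative numbers, and these
  numbers add up to the two traces. It disposes of \<epsilon> > 1 in the identity test.\<close>

lemma D_tr_le_1:
  assumes "density_mat d \<rho>" "density_mat d \<sigma>"
  shows "D_tr d \<rho> \<sigma> \<le> 1"
proof -
  have \<rho>: "\<rho> \<in> carrier_mat d d" "hermitian_mat \<rho>" "mtrace \<rho> = 1"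
    and \<sigma>: "\<sigma> \<in> carrier_mat d d" "hermitian_mat \<sigma>" "mtrace \<sigma> = 1"
    using assms by (auto simp: density_mat_def psd_mat_def)
  obtain V l where V: "unitary_mat d V" and A: "\<rho> - \<sigma> = spectral_fun d V l"
    and tn: "trace_norm_herm d (\<rho> - \<sigma>) = (\<Sum>i<d. \<bar>l i\<bar>)"
    using trace_norm_herm_spectral[of "\<rho> - \<sigma>" d] hermitian_minus[OF \<rho>(1,2) \<sigma>(1,2)]
      minus_carrier_mat[OF \<sigma>(1), of \<rho>] by blast
  let ?f = "\<lambda>X i. Re ((X *\<^sub>v col V i) \<bullet>c col V i)"
  have v: "col V i \<in> carrier_vec d" if "i < d" for i using V that by (auto simp: unitary_mat_def)
  have "\<bar>l i\<bar> \<le> ?f \<rho> i + ?f \<sigma> i" if i: "i < d" for i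
  proof -
    have "((\<rho> - \<sigma>) *\<^sub>v col V i) \<bullet>c col V i = (\<rho> *\<^sub>v col V i) \<bullet>c col V i - (\<sigma> *\<^sub>v col V i) \<bullet>c col V i"
      using \<rho> \<sigma> v[OF i]
      by (simp add: minus_mult_distrib_mat_vec[of _ d d] minus_scalar_prod_distrib[of _ d])
    then have "l i = ?f \<rho> i - ?f \<sigma> i"
      using spectral_fun_form[OF V i, of l] by (simp add: A[symmetric] complex_eq_iff)
    moreover have "0 \<le> ?f \<rho> i" "0 \<le> ?f \<sigma> i"
      using assms v[OF i] by (auto simp: density_mat_def psd_mat_def)
    ultimately show ?thesis by linarith
  qed
  then have "(\<Sum>i<d. \<bar>l i\<bar>) \<le> (\<Sum>i<d. ?f \<rho> i + ?f \<sigma> i)" by (intro sum_mono) auto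
  also have "\<dots> = 2"
    using sum_spectral_weights[OF V \<rho>(1)] sum_spectral_weights[OF V \<sigma>(1)] \<rho>(3) \<sigma>(3)
    by (simp add: sum.distrib flip: Re_sum)
  finally show ?thesis by (simp add: D_tr_def tn)
qed

text \<open>The trace norm is the trace of \<open>\<Delta>\<close> against its unitary sign \<open>S\<close>; apply Cauchy-Schwarz with
  weights \<open>(\<alpha>\<^sub>i + \<alpha>\<^sub>j) / 2\<close>.\<close>
lemma trace_norm_le_chi_dev:
  assumes U: "unitary_mat d U" and \<rho>: "density_mat d \<rho>" and \<sigma>: "density_mat d (spectral_fun d U q)"
    and \<alpha>: "\<And>i. 0 < \<alpha> i" "(\<Sum>i<d. \<alpha> i) = 1"
  shows "(2 * D_tr d \<rho> (spectral_fun d U q))\<^sup>2 \<le> chi_dev d U q \<alpha> \<rho>"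
proof -
  let ?s = "spectral_fun d U q"
  have Uc: "U \<in> carrier_mat d d" using U by (simp add: unitary_mat_def)
  have \<rho>': "\<rho> \<in> carrier_mat d d" "hermitian_mat \<rho>" and s: "?s \<in> carrier_mat d d" "hermitian_mat ?s"
    using \<rho> \<sigma> by (auto simp: density_mat_def psd_mat_def)
  obtain V l where V: "unitary_mat d V" and A: "\<rho> - ?s = spectral_fun d V l"
    and tn: "trace_norm_herm d (\<rho> - ?s) = (\<Sum>i<d. \<bar>l i\<bar>)"
    using trace_norm_herm_spectral[of "\<rho> - ?s" d] hermitian_minus[OF \<rho>' s]
      minus_carrier_mat[OF s(1), of \<rho>] by blast
  have Vc: "V \<in> carrier_mat d d" using V by (simp add: unitary_mat_def)
  define W where "W = mat_adjoint U * V"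
  have W: "unitary_mat d W" unfolding W_def by (intro unitary_mat_mult unitary_adjoint U V)
  then have Wc: "W \<in> carrier_mat d d" by (simp add: unitary_mat_def)
  \<comment> \<open>The sign at 0 is set to 1, so \<open>s k * s k = 1\<close> throughout and
    \<open>S\<close> is unitary as well as Hermitian.\<close>
  define s where "s k = (if 0 \<le> l k then 1 else -1 :: real)" for k
  define S where "S = spectral_fun d W s"
  define \<Delta> where "\<Delta> = spectral_fun d W l"
  have Di: "\<Delta> $$ (i,j) = (mat_adjoint U * \<rho> * U) $$ (i,j) - (if i = j then complex_of_real (q i) else 0)"
    if ij: "i < d" "j < d" for i j
  proof -
    have "\<Delta> = mat_adjoint U * (\<rho> - ?s) * U"
      unfolding \<Delta>_def W_def A conj_spectral_fun[OF U Vc] ..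
    then have "\<Delta> $$ (i,j) = (mat_adjoint U * \<rho> * U) $$ (i,j) - (mat_adjoint U * ?s * U) $$ (i,j)"
      using \<rho>'(1) s(1) ij by (simp add: conj_index[OF Uc] minus_carrier_mat right_diff_distrib left_diff_distrib sum_subtractf)
    then show ?thesis by (simp add: conj_spectral_self[OF U ij])
  qed
  have Sh: "S $$ (j,i) = cnj (S $$ (i,j))" if "i < d" "j < d" for i j
    using that Wc by (simp add: S_def spectral_fun_index mult_ac)
  have S1: "(\<Sum>j<d. (cmod (S $$ (i,j)))\<^sup>2) = 1" if i: "i < d" for i
  proof -
    have "complex_of_real (\<Sum>j<d. (cmod (S $$ (i,j)))\<^sup>2) = (\<Sum>j<d. S $$ (i,j) * cnj (S $$ (i,j)))"
      by (simp add: complex_norm_square del: of_real_power)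
    also have "\<dots> = (\<Sum>j<d. S $$ (i,j) * S $$ (j,i))"
      by (intro sum.cong refl) (simp only: Sh[OF i, symmetric] lessThan_iff)
    also have "\<dots> = spectral_fun d W (\<lambda>k. s k * s k) $$ (i,i)"
      unfolding S_def by (rule spectral_fun_mult[OF W i i])
    also have "(\<lambda>k. s k * s k) = (\<lambda>_. 1)" by (auto simp: s_def)
    also have "spectral_fun d W (\<lambda>_. 1) $$ (i,i) = 1" using spectral_fun_one[OF W i i] by simp
    finally show ?thesis by (simp only: of_real_eq_1_iff)
  qed
  have "complex_of_real (\<Sum>k<d. \<bar>l k\<bar>) = (\<Sum>k<d. complex_of_real (s k * l k))"
    by (auto simp: s_def intro!: sum.cong)
  also have "\<dots> = (\<Sum>i<d. spectral_fun d W (\<lambda>k. s k * l k) $$ (i,i))"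
    by (rule sum_spectral_fun_diag[OF W, symmetric])
  also have "\<dots> = (\<Sum>i<d. \<Sum>j<d. S $$ (i,j) * \<Delta> $$ (j,i))"
    unfolding S_def \<Delta>_def by (intro sum.cong refl) (simp add: spectral_fun_mult[OF W])
  finally have "(\<Sum>k<d. \<bar>l k\<bar>) = cmod (\<Sum>i<d. \<Sum>j<d. S $$ (i,j) * \<Delta> $$ (j,i))"
    by (metis norm_of_real abs_of_nonneg sum_nonneg abs_ge_zero)
  also have "\<dots> \<le> (\<Sum>i<d. \<Sum>j<d. cmod (S $$ (i,j)) * cmod (\<Delta> $$ (j,i)))"
    by (intro order_trans[OF norm_sum] sum_mono) (simp add: norm_mult)
  also have "\<dots> = (\<Sum>p\<in>{..<d} \<times> {..<d}. (cmod (S $$ p) * sqrt ((\<alpha> (fst p) + \<alpha> (snd p)) / 2)) *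
      (cmod (\<Delta> $$ (snd p, fst p)) * sqrt (2 / (\<alpha> (fst p) + \<alpha> (snd p)))))"
  proof -
    have "sqrt ((\<alpha> i + \<alpha> j) / 2) * sqrt (2 / (\<alpha> i + \<alpha> j)) = 1" for i j
      using \<alpha>(1)[of i] \<alpha>(1)[of j] by (simp flip: real_sqrt_mult)
    then have "cmod (S $$ (i,j)) * cmod (\<Delta> $$ (j,i)) =
      (cmod (S $$ (i,j)) * sqrt ((\<alpha> i + \<alpha> j) / 2)) * (cmod (\<Delta> $$ (j,i)) * sqrt (2 / (\<alpha> i + \<alpha> j)))" for i j
      by (metis (no_types, opaque_lifting) mult.assoc mult.left_commute mult.right_neutral)
    then show ?thesis by (simp only: sum_pairs fst_conv snd_conv)
  qed
  finally have "(\<Sum>k<d. \<bar>l k\<bar>)\<^sup>2 \<le> (\<Sum>p\<in>{..<d} \<times> {..<d}. (cmod (S $$ p) * sqrt ((\<alpha> (fst p) + \<alpha> (snd p)) / 2)) *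
      (cmod (\<Delta> $$ (snd p, fst p)) * sqrt (2 / (\<alpha> (fst p) + \<alpha> (snd p)))))\<^sup>2"
    by (intro power_mono) (auto intro: sum_nonneg)
  also have "\<dots> \<le> (\<Sum>p\<in>{..<d} \<times> {..<d}. (cmod (S $$ p) * sqrt ((\<alpha> (fst p) + \<alpha> (snd p)) / 2))\<^sup>2) *
      (\<Sum>p\<in>{..<d} \<times> {..<d}. (cmod (\<Delta> $$ (snd p, fst p)) * sqrt (2 / (\<alpha> (fst p) + \<alpha> (snd p))))\<^sup>2)"
    by (rule Cauchy_Schwarz_sum)
  \<comment> \<open>Rows of \<open>S\<close> have unit length, and by Hermiticity so do its columns;
    each half of the weight thus sums to half the total of \<open>\<alpha>\<close>.\<close>
  also have "(\<Sum>p\<in>{..<d} \<times> {..<d}. (cmod (S $$ p) * sqrt ((\<alpha> (fst p) + \<alpha> (snd p)) / 2))\<^sup>2) = 1"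
  proof -
    have sq: "(x * sqrt ((\<alpha> i + \<alpha> j) / 2))\<^sup>2 = \<alpha> i / 2 * x\<^sup>2 + \<alpha> j / 2 * x\<^sup>2" for x i j
      using \<alpha>(1)[of i] \<alpha>(1)[of j] by (simp add: power_mult_distrib field_simps)
    have a: "(\<Sum>i<d. \<Sum>j<d. \<alpha> i / 2 * (cmod (S $$ (i,j)))\<^sup>2) = 1 / 2"
      using \<alpha>(2) by (simp add: sum_distrib_left[symmetric] S1 sum_divide_distrib[symmetric])
    have "(\<Sum>i<d. \<Sum>j<d. \<alpha> j / 2 * (cmod (S $$ (i,j)))\<^sup>2) = (\<Sum>j<d. \<Sum>i<d. \<alpha> j / 2 * (cmod (S $$ (i,j)))\<^sup>2)"
      by (rule sum.swap)
    also have "\<dots> = (\<Sum>j<d. \<Sum>i<d. \<alpha> j / 2 * (cmod (S $$ (j,i)))\<^sup>2)"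
    proof (intro sum.cong refl)
      fix i j assume "j \<in> {..<d}" "i \<in> {..<d}"
      then have "cmod (S $$ (i,j)) = cmod (S $$ (j,i))" using Sh[of i j] by simp
      then show "\<alpha> j / 2 * (cmod (S $$ (i,j)))\<^sup>2 = \<alpha> j / 2 * (cmod (S $$ (j,i)))\<^sup>2" by simp
    qed
    finally show ?thesis using a by (simp add: sum_pairs sq sum.distrib)
  qed
  also have "(\<Sum>p\<in>{..<d} \<times> {..<d}. (cmod (\<Delta> $$ (snd p, fst p)) * sqrt (2 / (\<alpha> (fst p) + \<alpha> (snd p))))\<^sup>2) = chi_dev d U q \<alpha> \<rho>"
  proof -
    have sq: "(x * sqrt (2 / (\<alpha> i + \<alpha> j)))\<^sup>2 = 2 / (\<alpha> j + \<alpha> i) * x\<^sup>2" for x i j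
      using \<alpha>(1)[of i] \<alpha>(1)[of j] by (simp add: power_mult_distrib add.commute)
    have "(\<Sum>i<d. \<Sum>j<d. 2 / (\<alpha> j + \<alpha> i) * (cmod (\<Delta> $$ (j,i)))\<^sup>2) = (\<Sum>j<d. \<Sum>i<d. 2 / (\<alpha> j + \<alpha> i) * (cmod (\<Delta> $$ (j,i)))\<^sup>2)"
      by (rule sum.swap)
    also have "\<dots> = chi_dev d U q \<alpha> \<rho>"
      unfolding chi_dev_def by (intro sum.cong refl) (simp add: Di)
    finally show ?thesis by (simp only: sum_pairs fst_conv snd_conv sq)
  qed
  finally show ?thesis by (simp add: D_tr_def tn)
qed

section \<open>The two tests\<close>

lemma accept_effect_one: "accept_effect n (1\<^sub>m n)"
proof -
  have one: "unitary_mat n (1\<^sub>m n)"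
    by (simp add: unitary_mat_def, rule eq_matI) (auto simp: adjoint_index)
  have 1: "spectral_fun n (1\<^sub>m n) (\<lambda>_. 1) = 1\<^sub>m n"
    by (rule eq_matI) (use spectral_fun_one[OF one] in \<open>auto simp: spectral_fun_dims\<close>)
  have 0: "1\<^sub>m n - 1\<^sub>m n = spectral_fun n (1\<^sub>m n) (\<lambda>_. 0)"
    by (rule eq_matI) (auto simp: spectral_fun_index spectral_fun_dims)
  show ?thesis
    using psd_spectral_fun[of "1\<^sub>m n" n "\<lambda>_. 1"] psd_spectral_fun[of "1\<^sub>m n" n "\<lambda>_. 0"]
    by (simp add: accept_effect_def 1 0)
qed

lemma chi2_test:
  fixes \<theta> K :: real
  assumes \<sigma>: "density_mat d \<sigma>" and \<theta>: "0 \<le> \<theta>" and K: "K = 10 ^ 10"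
    and h1: "K * real d \<le> real T * \<theta>" and h2: "K * sqrt (real d) \<le> real T * sqrt (\<theta> * min_eigenvalue \<sigma>)"
  shows "\<exists>M. accept_effect (d ^ T) M \<and> (\<forall>\<rho>. (\<forall>t<T. density_mat d (\<rho> t)) \<longrightarrow>
     (D_chi2 d (avg_state d T \<rho>) \<sigma> \<le> ereal (0.99 * \<theta>) \<longrightarrow> accept_prob M (tensor_all T \<rho>) \<ge> 0.99) \<and>
     (D_chi2 d (avg_state d T \<rho>) \<sigma> > ereal \<theta> \<longrightarrow> accept_prob M (tensor_all T \<rho>) \<le> 0.01))"
proof -
  obtain U q where U: "unitary_mat d U" and s: "\<sigma> = spectral_fun d U q"
    using hermitian_spectral[of \<sigma> d] \<sigma> by (auto simp: density_mat_def psd_mat_def spectral_fun_def)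
  note qs = spectral_density[OF U \<sigma>[unfolded s]]
  have d: "0 < d" using qs(1) by (cases d) auto
  have "0 < K * real d" "0 < K * sqrt (real d)" using d K by auto
  \<comment> \<open>Positive left sides rule out \<open>T = 0\<close>, \<open>\<theta> = 0\<close>
    and a singular \<open>\<sigma>\<close>, so the conventions for division by zero do not come into
    play.\<close>
  then have "0 < real T * \<theta>" "0 < real T * sqrt (\<theta> * min_eigenvalue \<sigma>)" using h1 h2 by linarith+
  then have T: "0 < T" and \<theta>0: "0 < \<theta>" and g: "0 < min_eigenvalue \<sigma>"
    using \<theta> by (auto simp: zero_less_mult_iff)
  \<comment> \<open>The weights must be bounded below at all indices, so the spectrum is continued
    by its minimum beyond \<open>d\<close>.\<close>
  define p where "p i = (if i < d then q i else min_eigenvalue \<sigma>)" for i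
  have p: "min_eigenvalue \<sigma> \<le> p i" for i using min_eigenvalue_le[OF U, of i q] by (simp add: p_def s)
  have p0: "0 \<le> p i" for i using p[of i] g by linarith
  have p2: "p i \<le> 2 * p i" for i using p0[of i] by simp
  have sp: "(\<Sum>i<d. p i) = 1" using qs(1) by (simp add: p_def)
  have "(K * sqrt (real d))\<^sup>2 \<le> (real T * sqrt (\<theta> * min_eigenvalue \<sigma>))\<^sup>2"
    using h2 K by (intro power_mono) auto
  then have h2': "K\<^sup>2 * real d \<le> (real T)\<^sup>2 * \<theta> * min_eigenvalue \<sigma>"
    using \<theta> g by (simp add: power_mult_distrib)
  have dev: "chi_dev d U p p X = chi_dev d U q q X" for X
    unfolding chi_dev_def by (intro sum.cong refl) (auto simp: p_def)
  have D: "D_chi2 d (avg_state d T \<rho>) \<sigma> = ereal (chi_dev d U p p (avg_state d T \<rho>))"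
    if "\<forall>t<T. density_mat d (\<rho> t)" for \<rho>
    using D_chi2_eq[OF U density_avg_state[OF T that] \<sigma>[unfolded s] g[unfolded s]] by (simp add: s dev)
  obtain M where M: "accept_effect (d ^ T) M" "\<forall>\<rho>. (\<forall>t<T. density_mat d (\<rho> t)) \<longrightarrow>
     (chi_dev d U p p (avg_state d T \<rho>) \<le> 0.99 * \<theta> \<longrightarrow> 0.99 \<le> accept_prob M (tensor_all T \<rho>)) \<and>
     (\<theta> < chi_dev d U p p (avg_state d T \<rho>) \<longrightarrow> accept_prob M (tensor_all T \<rho>) \<le> 0.01)"
    using chi_dev_test[OF U d T g p p0 p2 sp \<theta>0 K h1 h2'] by blast
  then show ?thesis by (intro exI[of _ M]) (simp add: D)
qed

lemma identity_test:
  fixes \<epsilon> K :: real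
  assumes \<sigma>: "density_mat d \<sigma>" and \<epsilon>: "0 < \<epsilon>" and K: "K = 10 ^ 10"
    and h: "K * real d / \<epsilon>\<^sup>2 \<le> real T"
  shows "\<exists>M. accept_effect (d ^ T) M \<and> (\<forall>\<rho>. (\<forall>t<T. density_mat d (\<rho> t)) \<longrightarrow>
     (avg_state d T \<rho> = \<sigma> \<longrightarrow> accept_prob M (tensor_all T \<rho>) \<ge> 0.99) \<and>
     (D_tr d (avg_state d T \<rho>) \<sigma> > \<epsilon> \<longrightarrow> accept_prob M (tensor_all T \<rho>) \<le> 0.01))"
proof -
  obtain U q where U: "unitary_mat d U" and s: "\<sigma> = spectral_fun d U q"
    using hermitian_spectral[of \<sigma> d] \<sigma> by (auto simp: density_mat_def psd_mat_def spectral_fun_def)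
  note qs = spectral_density[OF U \<sigma>[unfolded s]]
  have d: "0 < d" using qs(1) by (cases d) auto
  have "0 < K * real d / \<epsilon>\<^sup>2" using d K \<epsilon> by simp
  then have T: "0 < T" using h by (cases T) auto
  show ?thesis
  proof (cases "1 < \<epsilon>")
    case True
    \<comment> \<open>For \<epsilon> > 1 the rejecting case cannot occur, and the test that always
      accepts is correct. The remaining case has \<epsilon> \<le> 1, which \<open>h2\<close> relies
      on.\<close>
    have "accept_prob (1\<^sub>m (d ^ T)) (tensor_all T \<rho>) = 1" if "\<forall>t<T. density_mat d (\<rho> t)" for \<rho>
      using density_tensor_all[OF that] by (simp add: accept_prob_def psd_mat_def left_mult_one_mat[of _ "d ^ T" "d ^ T"])
    moreover have "D_tr d (avg_state d T \<rho>) \<sigma> \<le> \<epsilon>" if "\<forall>t<T. density_mat d (\<rho> t)" for \<rho>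
      using D_tr_le_1[OF density_avg_state[OF T that] \<sigma>] True by simp
    ultimately show ?thesis using accept_effect_one by (intro exI[of _ "1\<^sub>m (d ^ T)"]) (auto simp: not_less[symmetric])
  next
    case False
    \<comment> \<open>Continued by 0, so that \<open>\<alpha>\<close> equals its lower bound
      \<open>\<gamma>\<close> at indices beyond \<open>d\<close>.\<close>
    define p where "p i = (if i < d then q i else 0)" for i
    define \<alpha> where "\<alpha> i = (p i + 1 / d) / 2" for i
    define \<gamma> where "\<gamma> = 1 / (2 * real d)"
    define \<theta> where "\<theta> = 4 * \<epsilon>\<^sup>2"
    have p0: "0 \<le> p i" for i using qs(2) by (simp add: p_def)
    have \<gamma>: "0 < \<gamma>" "\<gamma> \<le> \<alpha> i" "p i \<le> 2 * \<alpha> i" for i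
      using d p0[of i] by (auto simp: \<gamma>_def \<alpha>_def field_simps)
    have \<alpha>: "0 < \<alpha> i" for i using \<gamma>(1) \<gamma>(2)[of i] by linarith
    have sp: "(\<Sum>i<d. p i) = 1" using qs(1) by (simp add: p_def)
    have sa: "(\<Sum>i<d. \<alpha> i) = 1"
      using d sp by (simp add: \<alpha>_def sum.distrib sum_divide_distrib[symmetric])
    have \<theta>: "0 < \<theta>" using \<epsilon> by (simp add: \<theta>_def)
    have h': "K * real d \<le> real T * \<epsilon>\<^sup>2" using h \<epsilon> by (simp add: field_simps)
    have h1: "K * real d \<le> real T * \<theta>"
      unfolding \<theta>_def by (rule order_trans[OF h']) (intro mult_left_mono, auto)
    \<comment> \<open>For this \<open>\<gamma>\<close> the condition reads K^2 d^2 \<le> 2 T^2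
      \<epsilon>^2. It follows from K d \<le> T \<epsilon>^2 by squaring and using \<epsilon> \<le>
      1: no second sample condition is left in this part.\<close>
    have h2: "K\<^sup>2 * real d \<le> (real T)\<^sup>2 * \<theta> * \<gamma>"
    proof -
      have e1: "\<epsilon>\<^sup>2 \<le> 1" using False \<epsilon> by (simp add: power_le_one)
      have "(K * real d)\<^sup>2 \<le> (real T * \<epsilon>\<^sup>2)\<^sup>2" using h' K by (intro power_mono) auto
      also have "\<dots> = (real T)\<^sup>2 * \<epsilon>\<^sup>2 * \<epsilon>\<^sup>2" by (simp add: power2_eq_square)
      also have "\<dots> \<le> (real T)\<^sup>2 * \<epsilon>\<^sup>2 * 1" using e1 by (intro mult_left_mono) auto
      finally have "K\<^sup>2 * real d * real d \<le> (real T)\<^sup>2 * \<epsilon>\<^sup>2" by (simp add: power2_eq_square mult_ac)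
      then have "K\<^sup>2 * real d \<le> (real T)\<^sup>2 * \<epsilon>\<^sup>2 / real d" using d by (simp add: field_simps)
      also have "\<dots> \<le> (real T)\<^sup>2 * \<theta> * \<gamma>" using d by (simp add: \<theta>_def \<gamma>_def divide_right_mono)
      finally show ?thesis .
    qed
    have ss: "spectral_fun d U p = \<sigma>"
      unfolding s
    proof (rule eq_matI)
      have Uc: "U \<in> carrier_mat d d" using U by (simp add: unitary_mat_def)
      fix i j assume "i < dim_row (spectral_fun d U q)" "j < dim_col (spectral_fun d U q)"
      then show "spectral_fun d U p $$ (i,j) = spectral_fun d U q $$ (i,j)"
        using Uc by (auto simp: spectral_fun_index p_def spectral_fun_dims)
    qed (use U in \<open>auto simp: unitary_mat_def spectral_fun_dims\<close>)
    obtain M where M: "accept_effect (d ^ T) M" "\<forall>\<rho>. (\<forall>t<T. density_mat d (\<rho> t)) \<longrightarrow>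
     (chi_dev d U p \<alpha> (avg_state d T \<rho>) \<le> 0.99 * \<theta> \<longrightarrow> 0.99 \<le> accept_prob M (tensor_all T \<rho>)) \<and>
     (\<theta> < chi_dev d U p \<alpha> (avg_state d T \<rho>) \<longrightarrow> accept_prob M (tensor_all T \<rho>) \<le> 0.01)"
      using chi_dev_test[OF U d T \<gamma>(1,2) p0 \<gamma>(3) sp \<theta> K h1 h2] by blast
    have null: "chi_dev d U p \<alpha> \<sigma> = 0"
      unfolding chi_dev_def ss[symmetric] by (intro sum.neutral ballI) (simp add: conj_spectral_self[OF U])
    have alt: "\<theta> < chi_dev d U p \<alpha> (avg_state d T \<rho>)"
      if \<rho>: "\<forall>t<T. density_mat d (\<rho> t)" and far: "\<epsilon> < D_tr d (avg_state d T \<rho>) \<sigma>" for \<rho>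
    proof -
      have "\<theta> = (2 * \<epsilon>)\<^sup>2" by (simp add: \<theta>_def power_mult_distrib)
      also have "\<dots> < (2 * D_tr d (avg_state d T \<rho>) \<sigma>)\<^sup>2" using far \<epsilon> by (intro power_strict_mono) auto
      also have "\<dots> \<le> chi_dev d U p \<alpha> (avg_state d T \<rho>)"
        using trace_norm_le_chi_dev[OF U density_avg_state[OF T \<rho>], of p \<alpha>] \<sigma> \<alpha> sa by (simp add: ss)
      finally show ?thesis .
    qed
    show ?thesis
      using M alt null \<theta> by (intro exI[of _ M]) auto
  qed
qed

text \<open>The maximum in the first part is stated as two inequalities with denominators cleared.
  Since \<open>K\<close> and \<open>d\<close> are positive, they cannot hold for
  \<open>\<theta> = 0\<close> or a vanishing minimum eigenvalue, in agreement with reading the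
  quotients as infinite.\<close>

theorem theorem2p4:
  "\<exists>K::real. K > 0 \<and>
    (\<forall>(d::nat) \<sigma>. density_mat d \<sigma> \<longrightarrow>
      (\<forall>(\<theta>::real) (T::nat). \<theta> \<ge> 0 \<and> K * real d \<le> real T * \<theta> \<and>
          K * sqrt (real d) \<le> real T * sqrt (\<theta> * min_eigenvalue \<sigma>) \<longrightarrow>
        (\<exists>M. accept_effect (d ^ T) M \<and>
          (\<forall>\<rho>. (\<forall>t<T. density_mat d (\<rho> t)) \<longrightarrow>
             (D_chi2 d (avg_state d T \<rho>) \<sigma> \<le> ereal (0.99 * \<theta>) \<longrightarrow>
                accept_prob M (tensor_all T \<rho>) \<ge> 0.99) \<and>
             (D_chi2 d (avg_state d T \<rho>) \<sigma> > ereal \<theta> \<longrightarrow>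
                accept_prob M (tensor_all T \<rho>) \<le> 0.01)))) \<and>
      (\<forall>(\<epsilon>::real) (T::nat). \<epsilon> > 0 \<and> K * real d / \<epsilon>\<^sup>2 \<le> real T \<longrightarrow>
        (\<exists>M. accept_effect (d ^ T) M \<and>
          (\<forall>\<rho>. (\<forall>t<T. density_mat d (\<rho> t)) \<longrightarrow>
             (avg_state d T \<rho> = \<sigma> \<longrightarrow>
                accept_prob M (tensor_all T \<rho>) \<ge> 0.99) \<and>
             (D_tr d (avg_state d T \<rho>) \<sigma> > \<epsilon> \<longrightarrow>
                accept_prob M (tensor_all T \<rho>) \<le> 0.01)))))"
  by (rule exI[of _ "10 ^ 10"])
    (intro conjI allI impI, simp, (elim conjE, rule chi2_test; (assumption | rule refl)),
      (elim conjE, rule identity_test; (assumption | rule refl)))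

end
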